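(* For all integers $N\ge1$ (and $x\ne y$) we have $$\mathbb{K}_N(x,y)=-\frac{1}{2\pi i}\,\frac{\big(A_N^{-1}(x)A_N(y)\big)_{21}}{x-y},$$ where $$\mathbb{K}_N(x,y)=\sum_{n=0}^{N-1}\frac{P_n(x)}{h_n}\Big[P_n(y)-\lambda P_n''(y)+\lambda V'(y)P_n'(y)\Big].$$
   Context: Standing assumptions: $D\ge 4$ is an even integer, $\lambda>0$, and $V$ is a real polynomial with $V(x)=\gamma x^D+\mathcal{O}(x^{D-1})$, $\gamma>0$. $\mathcal{M}_D(\mathbb{C})$ is the space of complex $D\times D$ matrices; $\chi_A$ is the indicator function of $A$. Sobolev orthogonal polynomials: $\langle P,Q\rangle_S=\int_{\mathbb{R}}P(x)Q(x)e^{-V(x)}dx+\lambda\int_{\mathbb{R}}P'(x)Q'(x)e^{-V(x)}dx$ on real polynomials. $P_n$ ($n\ge0$) is the unique monic polynomial of degree $n$ such that $\langle P_n,P_m\rangle_S=0$ for all $n\ne m$; $h_n=\langle P_n,P_n\rangle_S$. Sibuya solutions: let $\varphi(z)=(\gamma^{-1}V(z))^{1/D}$ on a neighbourhood of infinity, with the branch such that $\varphi(z)=z(1+\mathcal{O}(z^{-1}))$ as $z\to\infty$, and let $\varphi^{-1}$ be its inverse near infinity. Fix $\varrho>0$ sufficiently large that $\varphi$ and $\varphi^{-1}$ are both injective on $\{|z|>\frac12\varrho\}$, $\frac12|z|\le|\varphi(z)|\le 2|z|$ for $|z|\ge\varrho$, and $\frac{(D-1)\varrho^{-D}}{\gamma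 D}\le\frac12$. For $k\in\{0,\dots,2D-1\}$ put $\Omega_k=\varphi^{-1}\big(\{w\in\mathbb{C}:|w|\ge\varrho,\ \pi\frac{k-1}{D}\le\arg w\le\pi\frac{k+1}{D}\}\big)$ (arguments modulo $2\pi$). $F_k$ is the unique entire function with $(-1)^kV'F_k'-F_k''+\lambda^{-1}F_k=0$ on $\mathbb{C}$ and $F_k(z)=1+\mathcal{O}(|z|^{2-D})$ as $|z|\to\infty$, $z\in\Omega_k$. Define $Y_k(z)=i^k e^{-i\pi/4}e^{-\frac12V(z)}F_k(z)$ for $k$ even and $Y_k(z)=i^ke^{-i\pi/4}\lambda\,e^{\frac12V(z)}F_k'(z)$ for $k$ odd. Wronskians: $W[f,g]=fg'-f'g$. The Wronskians $W[Y_k,Y_j]$ are constants and $W[Y_0,Y_D]\ne0$. For $j\in\{1,\dots,D-1\}\setminus\{D/2\}$: $\beta_j=-\frac{W[Y_D,Y_{2j}]}{W[Y_0,Y_D]}$ and $\kappa_j=\frac{W[Y_0,Y_{2j}]}{W[Y_0,Y_D]}$. Contours: $\Sigma_k=e^{2\pi ik/D}[0,+\infty)$ for $0\le k\le D-1$ and $\Sigma=\bigcup_{k=0}^{D-1}\Sigma_k$. All rays are oriented away from the origin, except $\Sigma_{D/2}=(-\infty,0]$, which is oriented towards the origin. "Left" and "right" are relative to the orientation. Weights: for $j\in\{1,\dots,D-1\}\setminus\{D/2\}$ and $z\in\Sigma$, $\omega_j(z)=Y_{2j}(z)e^{-\frac12V(z)}\chi_{\Sigma_j}(z)-\beta_jY_0(z)e^{-\frac12V(z)}\chi_{\Sigma_0}(z)+\kappa_jY_D(z)e^{-\frac12V(z)}\chi_{\Sigma_{D/2}}(z)$,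 and $\boldsymbol{\omega}=(\omega_1,\dots,\omega_{D/2-1},\omega_{D/2+1},\dots,\omega_{D-1})$ (row vector of length $D-2$). The matrix $A_n$ ($n\ge1$): the unique function $A_n:\mathbb{C}\setminus\Sigma\to\mathcal{M}_D(\mathbb{C})$ that is analytic on $\mathbb{C}\setminus\Sigma$; has continuous non-tangential boundary values $A_n^\pm$ (left/right) on $\Sigma\setminus\{0\}$ with $A_n^+(x)=A_n^-(x)\begin{pmatrix}1&e^{-V(x)}\chi_{\mathbb{R}}(x)&\boldsymbol{\omega}(x)\\0&1&\mathbf{0}\\ \mathbf{0}&\mathbf{0}&\mathbb{I}_{D-2}\end{pmatrix}$; is bounded near $0$; and satisfies $A_n(z)=(\mathbb{I}+\mathcal{O}(z^{-1}))\operatorname{diag}(z^{n+D-2},z^{-n},z^{-1},\dots,z^{-1})$ as $z\to\infty$. It exists and $\det A_n\equiv1$. The $(2,1)$ entry of $A_N^{-1}(x)A_N(y)$ involves only the second row of $A_N^{-1}$ and the first column of $A_N$; these have polynomial entries, so for $x$ or $y$ on $\Sigma$ it is understood through this polynomial extension. *)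

theory Defs
  imports
    "HOL-Complex_Analysis.Complex_Analysis"
    "HOL-Computational_Algebra.Polynomial"
    "HOL-Library.Landau_Symbols"
    "Jordan_Normal_Form.Gauss_Jordan_Elimination"
begin

abbreviation cpoly :: "real poly \<Rightarrow> complex \<Rightarrow> complex" where
  "cpoly p \<equiv> poly (map_poly complex_of_real p)"

section \<open>Sobolev orthogonal polynomials\<close>

definition sobolev_inner :: "real poly \<Rightarrow> real \<Rightarrow> real poly \<Rightarrow> real poly \<Rightarrow> real" where
  "sobolev_inner V lam P Q =
     (LBINT x. poly P x * poly Q x * exp (- poly V x))
     + lam * (LBINT x. poly (pderiv P) x * poly (pderiv Q) x * exp (- poly V x))"

definition monic_sobolev_ops :: "real poly \<Rightarrow> real \<Rightarrow> (nat \<Rightarrow> real poly) \<Rightarrow> bool" where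
  "monic_sobolev_ops V lam P \<longleftrightarrow>
     (\<forall>n. Polynomial.degree (P n) = n \<and> Polynomial.lead_coeff (P n) = 1 \<and>
          (\<forall>m. m \<noteq> n \<longrightarrow> sobolev_inner V lam (P n) (P m) = 0))"

definition sobolev_kernel ::
  "real poly \<Rightarrow> real \<Rightarrow> (nat \<Rightarrow> real poly) \<Rightarrow> nat \<Rightarrow> complex \<Rightarrow> complex \<Rightarrow> complex" where
  "sobolev_kernel V lam P N x y =
     (\<Sum>n<N. cpoly (P n) x / of_real (sobolev_inner V lam (P n) (P n)) *
        (cpoly (P n) y - of_real lam * cpoly (pderiv (pderiv (P n))) y
          + of_real lam * cpoly (pderiv V) y * cpoly (pderiv (P n)) y))"

section \<open>Sibuya solutions\<close>

text \<open>\<open>\<phi>\<close> is the branch of the \<open>D\<close>-th root of \<open>V / \<gamma>\<close> asymptotic to the identity, \<open>\<psi>\<close> its inverse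
  near infinity.  The two are only required to be mutually inverse for large arguments: points of
  modulus slightly above \<open>\<rho> / 2\<close> need not be mapped back into the domain of the other function.\<close>

definition sibuya_coordinate ::
  "nat \<Rightarrow> real \<Rightarrow> real poly \<Rightarrow> real \<Rightarrow> (complex \<Rightarrow> complex) \<Rightarrow> (complex \<Rightarrow> complex) \<Rightarrow> bool" where
  "sibuya_coordinate D \<gamma> V \<rho> \<phi> \<psi> \<longleftrightarrow>
     \<rho> > 0 \<and>
     \<phi> holomorphic_on {z. norm z > \<rho> / 2} \<and>
     (\<forall>z. norm z > \<rho> / 2 \<longrightarrow> \<phi> z ^ D = cpoly V z / of_real \<gamma>) \<and>
     (\<lambda>z. \<phi> z / z - 1) \<in> O[at_infinity](\<lambda>z. 1 / z) \<and>
     \<psi> holomorphic_on {w. norm w > \<rho> / 2} \<and>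
     (\<forall>\<^sub>F z in at_infinity. \<psi> (\<phi> z) = z) \<and>
     (\<forall>\<^sub>F w in at_infinity. \<phi> (\<psi> w) = w) \<and>
     inj_on \<phi> {z. norm z > \<rho> / 2} \<and>
     inj_on \<psi> {w. norm w > \<rho> / 2} \<and>
     (\<forall>z. norm z \<ge> \<rho> \<longrightarrow> norm z / 2 \<le> norm (\<phi> z) \<and> norm (\<phi> z) \<le> 2 * norm z) \<and>
     (real D - 1) / (\<rho> ^ D * \<gamma> * real D) \<le> 1 / 2"

definition sibuya_sector :: "nat \<Rightarrow> real \<Rightarrow> (complex \<Rightarrow> complex) \<Rightarrow> nat \<Rightarrow> complex set" where
  "sibuya_sector D \<rho> \<psi> k =
     \<psi> ` {rcis r t |r t. r \<ge> \<rho> \<and> pi * (real k - 1) / real D \<le> t \<and> t \<le> pi * (real k + 1) / real D}"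

definition sibuya_solution ::
  "nat \<Rightarrow> real poly \<Rightarrow> real \<Rightarrow> real \<Rightarrow> (complex \<Rightarrow> complex) \<Rightarrow> nat \<Rightarrow> (complex \<Rightarrow> complex) \<Rightarrow> bool" where
  "sibuya_solution D V lam \<rho> \<psi> k F \<longleftrightarrow>
     F holomorphic_on UNIV \<and>
     (\<forall>z. (- 1) ^ k * cpoly (pderiv V) z * deriv F z - deriv (deriv F) z + F z / of_real lam = 0) \<and>
     (\<lambda>z. F z - 1)
       \<in> O[inf at_infinity (principal (sibuya_sector D \<rho> \<psi> k))](\<lambda>z. of_real (norm z powi (2 - int D)))"

definition sibuya_Y ::
  "real poly \<Rightarrow> real \<Rightarrow> (nat \<Rightarrow> complex \<Rightarrow> complex) \<Rightarrow> nat \<Rightarrow> complex \<Rightarrow> complex" where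
  "sibuya_Y V lam F k z =
     (if even k
      then \<i> ^ k * exp (- \<i> * of_real pi / 4) * exp (- (1/2) * cpoly V z) * F k z
      else \<i> ^ k * exp (- \<i> * of_real pi / 4) * of_real lam * exp ((1/2) * cpoly V z) * deriv (F k) z)"

definition wronskian :: "(complex \<Rightarrow> complex) \<Rightarrow> (complex \<Rightarrow> complex) \<Rightarrow> complex \<Rightarrow> complex" where
  "wronskian f g z = f z * deriv g z - deriv f z * g z"

text \<open>The Wronskians below are constant functions; they are evaluated at \<open>0\<close>.\<close>

definition connection_beta ::
  "nat \<Rightarrow> real poly \<Rightarrow> real \<Rightarrow> (nat \<Rightarrow> complex \<Rightarrow> complex) \<Rightarrow> nat \<Rightarrow> complex" where
  "connection_beta D V lam F j =
     - (wronskian (sibuya_Y V lam F D) (sibuya_Y V lam F (2 * j)) 0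
        / wronskian (sibuya_Y V lam F 0) (sibuya_Y V lam F D) 0)"

definition connection_kappa ::
  "nat \<Rightarrow> real poly \<Rightarrow> real \<Rightarrow> (nat \<Rightarrow> complex \<Rightarrow> complex) \<Rightarrow> nat \<Rightarrow> complex" where
  "connection_kappa D V lam F j =
     wronskian (sibuya_Y V lam F 0) (sibuya_Y V lam F (2 * j)) 0
        / wronskian (sibuya_Y V lam F 0) (sibuya_Y V lam F D) 0"

section \<open>Contours and weights\<close>

definition ray :: "nat \<Rightarrow> nat \<Rightarrow> complex set" where
  "ray D k = {rcis r (2 * pi * real k / real D) |r. r \<ge> 0}"

definition rays :: "nat \<Rightarrow> complex set" where
  "rays D = (\<Union>k<D. ray D k)"

definition ccw_sector :: "nat \<Rightarrow> nat \<Rightarrow> complex set" where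
  "ccw_sector D k =
     {rcis r t |r t. r > 0 \<and> 2 * pi * real k / real D < t \<and> t < 2 * pi * (real k + 1) / real D}"

definition cw_sector :: "nat \<Rightarrow> nat \<Rightarrow> complex set" where
  "cw_sector D k =
     {rcis r t |r t. r > 0 \<and> 2 * pi * (real k - 1) / real D < t \<and> t < 2 * pi * real k / real D}"

text \<open>All rays are oriented away from the origin, except the negative real axis
  \<open>ray D (D div 2)\<close>, which is oriented towards it.\<close>

definition left_side :: "nat \<Rightarrow> nat \<Rightarrow> complex set" where
  "left_side D k = (if k = D div 2 then cw_sector D k else ccw_sector D k)"

definition right_side :: "nat \<Rightarrow> nat \<Rightarrow> complex set" where
  "right_side D k = (if k = D div 2 then ccw_sector D k else cw_sector D k)"

definition ray_weight ::
  "nat \<Rightarrow> real poly \<Rightarrow> real \<Rightarrow> (nat \<Rightarrow> complex \<Rightarrow> complex) \<Rightarrow> nat \<Rightarrow> complex \<Rightarrow> complex" where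
  "ray_weight D V lam F j z =
     sibuya_Y V lam F (2 * j) z * exp (- (1/2) * cpoly V z) * indicator (ray D j) z
     - connection_beta D V lam F j
         * sibuya_Y V lam F 0 z * exp (- (1/2) * cpoly V z) * indicator (ray D 0) z
     + connection_kappa D V lam F j
         * sibuya_Y V lam F D z * exp (- (1/2) * cpoly V z) * indicator (ray D (D div 2)) z"

definition weight_indices :: "nat \<Rightarrow> nat list" where
  "weight_indices D = [1..<D div 2] @ [D div 2 + 1..<D]"

section \<open>The Riemann-Hilbert problem\<close>

text \<open>Rows and columns of matrices are numbered from \<open>0\<close>.\<close>

definition jump_matrix ::
  "nat \<Rightarrow> real poly \<Rightarrow> real \<Rightarrow> (nat \<Rightarrow> complex \<Rightarrow> complex) \<Rightarrow> complex \<Rightarrow> complex mat" where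
  "jump_matrix D V lam F x = Matrix.mat D D (\<lambda>(i, j).
     if i = j then 1
     else if i = 0 \<and> j = 1 then exp (- cpoly V x) * indicator \<real> x
     else if i = 0 then ray_weight D V lam F (weight_indices D ! (j - 2)) x
     else 0)"

definition growth_matrix :: "nat \<Rightarrow> nat \<Rightarrow> complex \<Rightarrow> complex mat" where
  "growth_matrix D n z = mat_diag D (\<lambda>j.
     if j = 0 then z ^ (n + D - 2) else if j = 1 then z powi (- int n) else z powi (- 1))"

text \<open>Continuous boundary values are taken in the sense that \<open>A\<close> extends continuously to the
  contour minus the origin from either side; this contains the existence of non-tangential limits.
  Non-tangential limits that are only taken pointwise, even if they depend continuously on the
  point, would not determine the solution: there are nonzero entire functions \<open>E\<close> tending to \<open>0\<close> along
  every ray and uniformly in closed sectors avoiding one ray, and \<open>E (1 / (z - x0))\<close> with \<open>x0\<close> on the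
  contour then has no jump in this weak sense.\<close>

definition rh_solution ::
  "nat \<Rightarrow> real poly \<Rightarrow> real \<Rightarrow> (nat \<Rightarrow> complex \<Rightarrow> complex) \<Rightarrow> nat \<Rightarrow> (complex \<Rightarrow> complex mat) \<Rightarrow> bool" where
  "rh_solution D V lam F n A \<longleftrightarrow>
     (\<forall>z \<in> - rays D. A z \<in> carrier_mat D D) \<and>
     (\<forall>i<D. \<forall>j<D. (\<lambda>z. A z $$ (i, j)) holomorphic_on (- rays D)) \<and>
     (\<exists>Aplus Aminus.
        (\<forall>x \<in> rays D - {0}. Aplus x \<in> carrier_mat D D \<and> Aminus x \<in> carrier_mat D D \<and>
            Aplus x = Aminus x * jump_matrix D V lam F x) \<and>
        (\<forall>i<D. \<forall>j<D. continuous_on (rays D - {0}) (\<lambda>x. Aplus x $$ (i, j)) \<and>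
            continuous_on (rays D - {0}) (\<lambda>x. Aminus x $$ (i, j))) \<and>
        (\<forall>k<D. \<forall>x \<in> ray D k - {0}. \<forall>i<D. \<forall>j<D.
            ((\<lambda>z. A z $$ (i, j)) \<longlongrightarrow> Aplus x $$ (i, j)) (at x within left_side D k) \<and>
            ((\<lambda>z. A z $$ (i, j)) \<longlongrightarrow> Aminus x $$ (i, j)) (at x within right_side D k))) \<and>
     (\<exists>r>0. \<forall>i<D. \<forall>j<D. bounded ((\<lambda>z. A z $$ (i, j)) ` (ball 0 r - rays D))) \<and>
     (\<exists>R. (\<forall>z \<in> - rays D. R z \<in> carrier_mat D D \<and>
              A z = (1\<^sub>m D + R z) * growth_matrix D n z) \<and>
          (\<forall>i<D. \<forall>j<D. (\<lambda>z. R z $$ (i, j))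
              \<in> O[inf at_infinity (principal (- rays D))](\<lambda>z. 1 / z)))"

section \<open>The (2,1) entry and its polynomial extension\<close>

definition poly_extend :: "complex set \<Rightarrow> (complex \<Rightarrow> complex) \<Rightarrow> complex \<Rightarrow> complex" where
  "poly_extend S f z = (if z \<in> S then poly (THE p. \<forall>u \<in> - S. f u = poly p u) z else f z)"

text \<open>For \<open>x\<close> and \<open>y\<close> off the contour this is the entry in second row and first column of the
  product of \<open>A x\<close> inverse with \<open>A y\<close>.\<close>

definition inverse_product_21 :: "nat \<Rightarrow> (complex \<Rightarrow> complex mat) \<Rightarrow> complex \<Rightarrow> complex \<Rightarrow> complex" where
  "inverse_product_21 D A x y =
     (\<Sum>i<D. poly_extend (rays D) (\<lambda>u. the (mat_inverse (A u)) $$ (1, i)) x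
            * poly_extend (rays D) (\<lambda>u. A u $$ (i, 0)) y)"

end

theory Submission
  imports Defs "HOL-Probability.Sinc_Integral" "Jordan_Normal_Form.Determinant"
begin

text \<open>
  The \<open>(2,1)\<close> entry involves the first column of \<open>A\<close> and the second row of its inverse.  Neither has
  a jump: every jump matrix has a unit vector as first column and as second row, and \<open>det A = 1\<close> (the
  determinant has no jump and tends to \<open>1\<close>).  By Morera's and Liouville's theorems they consist of
  polynomials (\<open>no_jump_polynomial\<close>).  Fix \<open>x\<close> off the rays and let \<open>s\<close> be the second row of
  \<open>A(x)\<^sup>-\<^sup>1 A(y)\<close> as a function of \<open>y\<close>.  At \<open>y = x\<close> it is a unit vector, so its first entry is
  \<open>(y - x) q(y)\<close> with a polynomial \<open>q\<close> of degree below \<open>N + D - 2\<close>, and the claim is that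
  \<open>q = 2\<pi>\<i> K(x, \<cdot>)\<close>.

  Both polynomials are identified by their moments.  For a function with boundary values on the rays
  that behaves like \<open>c / z\<close> at infinity, the jump integrates to \<open>- 2\<pi>\<i> c\<close> over the rays
  (\<open>ray_jump_integral\<close>).  Applied to difference quotients of \<open>s\<close>, this shows that \<open>q\<close> has moment
  \<open>2\<pi>\<i> P\<^sub>m(x)\<close> against \<open>P\<^sub>m exp (- V)\<close> for \<open>m < N\<close>, and moment \<open>0\<close> against each of the other
  \<open>D - 2\<close> weights (\<open>ip_moment\<close>).

  The kernel \<open>K(x, \<cdot>)\<close> is a combination of the polynomials \<open>T P\<^sub>n\<close>, where \<open>T p = p - lam p'' + lam V' p'\<close>.
  Integration by parts gives \<open>\<langle>P, Q\<rangle> = \<integral> P (T Q) exp (- V)\<close>, so orthogonality of the \<open>P\<^sub>n\<close> yields its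
  moments against \<open>P\<^sub>m exp (- V)\<close> (\<open>kernel_poly_exp_moment\<close>).  The Sibuya solutions of even index
  satisfy \<open>T F = 0\<close>, and \<open>T\<close> is formally self-adjoint for the weight \<open>exp (- V)\<close>; hence the integral
  of \<open>T Q\<close> against a weight reduces to boundary terms at the origin, and \<open>\<beta>\<close> and \<open>\<kappa>\<close> are the
  coefficients for which these cancel (\<open>weight_moment_sobolev_op\<close>).  This uses that the Wronskian of
  \<open>Y\<^sub>0\<close> and \<open>Y\<^sub>D\<close> does not vanish, which follows from an energy estimate on the real axis.

  So \<open>q\<close> and \<open>2\<pi>\<i> K(x, \<cdot>)\<close> have the same \<open>N + D - 2\<close> moments.  These determine a polynomial of degree
  below \<open>N + D - 2\<close> (\<open>moments_determine\<close>): the entries of the first column of \<open>A\<close> in rows \<open>3, \<dots>, D\<close>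
  are dual to the \<open>D - 2\<close> weights, again by \<open>ray_jump_integral\<close>, and the \<open>T P\<^sub>n\<close> with \<open>n < N\<close> to the
  remaining moments.  Points \<open>x\<close> on the rays are reached because both sides are polynomials in \<open>x\<close>.
\<close>

section \<open>Sectors and rays\<close>

definition cone :: "real \<Rightarrow> real \<Rightarrow> complex set" where
  "cone a b = {rcis r t |r t. 0 < r \<and> a < t \<and> t < b}"

text \<open>The vertex is excluded: boundary values are not defined at the origin.\<close>

definition closed_cone :: "real \<Rightarrow> real \<Rightarrow> complex set" where
  "closed_cone a b = {rcis r t |r t. 0 < r \<and> a \<le> t \<and> t \<le> b}"

lemma Re_rcis_rotate: "Re (rcis r t * cis (- s)) = r * cos (t - s)"
proof -
  have "rcis r t * cis (- s) = rcis r (t - s)"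
    by (simp add: rcis_def cis_mult mult.assoc)
  then show ?thesis by simp
qed

lemma rotated_polar_form:
  "\<exists>t. \<bar>t - s\<bar> \<le> pi \<and> z = rcis (norm z) t \<and> Re (z * cis (- s)) = norm z * cos (t - s)"
proof -
  let ?u = "z * cis (- s)"
  have n: "norm ?u = norm z" by (simp add: norm_mult)
  have "z = ?u * cis s" by (simp add: cis_mult mult.assoc)
  also have "\<dots> = rcis (norm ?u) (Arg ?u) * cis s" by (simp add: rcis_cmod_Arg)
  also have "\<dots> = rcis (norm z) (Arg ?u + s)" by (simp add: n rcis_def cis_mult mult.assoc)
  finally have z: "z = rcis (norm z) (Arg ?u + s)" .
  have "\<bar>Arg ?u\<bar> \<le> pi" using Arg_bounded[of ?u] by auto
  moreover have "Re ?u = norm z * cos (Arg ?u)"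
    by (metis Re_rcis n rcis_cmod_Arg)
  ultimately show ?thesis using z by (intro exI[of _ "Arg ?u + s"]) auto
qed

text \<open>A sector of opening at most \<open>\<pi>\<close> is a round cone about its bisector; in this form openness
  and convexity are immediate.\<close>

lemma cone_iff:
  assumes "a < b" "b - a \<le> pi"
  shows "z \<in> cone a b \<longleftrightarrow>
    0 < Re (z * cis (- ((a + b) / 2))) \<and> cos ((b - a) / 2) * norm z < Re (z * cis (- ((a + b) / 2)))"
proof -
  let ?s = "(a + b) / 2" and ?h = "(b - a) / 2"
  have h: "0 < ?h" "?h \<le> pi / 2" using assms by auto
  have ch: "0 \<le> cos ?h" using h by (intro cos_ge_zero) auto
  show ?thesis
  proof
    assume "z \<in> cone a b"
    then obtain r t where rt: "z = rcis r t" "0 < r" "a < t" "t < b" by (auto simp: cone_def)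
    have "\<bar>t - ?s\<bar> < ?h" using rt by (auto simp: abs_if field_simps)
    then have "cos ?h < cos \<bar>t - ?s\<bar>"
      using h by (subst cos_mono_less_eq) auto
    then have c: "cos ?h < cos (t - ?s)" by (simp only: cos_abs_real)
    then have "r * cos ?h < r * cos (t - ?s)" "0 < r * cos (t - ?s)"
      using rt ch by (auto intro!: mult_strict_left_mono mult_pos_pos)
    then show "0 < Re (z * cis (- ?s)) \<and> cos ?h * norm z < Re (z * cis (- ?s))"
      using rt by (simp only: Re_rcis_rotate) (simp add: mult.commute)
  next
    assume A: "0 < Re (z * cis (- ?s)) \<and> cos ?h * norm z < Re (z * cis (- ?s))"
    obtain t where t: "\<bar>t - ?s\<bar> \<le> pi" "z = rcis (norm z) t" "Re (z * cis (- ?s)) = norm z * cos (t - ?s)"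
      using rotated_polar_form by blast
    have z: "norm z > 0" using A by auto
    then have "cos ?h < cos \<bar>t - ?s\<bar>" using A t by (simp add: mult.commute)
    then have "\<bar>t - ?s\<bar> < ?h" using h t(1) by (subst (asm) cos_mono_less_eq) auto
    then have "a < t" "t < b" by (auto simp: abs_if field_simps split: if_splits)
    then show "z \<in> cone a b" using z t(2) unfolding cone_def by blast
  qed
qed

lemma closed_cone_iff:
  assumes "a < b" "b - a < pi"
  shows "z \<in> closed_cone a b \<longleftrightarrow>
    0 < Re (z * cis (- ((a + b) / 2))) \<and> cos ((b - a) / 2) * norm z \<le> Re (z * cis (- ((a + b) / 2)))"
proof -
  let ?s = "(a + b) / 2" and ?h = "(b - a) / 2"
  have h: "0 < ?h" "?h < pi / 2" using assms by auto
  have ch: "0 < cos ?h" using h by (intro cos_gt_zero_pi) auto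
  show ?thesis
  proof
    assume "z \<in> closed_cone a b"
    then obtain r t where rt: "z = rcis r t" "0 < r" "a \<le> t" "t \<le> b" by (auto simp: closed_cone_def)
    have "\<bar>t - ?s\<bar> \<le> ?h" using rt by (auto simp: abs_if field_simps)
    then have "cos ?h \<le> cos \<bar>t - ?s\<bar>"
      using h by (subst cos_mono_le_eq) auto
    then have c: "cos ?h \<le> cos (t - ?s)" by (simp only: cos_abs_real)
    then have "r * cos ?h \<le> r * cos (t - ?s)" "0 < r * cos (t - ?s)"
      using rt ch by (auto intro!: mult_left_mono mult_pos_pos)
    then show "0 < Re (z * cis (- ?s)) \<and> cos ?h * norm z \<le> Re (z * cis (- ?s))"
      using rt by (simp only: Re_rcis_rotate) (simp add: mult.commute)
  next
    assume A: "0 < Re (z * cis (- ?s)) \<and> cos ?h * norm z \<le> Re (z * cis (- ?s))"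
    obtain t where t: "\<bar>t - ?s\<bar> \<le> pi" "z = rcis (norm z) t" "Re (z * cis (- ?s)) = norm z * cos (t - ?s)"
      using rotated_polar_form by blast
    have z: "norm z > 0" using A by auto
    then have "cos ?h \<le> cos \<bar>t - ?s\<bar>" using A t by (simp add: mult.commute)
    then have "\<bar>t - ?s\<bar> \<le> ?h" using h t(1) by (subst (asm) cos_mono_le_eq) auto
    then have "a \<le> t" "t \<le> b" by (auto simp: abs_if field_simps split: if_splits)
    then show "z \<in> closed_cone a b" using z t(2) unfolding closed_cone_def by blast
  qed
qed

lemma open_cone: assumes "a < b" "b - a \<le> pi" shows "open (cone a b)"
proof -
  have "cone a b = {z. 0 < Re (z * cis (- ((a + b) / 2)))} \<inter>
      {z. cos ((b - a) / 2) * norm z < Re (z * cis (- ((a + b) / 2)))}"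
    using cone_iff[OF assms] by blast
  also have "open \<dots>"
    by (intro open_Int open_Collect_less continuous_intros)
  finally show ?thesis .
qed

lemma convex_closed_cone: assumes "a < b" "b - a < pi" shows "convex (closed_cone a b)"
proof (rule convexI)
  let ?s = "(a + b) / 2" and ?c = "cos ((b - a) / 2)"
  fix x y :: complex and u v :: real
  assume xy: "x \<in> closed_cone a b" "y \<in> closed_cone a b" and uv: "0 \<le> u" "0 \<le> v" "u + v = 1"
  have c: "0 \<le> ?c" using assms by (intro cos_ge_zero) auto
  have R: "Re ((u *\<^sub>R x + v *\<^sub>R y) * cis (- ?s)) = u * Re (x * cis (- ?s)) + v * Re (y * cis (- ?s))"
    by (simp add: algebra_simps)
  note X = xy[unfolded closed_cone_iff[OF assms]]
  have "0 < u * Re (x * cis (- ?s)) + v * Re (y * cis (- ?s))"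
  proof (cases "u = 0")
    case True then show ?thesis using uv X by simp
  next
    case False then show ?thesis using uv X by (intro add_pos_nonneg mult_pos_pos mult_nonneg_nonneg) auto
  qed
  moreover have "?c * norm (u *\<^sub>R x + v *\<^sub>R y) \<le> ?c * (u * norm x + v * norm y)"
    using uv c by (intro mult_left_mono order.trans[OF norm_triangle_ineq]) auto
  then have "?c * norm (u *\<^sub>R x + v *\<^sub>R y) \<le> u * (?c * norm x) + v * (?c * norm y)"
    by (simp add: algebra_simps)
  moreover have "u * (?c * norm x) + v * (?c * norm y) \<le> u * Re (x * cis (- ?s)) + v * Re (y * cis (- ?s))"
    using uv X by (intro add_mono mult_left_mono) auto
  ultimately show "u *\<^sub>R x + v *\<^sub>R y \<in> closed_cone a b"
    unfolding closed_cone_iff[OF assms] R by linarith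
qed

definition ray_dir :: "nat \<Rightarrow> nat \<Rightarrow> complex" where
  "ray_dir D k = cis (2 * pi * real k / real D)"

lemma ray_dir_D [simp]: "D > 0 \<Longrightarrow> ray_dir D D = 1"
  by (simp add: ray_dir_def)

lemma ray_dir_0 [simp]: "ray_dir D 0 = 1"
  by (simp add: ray_dir_def)

lemma norm_ray_dir [simp]: "norm (ray_dir D k) = 1"
  by (simp add: ray_dir_def)

lemma ray_dir_half: "even D \<Longrightarrow> D > 0 \<Longrightarrow> ray_dir D (D div 2) = -1"
proof -
  assume D: "even D" "D > 0"
  then have "2 * pi * real (D div 2) / real D = pi"
    by (simp add: real_of_nat_div)
  then show ?thesis by (simp add: ray_dir_def)
qed

lemma mem_ray_iff: "x \<in> ray D k - {0} \<longleftrightarrow> (\<exists>r>0. x = of_real r * ray_dir D k)"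
  by (force simp: ray_def ray_dir_def rcis_def)

lemma mem_ray_iff': "x \<in> ray D k \<longleftrightarrow> (\<exists>r\<ge>0. x = of_real r * ray_dir D k)"
  by (auto simp: ray_def ray_dir_def rcis_def)

lemma ccw_sector_cone: "ccw_sector D k = cone (2 * pi * real k / real D) (2 * pi * (real k + 1) / real D)"
  by (auto simp: ccw_sector_def cone_def)

lemma cw_sector_cone: "cw_sector D k = cone (2 * pi * (real k - 1) / real D) (2 * pi * real k / real D)"
  by (auto simp: cw_sector_def cone_def)

lemma rcis_eq_iff_shift:
  assumes "rcis r t = rcis s u" "r > 0" "s \<ge> 0"
  shows "r = s" "\<exists>n::int. t = u + 2 * pi * of_int n"
proof -
  have "norm (rcis r t) = norm (rcis s u)" using assms(1) by (rule arg_cong)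
  then show rs: "r = s" using assms(2,3) by (metis abs_of_nonneg abs_of_pos complex_mod_rcis)
  have "cis t = cis u" using assms rs by (simp add: rcis_def)
  then have "cis (t - u) = 1" by (simp add: cis_divide[symmetric])
  then have "cos (t - u) = 1" by (simp add: complex_eq_iff)
  then obtain n::int where "t - u = of_int n * 2 * pi" using cos_one_2pi_int by blast
  then show "\<exists>n::int. t = u + 2 * pi * of_int n" by (intro exI[of _ n]) (simp add: algebra_simps)
qed

lemma ccw_sector_disjoint_rays: assumes "D > 0" shows "ccw_sector D k \<inter> rays D = {}"
proof -
  { fix z assume "z \<in> ccw_sector D k" "z \<in> rays D"
    then obtain r t s j where *: "z = rcis r t" "r > 0" "2*pi*real k / real D < t" "t < 2*pi*(real k+1)/real D"
       "z = rcis s (2*pi*real j/real D)" "s \<ge> 0"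
      unfolding ccw_sector_def rays_def ray_def by blast
    then obtain n::int where "t = 2*pi*real j/real D + 2*pi* of_int n"
      using rcis_eq_iff_shift(2)[of r t s "2*pi*real j/real D"] by auto
    then have "t = 2*pi*(of_int (int j + n * int D)) / real D" using assms by (simp add: field_simps)
    then have "real k < of_int (int j + n * int D)" "of_int (int j + n * int D) < real k + 1"
      using * assms by (simp_all add: divide_less_cancel)
    then have "int k < int j + n * int D" "int j + n * int D < int k + 1" by linarith+
    then have False by linarith }
  then show ?thesis by auto
qed

lemma cw_sector_Suc: "cw_sector D (Suc k) = ccw_sector D k"
  by (simp add: cw_sector_def ccw_sector_def add.commute)

lemma rcis_shift: "rcis r (t + 2 * pi * of_int n) = rcis r t"
  using cos_int_2pin[of n] sin_int_2pin[of n]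
  by (simp add: rcis_def cis_mult[symmetric] complex_eq_iff)

lemma cone_shift: "cone (a + 2 * pi * of_int n) (b + 2 * pi * of_int n) = cone a b"
proof
  show "cone (a + 2 * pi * of_int n) (b + 2 * pi * of_int n) \<subseteq> cone a b"
  proof
    fix z assume "z \<in> cone (a + 2 * pi * of_int n) (b + 2 * pi * of_int n)"
    then obtain r t where "z = rcis r t" "0 < r" "a + 2 * pi * of_int n < t" "t < b + 2 * pi * of_int n"
      by (auto simp: cone_def)
    then show "z \<in> cone a b" unfolding cone_def
      using rcis_shift[of r t "-n"] by (intro CollectI exI[of _ r] exI[of _ "t + 2*pi* of_int (-n)"]) auto
  qed
  show "cone a b \<subseteq> cone (a + 2 * pi * of_int n) (b + 2 * pi * of_int n)"
  proof
    fix z assume "z \<in> cone a b"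
    then obtain r t where "z = rcis r t" "0 < r" "a < t" "t < b"
      by (auto simp: cone_def)
    then show "z \<in> cone (a + 2 * pi * of_int n) (b + 2 * pi * of_int n)" unfolding cone_def
      using rcis_shift[of r t "n"] by (intro CollectI exI[of _ r] exI[of _ "t + 2*pi* of_int n"]) auto
  qed
qed

lemma cw_sector_D: "D > 0 \<Longrightarrow> cw_sector D D = cw_sector D 0"
  using cone_shift[of "2 * pi * (- 1) / real D" 1 0]
  by (simp add: cw_sector_cone field_simps)

lemma ray_D: "D > 0 \<Longrightarrow> ray D D = ray D 0"
  by (auto simp: ray_def rcis_def)

text \<open>Every sector is the clockwise side of the next ray, in the cyclic order.\<close>

lemma cw_sector_mod: "k < D \<Longrightarrow> cw_sector D (Suc k mod D) = ccw_sector D k"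
  using cw_sector_D[of D] cw_sector_Suc[of D k] by (cases "Suc k = D") auto

lemma ray_mod: "k < D \<Longrightarrow> ray D (Suc k mod D) = ray D (Suc k)"
  using ray_D[of D] by (cases "Suc k = D") auto

lemma zero_in_rays: "D > 0 \<Longrightarrow> 0 \<in> rays D"
  by (force simp: rays_def ray_def)

lemma cw_sector_disjoint_rays: assumes "D > 0" shows "cw_sector D k \<inter> rays D = {}"
proof (cases k)
  case (Suc k') then show ?thesis using ccw_sector_disjoint_rays[OF assms, of k'] by (simp add: cw_sector_Suc)
next
  case 0
  have "cw_sector D 0 = ccw_sector D (D - 1)"
    using cw_sector_D[OF assms] cw_sector_Suc[of D "D - 1"] assms by simp
  then show ?thesis using ccw_sector_disjoint_rays[OF assms] 0 by simp
qed

lemma rays_distinct: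
  assumes "j < D" "k < D" "j \<noteq> k" shows "ray D j \<inter> ray D k = {0}"
proof -
  { fix z assume z: "z \<in> ray D j" "z \<in> ray D k" "z \<noteq> 0"
    then obtain r s where *: "z = rcis r (2*pi*real j/real D)" "r \<ge> 0" "z = rcis s (2*pi*real k/real D)" "s \<ge> 0"
      unfolding ray_def by blast
    have "r > 0" using * z by (cases "r = 0") auto
    then obtain n::int where "2*pi*real j/real D = 2*pi*real k/real D + 2*pi* of_int n"
      using rcis_eq_iff_shift(2)[of r "2*pi*real j/real D" s "2*pi*real k/real D"] * by auto
    then have "2*pi*real_of_int (int j) = 2*pi*real_of_int(int k + n * int D)" using assms by (simp add: field_simps)
    then have "real_of_int (int j) = real_of_int (int k + n * int D)" 
      by simp
    then have jk: "int j = int k + n * int D" by linarith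
    have "n = 0"
    proof (rule ccontr)
      assume "n \<noteq> 0"
      then have "int D * 1 \<le> int D * \<bar>n\<bar>" by (intro mult_left_mono) auto
      then have "int D \<le> \<bar>n * int D\<bar>" by (simp add: abs_mult mult.commute)
      then show False using jk assms by linarith
    qed
    then have False using jk assms by simp }
  moreover have "0 \<in> ray D j" "0 \<in> ray D k" by (force simp: ray_def)+
  ultimately show ?thesis by auto
qed

lemma closed_ray: "closed (ray D k)"
proof -
  have "ray D k = (\<lambda>z. z * cis (- (2 * pi * real k / real D))) -` \<real>\<^sub>\<ge>\<^sub>0"
  proof (intro Set.set_eqI iffI)
    fix z assume "z \<in> ray D k"
    then show "z \<in> (\<lambda>z. z * cis (- (2 * pi * real k / real D))) -` \<real>\<^sub>\<ge>\<^sub>0"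
      by (auto simp: ray_def rcis_def cis_mult mult.assoc)
  next
    fix z assume "z \<in> (\<lambda>z. z * cis (- (2 * pi * real k / real D))) -` \<real>\<^sub>\<ge>\<^sub>0"
    then obtain r where r: "z * cis (- (2 * pi * real k / real D)) = of_real r" "r \<ge> 0"
      by (auto elim!: nonneg_Reals_cases)
    have "z = z * cis (- (2 * pi * real k / real D)) * cis (2 * pi * real k / real D)"
      by (simp add: mult.assoc cis_mult)
    then show "z \<in> ray D k" using r unfolding ray_def rcis_def by auto
  qed
  then show ?thesis by (simp add: closed_vimage continuous_intros)
qed

lemma closed_rays: "closed (rays D)"
  unfolding rays_def by (auto intro: closed_ray)

lemma ccw_sector_subset: "D > 0 \<Longrightarrow> ccw_sector D k \<subseteq> - rays D"
  using ccw_sector_disjoint_rays by blast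

lemma cw_sector_subset: "D > 0 \<Longrightarrow> cw_sector D k \<subseteq> - rays D"
  using cw_sector_disjoint_rays by blast

lemma open_ccw_sector: "D \<ge> 2 \<Longrightarrow> open (ccw_sector D k)"
  unfolding ccw_sector_cone by (rule open_cone) (auto simp: field_simps)

lemma cone_edges_closure:
  assumes "a < b" "r > 0"
  shows "rcis r a \<in> closure (cone a b)" "rcis r b \<in> closure (cone a b)"
proof -
  have "rcis r t \<in> cone a b" if "t \<in> {a<..<b}" for t
    unfolding cone_def using that assms(2) by (intro CollectI exI[of _ r] exI[of _ t]) auto
  then have "rcis r ` {a<..<b} \<subseteq> cone a b" by blast
  then have sub: "closure (rcis r ` {a<..<b}) \<subseteq> closure (cone a b)" by (rule closure_mono)
  have "rcis r ` closure {a<..<b} \<subseteq> closure (rcis r ` {a<..<b})"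
    by (rule image_closure_subset[OF _ closed_closure closure_subset])
       (auto simp: rcis_def intro!: continuous_intros)
  then have "rcis r ` {a..b} \<subseteq> closure (cone a b)" using sub assms by auto
  then show "rcis r a \<in> closure (cone a b)" "rcis r b \<in> closure (cone a b)"
    using assms by auto
qed

text \<open>This makes limits along a sector at a point of its edge unique.\<close>

lemma islimpt_sectors:
  assumes "x \<in> ray D k - {0}" "k < D"
  shows "x islimpt ccw_sector D k" "x islimpt cw_sector D k"
proof -
  obtain r where r0: "r > 0" "x = of_real r * ray_dir D k"
    using assms(1)[unfolded mem_ray_iff] by (elim exE conjE)
  have r: "r > 0" "x = rcis r (2 * pi * real k / real D)"
    using r0 by (simp_all only: ray_dir_def rcis_def)
  have "x \<in> rays D" using assms unfolding rays_def by blast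
  then have n: "x \<notin> ccw_sector D k" "x \<notin> cw_sector D k"
    using disjoint_iff[THEN iffD1, OF ccw_sector_disjoint_rays[of D k]]
      disjoint_iff[THEN iffD1, OF cw_sector_disjoint_rays[of D k]] assms(2) by auto
  have lt: "2 * pi * real k / real D < 2 * pi * (real k + 1) / real D"
    "2 * pi * (real k - 1) / real D < 2 * pi * real k / real D"
  proof -
    have "0 < real D" using assms(2) by simp
    then show "2 * pi * real k / real D < 2 * pi * (real k + 1) / real D"
      "2 * pi * (real k - 1) / real D < 2 * pi * real k / real D"
      by (intro divide_strict_right_mono mult_strict_left_mono; simp)+
  qed
  have c1: "x \<in> closure (ccw_sector D k)"
    unfolding ccw_sector_cone r(2) by (rule cone_edges_closure(1)[OF lt(1) r(1)])
  have c2: "x \<in> closure (cw_sector D k)"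
    unfolding cw_sector_cone r(2) by (rule cone_edges_closure(2)[OF lt(2) r(1)])
  show "x islimpt ccw_sector D k" using c1 n(1) unfolding closure_def by blast
  show "x islimpt cw_sector D k" using c2 n(2) unfolding closure_def by blast
qed

section \<open>Functions with boundary values on the rays\<close>

text \<open>The boundary values on the \<open>k\<close>-th ray are named by the adjacent sector (counterclockwise or
  clockwise of the ray), not by the orientation of the contour; this makes all rays alike.\<close>

definition side_limits ::
  "nat \<Rightarrow> (complex \<Rightarrow> complex) \<Rightarrow> (nat \<Rightarrow> complex \<Rightarrow> complex) \<Rightarrow> (nat \<Rightarrow> complex \<Rightarrow> complex) \<Rightarrow> bool" where
  "side_limits D f hp hm \<longleftrightarrow>
     (\<forall>k<D. continuous_on (ray D k - {0}) (hp k) \<and> continuous_on (ray D k - {0}) (hm k) \<and>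
        (\<forall>x \<in> ray D k - {0}. (f \<longlongrightarrow> hp k x) (at x within ccw_sector D k) \<and>
                            (f \<longlongrightarrow> hm k x) (at x within cw_sector D k)))"

definition bounded_near_0 :: "nat \<Rightarrow> (complex \<Rightarrow> complex) \<Rightarrow> bool" where
  "bounded_near_0 D f \<longleftrightarrow> (\<exists>r>0. bounded (f ` (ball 0 r - rays D)))"

definition no_jump :: "nat \<Rightarrow> (complex \<Rightarrow> complex) \<Rightarrow> (complex \<Rightarrow> complex) \<Rightarrow> bool" where
  "no_jump D f g \<longleftrightarrow> side_limits D f (\<lambda>_. g) (\<lambda>_. g)"

lemma bounded_near_0_lim:
  assumes "bounded_near_0 D f"
  obtains r M where "r > 0" "M > 0" "\<And>z. z \<in> ball 0 r - rays D \<Longrightarrow> norm (f z) \<le> M"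
  using assms unfolding bounded_near_0_def bounded_pos by (metis imageI)

text \<open>The opening is at most \<open>\<pi>\<close> because \<open>D \<ge> 4\<close>.\<close>

definition wedge :: "nat \<Rightarrow> nat \<Rightarrow> complex set" where
  "wedge D k = cone (2 * pi * (real k - 1) / real D) (2 * pi * (real k + 1) / real D)"

lemma wedge_split:
  assumes "D > 0"
  shows "wedge D k = cw_sector D k \<union> (ray D k - {0}) \<union> ccw_sector D k"
proof (intro equalityI subsetI)
  let ?t = "2 * pi * real k / real D"
  have lt: "2 * pi * (real k - 1) / real D < ?t" "?t < 2 * pi * (real k + 1) / real D"
    using assms by (auto intro!: divide_strict_right_mono)
  { fix z assume "z \<in> wedge D k"
    then obtain r t where rt: "z = rcis r t" "0 < r" "2 * pi * (real k - 1) / real D < t"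
      "t < 2 * pi * (real k + 1) / real D" by (auto simp: wedge_def cone_def)
    consider "t < ?t" | "t = ?t" | "t > ?t" by linarith
    then show "z \<in> cw_sector D k \<union> (ray D k - {0}) \<union> ccw_sector D k"
    proof cases
      case 1 then have "z \<in> cw_sector D k" unfolding cw_sector_cone cone_def using rt by blast
      then show ?thesis by blast
    next
      case 2 then have "z \<in> ray D k - {0}" unfolding mem_ray_iff ray_dir_def rcis_def[symmetric] using rt by blast
      then show ?thesis by blast
    next
      case 3 then have "z \<in> ccw_sector D k" unfolding ccw_sector_cone cone_def using rt by blast
      then show ?thesis by blast
    qed }
  { fix z assume "z \<in> cw_sector D k \<union> (ray D k - {0}) \<union> ccw_sector D k"
    then obtain r t where "z = rcis r t" "0 < r" "2 * pi * (real k - 1) / real D < t"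
      "t < 2 * pi * (real k + 1) / real D"
    proof (elim UnE)
      assume "z \<in> cw_sector D k"
      then obtain r t where "z = rcis r t" "0 < r" "2 * pi * (real k - 1) / real D < t" "t < ?t"
        unfolding cw_sector_cone cone_def by blast
      then show ?thesis using that[of r t] lt by linarith
    next
      assume "z \<in> ccw_sector D k"
      then obtain r t where "z = rcis r t" "0 < r" "?t < t" "t < 2 * pi * (real k + 1) / real D"
        unfolding ccw_sector_cone cone_def by blast
      then show ?thesis using that[of r t] lt by linarith
    next
      assume "z \<in> ray D k - {0}"
      then obtain r where "r > 0" "z = rcis r ?t"
        unfolding mem_ray_iff ray_dir_def rcis_def[symmetric] by blast
      then show ?thesis using that[of r ?t] lt by blast
    qed
    then show "z \<in> wedge D k" unfolding wedge_def cone_def by blast }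
qed

lemma open_wedge: "D \<ge> 4 \<Longrightarrow> open (wedge D k)"
  unfolding wedge_def by (rule open_cone) (auto simp: field_simps)

lemma Im_rcis_rotate: "Im (rcis r t * cis (- s)) = r * sin (t - s)"
proof -
  have "rcis r t * cis (- s) = rcis r (t - s)"
    by (simp add: rcis_def cis_mult mult.assoc)
  then show ?thesis by simp
qed

text \<open>Once the ray is rotated to the positive axis, the sign of the imaginary part separates the two
  sides, so functions can be pasted across a straight line.\<close>

lemma wedge_Im_sides:
  assumes D: "D \<ge> 4" and z: "z \<in> wedge D k"
  defines "u \<equiv> z * cis (- (2 * pi * real k / real D))"
  shows "0 < Im u \<longleftrightarrow> z \<in> ccw_sector D k" "Im u < 0 \<longleftrightarrow> z \<in> cw_sector D k"
    "Im u = 0 \<longleftrightarrow> z \<in> ray D k - {0}"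
proof -
  let ?t = "2 * pi * real k / real D"
  have q: "2 * pi / real D \<le> pi / 2" using D by (simp add: field_simps)
  have sn: "Im (rcis r t * cis (- ?t)) = r * sin (t - ?t)" for r t
    by (rule Im_rcis_rotate)
  have cc: "0 < Im u" if zz: "z \<in> ccw_sector D k"
  proof -
    obtain r t where rt: "z = rcis r t" "0 < r" "?t < t" "t < 2 * pi * (real k + 1) / real D"
      using zz unfolding ccw_sector_cone cone_def by blast
    have "0 < t - ?t" "t - ?t < 2 * pi / real D"
      using rt by (auto simp: distrib_left add_divide_distrib)
    then have "0 < sin (t - ?t)" using q pi_gt_zero by (intro sin_gt_zero) linarith+
    then show ?thesis unfolding u_def rt(1) sn using rt by simp
  qed
  have cw: "Im u < 0" if zz: "z \<in> cw_sector D k"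
  proof -
    obtain r t where rt: "z = rcis r t" "0 < r" "2 * pi * (real k - 1) / real D < t" "t < ?t"
      using zz unfolding cw_sector_cone cone_def by blast
    have "0 < ?t - t" "?t - t < 2 * pi / real D"
      using rt by (auto simp: right_diff_distrib diff_divide_distrib)
    then have "0 < sin (?t - t)" using q pi_gt_zero by (intro sin_gt_zero) linarith+
    then have "sin (t - ?t) < 0" using sin_minus[of "?t - t"] by simp
    then show ?thesis unfolding u_def rt(1) sn using rt by (simp add: mult_pos_neg)
  qed
  have r0: "Im u = 0" if zz: "z \<in> ray D k - {0}"
  proof -
    obtain r where "z = rcis r ?t" 
      using zz unfolding mem_ray_iff ray_dir_def rcis_def[symmetric] by blast
    then show ?thesis unfolding u_def by (simp only: sn) simp
  qed
  have "z \<in> cw_sector D k \<or> z \<in> ray D k - {0} \<or> z \<in> ccw_sector D k"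
    using z wedge_split[of D k] D by auto
  then show "0 < Im u \<longleftrightarrow> z \<in> ccw_sector D k" "Im u < 0 \<longleftrightarrow> z \<in> cw_sector D k"
    "Im u = 0 \<longleftrightarrow> z \<in> ray D k - {0}"
    using cc cw r0 by (smt (verit))+
qed

lemma tendsto_within_cong:
  assumes "(f \<longlongrightarrow> l) (at x within S)" "\<And>z. z \<in> S \<Longrightarrow> h z = f z"
  shows "(h \<longlongrightarrow> l) (at x within S)"
  using assms(1) by (rule Lim_transform_eventually) (auto simp: eventually_at_topological assms(2))

lemma eventually_within_open:
  assumes "open A" "x \<in> A"
  shows "\<forall>\<^sub>F z in at x within S. z \<in> S \<and> z \<in> A"
  using assms unfolding eventually_at_topological by blast

text \<open>Bounds that hold off the rays pass to the boundary values.\<close>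

lemma norm_boundary_value_le:
  assumes lim: "(f \<longlongrightarrow> l) (at x within S)" and x: "x islimpt S"
    and A: "open A" "x \<in> A" and M: "\<And>z. z \<in> S \<Longrightarrow> z \<in> A \<Longrightarrow> norm (f z) \<le> M"
  shows "norm l \<le> M"
proof (rule tendsto_upperbound[OF tendsto_norm[OF lim]])
  show "\<forall>\<^sub>F z in at x within S. norm (f z) \<le> M"
    using eventually_within_open[OF A] by eventually_elim (blast intro: M)
  show "at x within S \<noteq> bot" using x by (simp add: trivial_limit_within)
qed

lemma ray_disjoint_sectors:
  assumes "D > 0" "k < D" "x \<in> ray D k"
  shows "x \<notin> ccw_sector D j" "x \<notin> cw_sector D j"
proof -
  have "x \<in> rays D" using assms unfolding rays_def by blast
  then show "x \<notin> ccw_sector D j" "x \<notin> cw_sector D j"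
    using ccw_sector_disjoint_rays[OF assms(1), of j] cw_sector_disjoint_rays[OF assms(1), of j] by blast+
qed

text \<open>Across each ray the two halves of a neighbouring wedge are glued by Morera's theorem, and
  the origin is then a removable singularity.\<close>

lemma no_jump_entire:
  assumes D: "D \<ge> 4" and hol: "f holomorphic_on (- rays D)" and nj: "no_jump D f g"
    and bd: "bounded_near_0 D f"
  obtains F where "F holomorphic_on UNIV" "\<And>z. z \<in> - rays D \<Longrightarrow> F z = f z"
    "\<And>x. x \<in> rays D - {0} \<Longrightarrow> F x = g x"
proof -
  have D0: "D > 0" using D by simp
  define h where "h z = (if z \<in> rays D then g z else f z)" for z
  have opn: "open (- rays D)" using closed_rays by (simp add: open_Compl)
  have hf: "h holomorphic_on (- rays D)"
    by (rule holomorphic_transform[OF hol]) (simp add: h_def)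
  have hw: "h holomorphic_on wedge D k" if k: "k < D" for k
  proof -
    let ?c = "cis (- (2 * pi * real k / real D))"
    let ?d = "\<i> * cnj ?c"
    have inn: "?d \<bullet> z = Im (z * ?c)" for z
      by (simp add: inner_complex_def algebra_simps)
    have c: "continuous_on (wedge D k) h"
    proof -
      have "isCont h x" if x: "x \<in> wedge D k" for x
      proof (cases "x \<in> rays D")
        case False
        then show ?thesis using hf opn
          by (meson ComplI continuous_on_eq_continuous_at holomorphic_on_imp_continuous_on)
      next
        case True
        then have xr: "x \<in> ray D k - {0}" 
          using x wedge_split[OF D0, of k] ccw_sector_disjoint_rays[OF D0, of k] cw_sector_disjoint_rays[OF D0, of k] by blast
        have hx: "h x = g x" using True by (simp add: h_def)
        have "(h \<longlongrightarrow> g x) (at x within ccw_sector D k)"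
          by (rule tendsto_within_cong[where f = f])
             (use nj k xr ccw_sector_disjoint_rays[OF D0, of k] in
               \<open>auto simp: no_jump_def side_limits_def h_def\<close>)
        moreover have "(h \<longlongrightarrow> g x) (at x within cw_sector D k)"
          by (rule tendsto_within_cong[where f = f])
             (use nj k xr cw_sector_disjoint_rays[OF D0, of k] in
               \<open>auto simp: no_jump_def side_limits_def h_def\<close>)
        moreover have "(h \<longlongrightarrow> g x) (at x within ray D k - {0})"
        proof (rule tendsto_within_cong[where f = g])
          show "(g \<longlongrightarrow> g x) (at x within ray D k - {0})"
            using nj k xr unfolding no_jump_def side_limits_def continuous_on_def by blast
          show "h z = g z" if "z \<in> ray D k - {0}" for z using that k by (auto simp: h_def rays_def)
        qed
        ultimately have "(h \<longlongrightarrow> g x) (at x within wedge D k)"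
          unfolding wedge_split[OF D0] by (intro Lim_Un)
        then show ?thesis
          using at_within_open[OF x open_wedge[OF D]] hx by (simp add: isCont_def)
      qed
      then show ?thesis by (simp add: continuous_at_imp_continuous_on)
    qed
    show ?thesis
    proof (rule holomorphic_on_paste_across_line[where d = ?d and k = 0])
      show "open (wedge D k)" using open_wedge D by blast
      show "?d \<noteq> 0" by simp
      show "h holomorphic_on wedge D k \<inter> {z. ?d \<bullet> z < 0}"
        by (rule holomorphic_on_subset[OF hf], unfold inn)
           (use wedge_Im_sides(2)[OF D] cw_sector_disjoint_rays[OF D0, of k] in blast)
      show "h holomorphic_on wedge D k \<inter> {z. 0 < ?d \<bullet> z}"
        by (rule holomorphic_on_subset[OF hf], unfold inn)
           (use wedge_Im_sides(1)[OF D] ccw_sector_disjoint_rays[OF D0, of k] in blast)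
      show "continuous_on (wedge D k) h" by (rule c)
    qed
  qed
  have cover: "UNIV - {0} = - rays D \<union> (\<Union>k<D. wedge D k)"
  proof -
    have "z \<noteq> 0" if "z \<in> wedge D k" for z k using that by (auto simp: wedge_def cone_def)
    moreover have "z \<in> - rays D \<union> (\<Union>k<D. wedge D k)" if "z \<noteq> 0" for z
      using that wedge_split[OF D0] by (auto simp: rays_def)
    ultimately show ?thesis using zero_in_rays[OF D0] by blast
  qed
  have "h holomorphic_on (- rays D \<union> (\<Union>k<D. wedge D k))"
    by (intro holomorphic_on_Un holomorphic_on_UN_open hf hw opn open_UN ballI open_wedge D) auto
  then have h0: "h holomorphic_on UNIV - {0}" by (simp only: cover)
  obtain r M where rM: "r > 0" "M > 0" "\<And>z. z \<in> ball 0 r - rays D \<Longrightarrow> norm (f z) \<le> M"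
    using bounded_near_0_lim[OF bd] by blast
  have hb: "norm (h z) \<le> M" if z: "z \<in> ball 0 r" "z \<noteq> 0" for z
  proof (cases "z \<in> rays D")
    case False then show ?thesis using rM(3)[of z] z by (simp add: h_def)
  next
    case True
    then obtain k where k: "k < D" "z \<in> ray D k - {0}" using z by (auto simp: rays_def)
    have "(f \<longlongrightarrow> g z) (at z within ccw_sector D k)" using nj k by (auto simp: no_jump_def side_limits_def)
    then have "norm (g z) \<le> M"
      by (rule norm_boundary_value_le[OF _ islimpt_sectors(1)[OF k(2,1)] open_ball z(1)])
         (use rM(3) ccw_sector_disjoint_rays[OF D0, of k] in blast)
    then show ?thesis using True by (simp add: h_def)
  qed
  have "\<exists>G. G holomorphic_on UNIV \<and> (\<forall>z \<in> UNIV - {0}. G z = h z)"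
  proof (subst holomorphic_on_extend_bounded[OF h0])
    show "\<exists>B. \<forall>\<^sub>F z in at 0. norm (h z) \<le> B"
    proof (intro exI)
      have "\<forall>\<^sub>F z in at 0. z \<in> ball 0 r - {0}"
        by (rule eventually_at_in_open) (use rM(1) in auto)
      then show "\<forall>\<^sub>F z in at 0. norm (h z) \<le> M" by eventually_elim (use hb in blast)
    qed
  qed simp
  then obtain G where G: "G holomorphic_on UNIV" "\<And>z. z \<noteq> 0 \<Longrightarrow> G z = h z" by blast
  show ?thesis
  proof (rule that[OF G(1)])
    show "G z = f z" if "z \<in> - rays D" for z
    proof -
      have "z \<noteq> 0" using that zero_in_rays[OF D0] by blast
      then show ?thesis using G(2) that by (simp add: h_def)
    qed
    show "G z = g z" if "z \<in> rays D - {0}" for z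
      using G(2) that by (simp add: h_def)
  qed
qed


text \<open>Liouville's theorem needs the growth bound on the rays as well; they inherit it from the
  adjacent sectors by continuity.\<close>

lemma no_jump_polynomial:
  assumes D: "D \<ge> 4" and hol: "f holomorphic_on (- rays D)" and nj: "no_jump D f g"
    and bd: "bounded_near_0 D f"
    and gr: "f \<in> O[inf at_infinity (principal (- rays D))](\<lambda>z. z ^ m)"
  obtains p where "Polynomial.degree p \<le> m" "\<And>z. z \<in> - rays D \<Longrightarrow> f z = poly p z"
    "\<And>x. x \<in> rays D - {0} \<Longrightarrow> g x = poly p x"
proof -
  have D0: "D > 0" using D by simp
  obtain F where F: "F holomorphic_on UNIV" "\<And>z. z \<in> - rays D \<Longrightarrow> F z = f z"
    "\<And>x. x \<in> rays D - {0} \<Longrightarrow> F x = g x"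
    using no_jump_entire[OF D hol nj bd] by blast
  obtain c where c: "c > 0" "\<forall>\<^sub>F z in inf at_infinity (principal (- rays D)). norm (f z) \<le> c * norm (z ^ m)"
    using landau_o.bigE[OF gr] by blast
  then obtain b where b: "\<And>z. norm z \<ge> b \<Longrightarrow> z \<in> - rays D \<Longrightarrow> norm (f z) \<le> c * norm (z ^ m)"
    unfolding eventually_inf_principal eventually_at_infinity by blast
  have "norm (F z) \<le> c * norm z ^ m" if z: "norm z \<ge> max b 1 + 1" for z
  proof (cases "z \<in> rays D")
    case False then show ?thesis using b[of z] F(2)[of z] z by (simp add: norm_power)
  next
    case True
    moreover have "z \<noteq> 0" using z by (intro notI) simp
    ultimately obtain k where k: "k < D" "z \<in> ray D k - {0}" by (auto simp: rays_def)
    have cF: "isCont F z"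
      using holomorphic_on_imp_continuous_on[OF F(1)] by (simp add: continuous_on_eq_continuous_at)
    have lim: "((\<lambda>w. F w / w ^ m) \<longlongrightarrow> F z / z ^ m) (at z within ccw_sector D k)"
      using \<open>z \<noteq> 0\<close> by (intro tendsto_intros isCont_tendsto_compose[OF cF]) auto
    have "norm (F z / z ^ m) \<le> c"
    proof (rule norm_boundary_value_le[OF lim islimpt_sectors(1)[OF k(2,1)], of "- cball 0 (max b 1)"])
      fix w assume w: "w \<in> ccw_sector D k" "w \<in> - cball 0 (max b 1)"
      then have "w \<in> - rays D" using ccw_sector_disjoint_rays[OF D0, of k] by blast
      then have "norm (F w) \<le> c * norm (w ^ m)" using b[of w] w F(2) by auto
      moreover have "norm (w ^ m) > 0" using w by auto
      ultimately show "norm (F w / w ^ m) \<le> c" by (simp add: norm_divide field_simps)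
    qed (use z in auto)
    moreover have "norm (z ^ m) > 0" using z by auto
    ultimately show ?thesis by (simp add: norm_divide norm_power field_simps)
  qed
  then have L: "F z = (\<Sum>k\<le>m. (deriv ^^ k) F 0 / fact k * z ^ k)" for z
    using Liouville_polynomial[OF F(1)] by blast
  define p where "p = (\<Sum>k\<le>m. Polynomial.monom ((deriv ^^ k) F 0 / fact k) k)"
  have "Polynomial.degree p \<le> m" unfolding p_def
    by (intro degree_sum_le) (auto intro: order.trans[OF degree_monom_le])
  moreover have "poly p z = F z" for z unfolding p_def L[of z] by (simp add: poly_sum poly_monom)
  ultimately show ?thesis using that[of p] F by simp
qed

section \<open>The integral of a jump over the rays\<close>

definition closed_sector :: "nat \<Rightarrow> nat \<Rightarrow> complex set" where
  "closed_sector D k = closed_cone (2 * pi * real k / real D) (2 * pi * (real k + 1) / real D)"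

lemma closed_sector_split:
  assumes "D > 0"
  shows "closed_sector D k = (ray D k - {0}) \<union> ccw_sector D k \<union> (ray D (Suc k) - {0})"
proof (intro equalityI subsetI)
  let ?t = "2 * pi * real k / real D" and ?s = "2 * pi * (real k + 1) / real D"
  have lt: "?t < ?s"
    using assms by (auto intro!: divide_strict_right_mono)
  have r: "x \<in> ray D (Suc k) - {0} \<longleftrightarrow> (\<exists>r>0. x = rcis r ?s)" 
    "x \<in> ray D k - {0} \<longleftrightarrow> (\<exists>r>0. x = rcis r ?t)" for x
    unfolding mem_ray_iff ray_dir_def rcis_def by (simp_all add: add.commute)
  { fix z assume "z \<in> closed_sector D k"
    then obtain r t where rt: "z = rcis r t" "0 < r" "?t \<le> t" "t \<le> ?s" 
      by (auto simp: closed_sector_def closed_cone_def)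
    consider "t = ?t" | "t = ?s" | "?t < t \<and> t < ?s" using rt by linarith
    then show "z \<in> (ray D k - {0}) \<union> ccw_sector D k \<union> (ray D (Suc k) - {0})"
    proof cases
      case 1 then show ?thesis using r(2)[of z] rt by blast
    next
      case 2 then show ?thesis using r(1)[of z] rt by blast
    next
      case 3 then have "z \<in> ccw_sector D k" unfolding ccw_sector_cone cone_def using rt by blast
      then show ?thesis by blast
    qed }
  { fix z assume z: "z \<in> (ray D k - {0}) \<union> ccw_sector D k \<union> (ray D (Suc k) - {0})"
    have "\<exists>r t. z = rcis r t \<and> 0 < r \<and> ?t \<le> t \<and> t \<le> ?s"
      using z
    proof (elim UnE)
      assume "z \<in> ccw_sector D k"
      then show ?thesis unfolding ccw_sector_cone cone_def by (blast intro: less_imp_le)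
    next
      assume "z \<in> ray D k - {0}" then show ?thesis unfolding r using lt less_imp_le by blast
    next
      assume "z \<in> ray D (Suc k) - {0}" then show ?thesis unfolding r using lt less_imp_le by blast
    qed
    then show "z \<in> closed_sector D k" unfolding closed_sector_def closed_cone_def by blast }
qed

lemma closed_sector_opening:
  assumes "D \<ge> 4"
  shows "2 * pi * real k / real D < 2 * pi * (real k + 1) / real D"
    "2 * pi * (real k + 1) / real D - 2 * pi * real k / real D < pi"
  using assms by (auto intro!: divide_strict_right_mono simp: diff_divide_distrib[symmetric] field_simps)

lemma convex_closed_sector: "D \<ge> 4 \<Longrightarrow> convex (closed_sector D k)"
  unfolding closed_sector_def by (intro convex_closed_cone closed_sector_opening)

text \<open>A point of an edge is a limit of points on the far side of that edge, hence not interior.\<close>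

lemma interior_closed_sector:
  assumes D: "D \<ge> 4" and k: "k < D"
  shows "interior (closed_sector D k) \<subseteq> ccw_sector D k"
proof
  fix z assume z: "z \<in> interior (closed_sector D k)"
  have D0: "D > 0" using D by simp
  show "z \<in> ccw_sector D k"
  proof (rule ccontr)
    assume "z \<notin> ccw_sector D k"
    then consider "z \<in> ray D k - {0}" | "z \<in> ray D (Suc k mod D) - {0}"
      using z interior_subset[of "closed_sector D k"] closed_sector_split[OF D0, of k] ray_mod[OF k] by blast
    then show False
    proof cases
      case 1
      have "\<exists>w \<in> cw_sector D k. w \<in> interior (closed_sector D k)"
        using islimpt_sectors(2)[OF 1 k] z unfolding islimpt_def by (metis open_interior)
      then obtain w where w: "w \<in> cw_sector D k" "w \<in> closed_sector D k" using interior_subset by blast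
      then have "w \<in> ccw_sector D k"
        using closed_sector_split[OF D0, of k] ray_disjoint_sectors(2)[OF D0 k, of w k]
          ray_disjoint_sectors(2)[OF D0 mod_less_divisor[OF D0], of w "Suc k" k] ray_mod[OF k] by blast
      then show False using wedge_Im_sides[OF D, of w k] wedge_split[OF D0, of k] w(1) by (smt (verit) UnI1)
    next
      case 2
      let ?j = "Suc k mod D"
      have j: "?j < D" using D0 by simp
      have "\<exists>w \<in> ccw_sector D ?j. w \<in> interior (closed_sector D k)"
        using islimpt_sectors(1)[OF 2 j] z unfolding islimpt_def by (metis open_interior)
      then obtain w where w: "w \<in> ccw_sector D ?j" "w \<in> closed_sector D k" using interior_subset by blast
      then have "w \<in> ccw_sector D k"
        using closed_sector_split[OF D0, of k] ray_disjoint_sectors(1)[OF D0 k, of w ?j]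
          ray_disjoint_sectors(1)[OF D0 j, of w ?j] ray_mod[OF k] by blast
      then have "w \<in> cw_sector D ?j" using cw_sector_mod[OF k] by simp
      then show False using wedge_Im_sides[OF D, of w ?j] wedge_split[OF D0, of ?j] w(1) by (smt (verit) UnI1)
    qed
  qed
qed

lemma ray_dir_mod: "k < D \<Longrightarrow> ray_dir D (Suc k mod D) = ray_dir D (Suc k)"
  using ray_dir_D[of D] by (cases "Suc k = D") auto

text \<open>A closed sector without its vertex is convex, so the function has a primitive there even if it
  is merely continuous up to the edges; this replaces a contour deformation.\<close>

lemma sector_primitive:
  assumes D: "D \<ge> 4" and k: "k < D" and hol: "f holomorphic_on (- rays D)"
    and sl: "side_limits D f hp hm"
  obtains g h where "\<And>z. z \<in> closed_sector D k \<Longrightarrow> (g has_field_derivative h z) (at z within closed_sector D k)"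
    "\<And>z. z \<in> ccw_sector D k \<Longrightarrow> h z = f z"
    "\<And>z. z \<in> ray D k - {0} \<Longrightarrow> h z = hp k z"
    "\<And>z. z \<in> ray D (Suc k) - {0} \<Longrightarrow> h z = hm (Suc k mod D) z"
proof -
  have D0: "D > 0" using D by simp
  let ?j = "Suc k mod D"
  have j: "?j < D" using D0 by simp
  have jk: "?j \<noteq> k" using D k by (cases "Suc k = D") auto
  have rd: "x \<notin> ray D ?j" if "x \<in> ray D k - {0}" for x
    using rays_distinct[OF j k jk] that by blast
  have rd': "x \<notin> ray D k" if "x \<in> ray D ?j - {0}" for x
    using rays_distinct[OF j k jk] that by blast
  let ?C = "closed_sector D k"
  have C: "?C = (ray D k - {0}) \<union> ccw_sector D k \<union> (ray D ?j - {0})"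
    unfolding closed_sector_split[OF D0] ray_mod[OF k] ..
  define h where "h z = (if z \<in> ray D k then hp k z else if z \<in> ray D ?j then hm ?j z else f z)" for z
  have hS: "h z = f z" if "z \<in> ccw_sector D k" for z
    unfolding h_def using that ray_disjoint_sectors[OF D0 k, of z k] ray_disjoint_sectors[OF D0 j, of z k] by auto
  have hk: "h z = hp k z" if "z \<in> ray D k - {0}" for z using that by (simp add: h_def)
  have hj: "h z = hm ?j z" if "z \<in> ray D ?j - {0}" for z using that rd'[of z] by (simp add: h_def)
  have opn: "open (ccw_sector D k)" using open_ccw_sector D by simp
  have "f holomorphic_on ccw_sector D k"
    using hol ccw_sector_disjoint_rays[OF D0, of k] by (auto intro: holomorphic_on_subset)
  then have hh: "h holomorphic_on ccw_sector D k"
    by (rule holomorphic_transform) (simp add: hS)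
  have bot: "at x within (ray D i - {0}) = bot" if "x \<notin> ray D i" for x i
    using that closed_ray[of D i] islimpt_subset[of x "ray D i - {0}" "ray D i"]
    by (auto simp: trivial_limit_within closed_limpt)
  have "continuous_on ?C h"
    unfolding continuous_on_def
  proof
    fix x assume "x \<in> ?C"
    then consider "x \<in> ccw_sector D k" | "x \<in> ray D k - {0}" | "x \<in> ray D ?j - {0}"
      unfolding C by blast
    then show "(h \<longlongrightarrow> h x) (at x within ?C)"
    proof cases
      case 1
      have "isCont h x" using hh opn 1
        by (meson continuous_on_eq_continuous_at holomorphic_on_imp_continuous_on)
      then show ?thesis unfolding isCont_def by (rule tendsto_within_subset) simp
    next
      case 2
      have "(h \<longlongrightarrow> hp k x) (at x within (ray D k - {0}))"
        by (rule tendsto_within_cong[where f = "hp k"])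
           (use sl k 2 hk in \<open>auto simp: side_limits_def continuous_on_def\<close>)
      moreover have "(h \<longlongrightarrow> hp k x) (at x within ccw_sector D k)"
        by (rule tendsto_within_cong[where f = f]) (use sl k 2 hS in \<open>auto simp: side_limits_def\<close>)
      moreover have "(h \<longlongrightarrow> hp k x) (at x within (ray D ?j - {0}))"
        using bot[OF rd[OF 2]] by simp
      ultimately show ?thesis unfolding C hk[OF 2] by (intro Lim_Un)
    next
      case 3
      have "(h \<longlongrightarrow> hm ?j x) (at x within (ray D ?j - {0}))"
        by (rule tendsto_within_cong[where f = "hm ?j"])
           (use sl j 3 hj in \<open>auto simp: side_limits_def continuous_on_def\<close>)
      moreover have "(h \<longlongrightarrow> hm ?j x) (at x within ccw_sector D k)"
        by (rule tendsto_within_cong[where f = f])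
           (use sl j 3 hS in \<open>auto simp: side_limits_def cw_sector_mod[OF k, symmetric]\<close>)
      moreover have "(h \<longlongrightarrow> hm ?j x) (at x within (ray D k - {0}))"
        using bot[OF rd'[OF 3]] by simp
      ultimately show ?thesis unfolding C hj[OF 3] by (intro Lim_Un)
    qed
  qed
  moreover have "h field_differentiable at x" if "x \<in> interior ?C - {}" for x
    using that interior_closed_sector[OF D k] hh opn holomorphic_on_imp_differentiable_at by blast
  ultimately obtain g where g: "\<And>x. x \<in> ?C \<Longrightarrow> (g has_field_derivative h x) (at x within ?C)"
    using holomorphic_convex_primitive[OF convex_closed_sector[OF D] finite.emptyI] by metis
  show ?thesis
    by (rule that[of g h]) (use g hS hk hj ray_mod[OF k] in auto)
qed


lemma mem_closed_sector:
  assumes "D > 0" "r > 0" "2 * pi * real k / real D \<le> t" "t \<le> 2 * pi * (real k + 1) / real D"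
  shows "rcis r t \<in> closed_sector D k"
  using assms unfolding closed_sector_def closed_cone_def by blast

lemma integral_along_ray:
  fixes g h :: "complex \<Rightarrow> complex"
  assumes g: "\<And>z. z \<in> S \<Longrightarrow> (g has_field_derivative h z) (at z within S)"
    and S: "\<And>r. r \<in> {a..b} \<Longrightarrow> of_real r * e \<in> S" and ab: "a \<le> b"
  shows "((\<lambda>r. e * h (of_real r * e)) has_integral g (of_real b * e) - g (of_real a * e)) {a..b}"
proof (rule fundamental_theorem_of_calculus[where f = "\<lambda>r. g (of_real r * e)", OF ab])
  fix r assume r: "r \<in> {a..b}"
  have "((\<lambda>r. of_real r * e) has_vector_derivative e) (at r within {a..b})"
    by (auto intro!: derivative_eq_intros simp: has_vector_derivative_def scaleR_conv_of_real)
  moreover have "(g has_field_derivative h (of_real r * e)) (at (of_real r * e) within (\<lambda>r. of_real r * e) ` {a..b})"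
    by (rule has_field_derivative_subset[OF g[OF S[OF r]]]) (use S in blast)
  ultimately show "((\<lambda>r. g (of_real r * e)) has_vector_derivative e * h (of_real r * e)) (at r within {a..b})"
    by (rule field_vector_diff_chain_within[unfolded o_def])
qed

text \<open>A primitive of a function close to \<open>c / z\<close> grows along a circular arc like \<open>\<i> c\<close> times the
  angle.\<close>

lemma arc_increment:
  fixes g h :: "complex \<Rightarrow> complex"
  assumes g: "\<And>z. z \<in> S \<Longrightarrow> (g has_field_derivative h z) (at z within S)"
    and S: "\<And>t. t \<in> {a..b} \<Longrightarrow> rcis R t \<in> S" and ab: "a \<le> b" and R: "R > 0" and K: "K \<ge> 0"
    and h: "\<And>t. t \<in> {a..b} \<Longrightarrow> norm (h (rcis R t) - c / rcis R t) \<le> K / R\<^sup>2"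
  shows "norm (g (rcis R b) - g (rcis R a) - \<i> * c * of_real (b - a)) \<le> K / R * (b - a)"
proof -
  let ?d = "\<lambda>t. \<i> * rcis R t * h (rcis R t)"
  have I: "(?d has_integral g (rcis R b) - g (rcis R a)) {a..b}"
  proof (rule fundamental_theorem_of_calculus[where f = "\<lambda>t. g (rcis R t)", OF ab])
    fix t assume t: "t \<in> {a..b}"
    have "((\<lambda>z. of_real R * exp (\<i> * z)) has_field_derivative \<i> * rcis R t) (at (of_real t))"
      by (auto intro!: derivative_eq_intros simp: rcis_def cis_conv_exp)
    then have "((\<lambda>t. rcis R t) has_vector_derivative (\<i> * rcis R t)) (at t within {a..b})"
      unfolding rcis_def cis_conv_exp by (rule has_vector_derivative_real_field)
    moreover have "(g has_field_derivative h (rcis R t)) (at (rcis R t) within (\<lambda>t. rcis R t) ` {a..b})"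
      by (rule has_field_derivative_subset[OF g[OF S[OF t]]]) (use S in blast)
    ultimately show "((\<lambda>t. g (rcis R t)) has_vector_derivative ?d t) (at t within {a..b})"
      by (rule field_vector_diff_chain_within[unfolded o_def])
  qed
  have "((\<lambda>t. \<i> * c) has_integral (b - a) *\<^sub>R (\<i> * c)) {a..b}"
    using has_integral_const_real[of "\<i> * c" a b] ab by simp
  from has_integral_diff[OF I this]
  have "((\<lambda>t. ?d t - \<i> * c) has_integral g (rcis R b) - g (rcis R a) - \<i> * c * of_real (b - a)) (cbox a b)"
    by (simp add: scaleR_conv_of_real mult_ac)
  moreover have "norm (?d t - \<i> * c) \<le> K / R" if "t \<in> cbox a b" for t
  proof -
    have z: "rcis R t \<noteq> 0" using R by simp
    have "?d t - \<i> * c = \<i> * rcis R t * (h (rcis R t) - c / rcis R t)"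
      using z by (simp add: field_simps)
    then have "norm (?d t - \<i> * c) = R * norm (h (rcis R t) - c / rcis R t)"
      using R by (simp add: norm_mult)
    also have "\<dots> \<le> R * (K / R\<^sup>2)" using h[of t] that R by (intro mult_left_mono) auto
    also have "\<dots> = K / R" using R by (simp add: power2_eq_square)
    finally show ?thesis .
  qed
  moreover have "0 \<le> K / R" using K R by simp
  ultimately have "norm (g (rcis R b) - g (rcis R a) - \<i> * c * of_real (b - a)) \<le> K / R * measure lborel (cbox a b)"
    by (intro has_integral_bound)
  then show ?thesis using ab by simp
qed

text \<open>Cauchy's theorem for a truncated sector, written as increments of a primitive.  The outer arc
  contributes its share of \<open>2\<pi>\<i> c\<close>, the inner arc disappears with its radius because the function is
  bounded.\<close>

lemma sector_boundary_integral:
  assumes D: "D \<ge> 4" and k: "k < D" and hol: "f holomorphic_on (- rays D)"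
    and sl: "side_limits D f hp hm"
    and M: "\<And>z. z \<in> ball 0 r0 - rays D \<Longrightarrow> norm (f z) \<le> M" "M \<ge> 0"
    and K: "\<And>z. z \<in> - rays D \<Longrightarrow> norm z > R0 \<Longrightarrow> norm (f z - c / z) \<le> K / (norm z)\<^sup>2" "K \<ge> 0"
    and \<epsilon>: "0 < \<epsilon>" "\<epsilon> < r0" "\<epsilon> \<le> R" "R0 < R"
  shows "norm (integral {\<epsilon>..R} (\<lambda>r. ray_dir D k * hp k (of_real r * ray_dir D k))
     - integral {\<epsilon>..R} (\<lambda>r. ray_dir D (Suc k) * hm (Suc k mod D) (of_real r * ray_dir D (Suc k)))
     + 2 * pi * \<i> * c / of_nat D) \<le> K / R * (2 * pi / real D) + 2 * M * \<epsilon>"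
    "(\<lambda>r. ray_dir D k * hp k (of_real r * ray_dir D k)) integrable_on {\<epsilon>..R}"
    "(\<lambda>r. ray_dir D (Suc k) * hm (Suc k mod D) (of_real r * ray_dir D (Suc k))) integrable_on {\<epsilon>..R}"
proof -
  have D0: "D > 0" using D by simp
  let ?C = "closed_sector D k" and ?t = "2 * pi * real k / real D" and ?s = "2 * pi * (real k + 1) / real D"
  let ?a = "ray_dir D k" and ?b = "ray_dir D (Suc k)" and ?j = "Suc k mod D"
  have j: "?j < D" using D0 by simp
  obtain g h where g: "\<And>z. z \<in> ?C \<Longrightarrow> (g has_field_derivative h z) (at z within ?C)"
    and hS: "\<And>z. z \<in> ccw_sector D k \<Longrightarrow> h z = f z"
    and hk: "\<And>z. z \<in> ray D k - {0} \<Longrightarrow> h z = hp k z"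
    and hj: "\<And>z. z \<in> ray D (Suc k) - {0} \<Longrightarrow> h z = hm ?j z"
    using sector_primitive[OF D k hol sl] by metis
  have ts: "?t < ?s" "?s - ?t < pi" using closed_sector_opening[OF D] by auto
  have st: "?s - ?t = 2 * pi / real D" by (simp add: diff_divide_distrib[symmetric] algebra_simps)
  have ab: "?a = cis ?t" "?b = cis ?s" by (simp_all add: ray_dir_def add.commute)
  have R: "R > 0" using \<epsilon> by simp
  have ina: "of_real r * ?a \<in> ?C" "of_real r * ?b \<in> ?C" if "r > 0" for r
    using mem_closed_sector[OF D0 that, of k ?t] mem_closed_sector[OF D0 that, of k ?s] ts
    by (simp_all add: ab rcis_def)
  have onray: "of_real r * ?a \<in> ray D k - {0}" "of_real r * ?b \<in> ray D (Suc k) - {0}" if "r > 0" for r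
    unfolding mem_ray_iff using that by blast+
  have I1: "((\<lambda>r. ?a * h (of_real r * ?a)) has_integral g (of_real R * ?a) - g (of_real \<epsilon> * ?a)) {\<epsilon>..R}"
    by (rule integral_along_ray[OF g]) (use ina \<epsilon> in auto)
  have I2: "((\<lambda>r. ?b * h (of_real r * ?b)) has_integral g (of_real R * ?b) - g (of_real \<epsilon> * ?b)) {\<epsilon>..R}"
    by (rule integral_along_ray[OF g]) (use ina \<epsilon> in auto)
  have J1: "((\<lambda>r. ?a * hp k (of_real r * ?a)) has_integral g (of_real R * ?a) - g (of_real \<epsilon> * ?a)) {\<epsilon>..R}"
    by (rule has_integral_eq[OF _ I1]) (use hk onray \<epsilon> in auto)
  have J2: "((\<lambda>r. ?b * hm ?j (of_real r * ?b)) has_integral g (of_real R * ?b) - g (of_real \<epsilon> * ?b)) {\<epsilon>..R}"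
    by (rule has_integral_eq[OF _ I2]) (use hj onray \<epsilon> in auto)
  \<comment> \<open>The weight \<open>e\<close> is \<open>1\<close> near the origin and \<open>z\<^sup>2\<close> far out, where \<open>d\<close> is the leading term \<open>c / z\<close>.\<close>
  have bnd: "norm ((h z - d z) * e z) \<le> B" 
    if z: "z \<in> ?C" "z \<in> A" and A: "open A" and c: "isCont d z" "isCont e z"
      and B: "\<And>w. w \<in> ccw_sector D k \<Longrightarrow> w \<in> A \<Longrightarrow> norm ((f w - d w) * e w) \<le> B" for z A d e B
  proof -
    have dl: "(d \<longlongrightarrow> d z) (at z within S)" "(e \<longlongrightarrow> e z) (at z within S)" for S
      using c[unfolded isCont_def] by (auto intro: tendsto_within_subset)
    consider "z \<in> ccw_sector D k" | "z \<in> ray D k - {0}" | "z \<in> ray D ?j - {0}"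
      using z closed_sector_split[OF D0, of k] ray_mod[OF k] by auto
    then show ?thesis
    proof cases
      case 1 then show ?thesis using B[of z] z hS by simp
    next
      case 2
      have "((\<lambda>w. (f w - d w) * e w) \<longlongrightarrow> (hp k z - d z) * e z) (at z within ccw_sector D k)"
        using sl k 2 by (intro tendsto_intros dl) (auto simp: side_limits_def)
      from norm_boundary_value_le[OF this islimpt_sectors(1)[OF 2 k] A z(2) B]
      show ?thesis using hk[OF 2] by simp
    next
      case 3
      have "((\<lambda>w. (f w - d w) * e w) \<longlongrightarrow> (hm ?j z - d z) * e z) (at z within cw_sector D ?j)"
        using sl j 3 by (intro tendsto_intros dl) (auto simp: side_limits_def)
      from norm_boundary_value_le[OF this islimpt_sectors(2)[OF 3 j] A z(2)] B
      show ?thesis using hj[of z] 3 ray_mod[OF k] cw_sector_mod[OF k] by auto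
    qed
  qed
  have far: "norm (g (rcis R ?s) - g (rcis R ?t) - \<i> * c * of_real (?s - ?t)) \<le> K / R * (?s - ?t)"
  proof (rule arc_increment[OF g _ _ R K(2)])
    fix t assume t: "t \<in> {?t..?s}"
    show zC: "rcis R t \<in> ?C" using mem_closed_sector[OF D0 R] t by simp
    have "norm ((h (rcis R t) - c / rcis R t) * (rcis R t)\<^sup>2) \<le> K"
    proof (rule bnd[OF zC, of "- cball 0 R0" "\<lambda>w. c / w" "\<lambda>w. w\<^sup>2"])
      fix w assume w: "w \<in> ccw_sector D k" "w \<in> - cball 0 R0"
      have "w \<in> - rays D" using w ccw_sector_disjoint_rays[OF D0, of k] by blast
      then have "norm (f w - c / w) \<le> K / (norm w)\<^sup>2" using K(1) w by simp
      moreover have "w \<noteq> 0" using \<open>w \<in> - rays D\<close> zero_in_rays[OF D0] by blast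
      ultimately show "norm ((f w - c / w) * w\<^sup>2) \<le> K"
        by (simp only: norm_mult norm_power) (simp add: pos_le_divide_eq)
    qed (use R \<epsilon> in \<open>auto intro!: continuous_intros\<close>)
    then show "norm (h (rcis R t) - c / rcis R t) \<le> K / R\<^sup>2"
      using R by (simp only: norm_mult norm_power) (simp add: pos_le_divide_eq)
  qed (use ts in auto)
  have near: "norm (g (of_real \<epsilon> * ?b) - g (of_real \<epsilon> * ?a)) \<le> M * norm (of_real \<epsilon> * ?b - of_real \<epsilon> * ?a)"
  proof (rule field_differentiable_bound[where S = "?C \<inter> ball 0 r0" and f' = h])
    show "convex (?C \<inter> ball 0 r0)" by (intro convex_Int convex_closed_sector D convex_ball)
    fix z assume z: "z \<in> ?C \<inter> ball 0 r0"
    then show "(g has_field_derivative h z) (at z within ?C \<inter> ball 0 r0)"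
      using g by (blast intro: has_field_derivative_subset)
    show "norm (h z) \<le> M"
      using bnd[of z "ball 0 r0" "\<lambda>_. 0" "\<lambda>_. 1" M] z M(1) ccw_sector_disjoint_rays[OF D0, of k] by auto
  qed (use ina \<epsilon> in \<open>auto simp: norm_mult\<close>)
  have "norm (of_real \<epsilon> * ?b - of_real \<epsilon> * ?a) \<le> 2 * \<epsilon>"
    using norm_triangle_ineq4[of "of_real \<epsilon> * ?b" "of_real \<epsilon> * ?a"] \<epsilon> by (simp add: norm_mult)
  then have "M * norm (of_real \<epsilon> * ?b - of_real \<epsilon> * ?a) \<le> M * (2 * \<epsilon>)"
    by (rule mult_left_mono) (rule M(2))
  with near have near': "norm (g (of_real \<epsilon> * ?b) - g (of_real \<epsilon> * ?a)) \<le> 2 * M * \<epsilon>"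
    by simp
  have eq: "(g (of_real R * ?a) - g (of_real \<epsilon> * ?a)) - (g (of_real R * ?b) - g (of_real \<epsilon> * ?b)) + 2 * pi * \<i> * c / of_nat D
    = - (g (rcis R ?s) - g (rcis R ?t) - \<i> * c * of_real (?s - ?t)) + (g (of_real \<epsilon> * ?b) - g (of_real \<epsilon> * ?a))"
    unfolding st ab by (simp add: rcis_def)
  show "norm (integral {\<epsilon>..R} (\<lambda>r. ?a * hp k (of_real r * ?a))
     - integral {\<epsilon>..R} (\<lambda>r. ?b * hm ?j (of_real r * ?b))
     + 2 * pi * \<i> * c / of_nat D) \<le> K / R * (2 * pi / real D) + 2 * M * \<epsilon>"
    unfolding integral_unique[OF J1] integral_unique[OF J2] eq
  proof (rule order.trans[OF norm_triangle_ineq add_mono])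
    show "norm (- (g (rcis R ?s) - g (rcis R ?t) - \<i> * c * of_real (?s - ?t))) \<le> K / R * (2 * pi / real D)"
      using far by (simp only: norm_minus_cancel st)
  qed (rule near')
  show "(\<lambda>r. ?a * hp k (of_real r * ?a)) integrable_on {\<epsilon>..R}" "(\<lambda>r. ?b * hm ?j (of_real r * ?b)) integrable_on {\<epsilon>..R}"
    using J1 J2 by blast+
qed


text \<open>Summing the sector identities, every ray is traversed twice in opposite directions and
  contributes the integral of its jump, while the arcs add up to \<open>2\<pi>\<i>\<close> times the coefficient \<open>c\<close>.\<close>

lemma ray_jump_integral:
  assumes D: "D \<ge> 4" and hol: "f holomorphic_on (- rays D)"
    and sl: "side_limits D f hp hm" and bd: "bounded_near_0 D f"
    and inf: "(\<lambda>z. f z - c / z) \<in> O[inf at_infinity (principal (- rays D))](\<lambda>z. 1 / z\<^sup>2)"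
    and w: "\<And>k r. k < D \<Longrightarrow> r > 0 \<Longrightarrow>
        hp k (of_real r * ray_dir D k) - hm k (of_real r * ray_dir D k) = w k r"
    and wc: "\<And>k. k < D \<Longrightarrow> continuous_on {0..} (w k)"
  shows "((\<lambda>R. \<Sum>k<D. ray_dir D k * integral {0..R} (w k)) \<longlongrightarrow> - (2 * pi * \<i> * c)) at_top"
proof -
  have D0: "D > 0" using D by simp
  obtain r0 M where M: "r0 > 0" "M > 0" "\<And>z. z \<in> ball 0 r0 - rays D \<Longrightarrow> norm (f z) \<le> M"
    using bounded_near_0_lim[OF bd] by blast
  obtain K where K: "K > 0" "\<forall>\<^sub>F z in inf at_infinity (principal (- rays D)). norm (f z - c / z) \<le> K * norm (1 / z\<^sup>2)"
    using landau_o.bigE[OF inf] by blast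
  then obtain R0 where R0: "\<And>z. norm z \<ge> R0 \<Longrightarrow> z \<in> - rays D \<Longrightarrow> norm (f z - c / z) \<le> K * norm (1 / z\<^sup>2)"
    unfolding eventually_inf_principal eventually_at_infinity by blast
  have K': "norm (f z - c / z) \<le> K / (norm z)\<^sup>2" if "z \<in> - rays D" "norm z > R0" for z
    using R0[of z] that by (simp add: norm_divide norm_power)
  define I where "I \<epsilon> R = (\<Sum>k<D. ray_dir D k * integral {\<epsilon>..R} (w k))" for \<epsilon> R
  have est: "norm (I \<epsilon> R + 2 * pi * \<i> * c) \<le> K / R * (2 * pi) + 2 * M * \<epsilon> * real D"
    if \<epsilon>: "0 < \<epsilon>" "\<epsilon> < r0" "\<epsilon> \<le> R" "R0 < R" for \<epsilon> R
  proof -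
    let ?p = "\<lambda>k. integral {\<epsilon>..R} (\<lambda>r. ray_dir D k * hp k (of_real r * ray_dir D k))"
    let ?m = "\<lambda>k. integral {\<epsilon>..R} (\<lambda>r. ray_dir D (Suc k) * hm (Suc k mod D) (of_real r * ray_dir D (Suc k)))"
    let ?n = "\<lambda>k. integral {\<epsilon>..R} (\<lambda>r. ray_dir D k * hm k (of_real r * ray_dir D k))"
    note sb = sector_boundary_integral[OF D _ hol sl M(3) less_imp_le[OF M(2)] K' less_imp_le[OF K(1)] \<epsilon>]
    have m: "?m k = ?n (Suc k mod D)" if "k < D" for k
      by (simp add: ray_dir_mod[OF that])
    have bij: "bij_betw (\<lambda>k. Suc k mod D) {..<D} {..<D}"
    proof -
      have "inj_on (\<lambda>k. Suc k mod D) {..<D}"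
      proof (rule inj_onI)
        fix a b assume ab: "a \<in> {..<D}" "b \<in> {..<D}" "Suc a mod D = Suc b mod D"
        then show "a = b" by (cases "Suc a = D"; cases "Suc b = D") auto
      qed
      moreover have "(\<lambda>k. Suc k mod D) ` {..<D} \<subseteq> {..<D}" using D0 by auto
      ultimately show ?thesis by (simp add: bij_betw_def endo_inj_surj)
    qed
    have int: "(\<lambda>r. ray_dir D k * hp k (of_real r * ray_dir D k)) integrable_on {\<epsilon>..R}"
      "(\<lambda>r. ray_dir D k * hm k (of_real r * ray_dir D k)) integrable_on {\<epsilon>..R}" if k: "k < D" for k
    proof -
      show "(\<lambda>r. ray_dir D k * hp k (of_real r * ray_dir D k)) integrable_on {\<epsilon>..R}"
        using sb(2)[OF k] .
      have "k \<in> (\<lambda>k. Suc k mod D) ` {..<D}" using k bij unfolding bij_betw_def by blast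
      then obtain k' where k': "k' < D" "k = Suc k' mod D" by blast
      show "(\<lambda>r. ray_dir D k * hm k (of_real r * ray_dir D k)) integrable_on {\<epsilon>..R}"
        unfolding k'(2) ray_dir_mod[OF k'(1)] by (rule sb(3)[OF k'(1)])
    qed
    have "ray_dir D k * integral {\<epsilon>..R} (w k) = ?p k - ?n k" if k: "k < D" for k
    proof -
      have "?p k - ?n k = integral {\<epsilon>..R} (\<lambda>r. ray_dir D k * hp k (of_real r * ray_dir D k)
          - ray_dir D k * hm k (of_real r * ray_dir D k))"
        by (rule integral_diff[symmetric]) (rule int[OF k])+
      also have "\<dots> = integral {\<epsilon>..R} (\<lambda>r. ray_dir D k * w k r)"
        using w[OF k] \<epsilon> by (intro integral_cong) (auto simp: right_diff_distrib[symmetric])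
      finally show ?thesis by simp
    qed
    then have "I \<epsilon> R = (\<Sum>k<D. ?p k) - (\<Sum>k<D. ?n k)"
      unfolding I_def by (simp add: sum_subtractf)
    also have "(\<Sum>k<D. ?n k) = (\<Sum>k<D. ?n (Suc k mod D))"
      using sum.reindex_bij_betw[OF bij, of ?n] by simp
    also have "\<dots> = (\<Sum>k<D. ?m k)" using m by (intro sum.cong) auto
    finally have "I \<epsilon> R + 2 * pi * \<i> * c = (\<Sum>k<D. ?p k - ?m k + 2 * pi * \<i> * c / of_nat D)"
      using D0 by (simp add: sum.distrib sum_subtractf)
    also have "norm \<dots> \<le> (\<Sum>k<D. K / R * (2 * pi / real D) + 2 * M * \<epsilon>)"
      by (rule sum_norm_le) (rule sb(1), simp)
    also have "\<dots> = K / R * (2 * pi) + 2 * M * \<epsilon> * real D"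
      using D0 by (simp add: field_simps)
    finally show ?thesis .
  qed
  have est0: "norm (I 0 R + 2 * pi * \<i> * c) \<le> K / R * (2 * pi)" if R: "R > max R0 0" for R
  proof (rule tendsto_le)
    have cI: "((\<lambda>\<epsilon>. integral {\<epsilon>..R} (w k)) \<longlongrightarrow> integral {0..R} (w k)) (at_right 0)" if k: "k < D" for k
    proof -
      have wi: "(w k) integrable_on {0..R}"
        by (rule integrable_continuous_real) (rule continuous_on_subset[OF wc[OF k]], auto)
      have "continuous_on {0..R} (\<lambda>\<epsilon>. integral {\<epsilon>..R} (w k))"
        by (rule indefinite_integral_continuous_1'[OF wi])
      then have "((\<lambda>\<epsilon>. integral {\<epsilon>..R} (w k)) \<longlongrightarrow> integral {0..R} (w k)) (at 0 within {0..R})"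
        using R by (auto simp: continuous_on_def)
      then show ?thesis using R at_within_Icc_at_right[of 0 R] by simp
    qed
    show "((\<lambda>\<epsilon>. norm (I \<epsilon> R + 2 * pi * \<i> * c)) \<longlongrightarrow> norm (I 0 R + 2 * pi * \<i> * c)) (at_right 0)"
      unfolding I_def by (intro tendsto_intros cI) auto
    show "((\<lambda>\<epsilon>. K / R * (2 * pi) + 2 * M * \<epsilon> * real D) \<longlongrightarrow> K / R * (2 * pi)) (at_right 0)"
      by (auto intro!: tendsto_eq_intros)
    have "\<forall>\<^sub>F \<epsilon> in at_right 0. \<epsilon> \<in> {0<..<min r0 R}"
      by (rule eventually_at_right_real) (use M(1) R in auto)
    then show "\<forall>\<^sub>F \<epsilon> in at_right 0. norm (I \<epsilon> R + 2 * pi * \<i> * c) \<le> K / R * (2 * pi) + 2 * M * \<epsilon> * real D"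
      by eventually_elim (use est R in auto)
  qed simp
  have "((\<lambda>R. I 0 R + 2 * pi * \<i> * c) \<longlongrightarrow> 0) at_top"
  proof (rule Lim_null_comparison)
    show "\<forall>\<^sub>F R in at_top. norm (I 0 R + 2 * pi * \<i> * c) \<le> K / R * (2 * pi)"
      using eventually_gt_at_top[of "max R0 0"] by eventually_elim (rule est0)
    show "((\<lambda>R. K / R * (2 * pi)) \<longlongrightarrow> 0) at_top"
      by (intro tendsto_mult_left_zero tendsto_divide_0[OF tendsto_const] filterlim_at_top_imp_at_infinity filterlim_ident)
  qed
  from tendsto_diff[OF this tendsto_const[of "2 * pi * \<i> * c"]]
  show ?thesis by (simp add: I_def)
qed

section \<open>The exponential weight and Sobolev orthogonality\<close>

abbreviation cp :: "real poly \<Rightarrow> complex poly" where "cp p \<equiv> map_poly complex_of_real p"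

lemma cpoly_of_real [simp]: "poly (cp p) (of_real x) = of_real (poly p x)"
  by (induction p) (simp_all add: map_poly_pCons)

lemma cpoly_pderiv: "cp (pderiv p) = pderiv (cp p)"
  by (rule poly_eqI) (simp add: coeff_pderiv coeff_map_poly)

lemma degree_cp [simp]: "Polynomial.degree (cp p) = Polynomial.degree p"
  by (rule degree_map_poly) simp

lemma poly_over_power_tendsto:
  fixes p :: "complex poly"
  assumes n: "Polynomial.degree p \<le> n"
  shows "((\<lambda>z. poly p z / z ^ n) \<longlongrightarrow> coeff p n) at_infinity"
proof -
  have "((\<lambda>z::complex. inverse z) \<longlongrightarrow> 0) at_infinity" by (rule tendsto_inverse_0)
  then have "((\<lambda>z. \<Sum>i\<le>n. coeff p i * inverse z ^ (n - i)) \<longlongrightarrow> (\<Sum>i\<le>n. coeff p i * 0 ^ (n - i))) at_infinity"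
    by (intro tendsto_intros)
  moreover have "(\<Sum>i\<le>n. coeff p i * 0 ^ (n - i)) = coeff p n"
  proof -
    have "(\<Sum>i\<le>n. coeff p i * 0 ^ (n - i)) = (\<Sum>i\<le>n. if i = n then coeff p n else 0)"
      by (intro sum.cong) (auto simp: power_0_left)
    then show ?thesis by simp
  qed
  ultimately have "((\<lambda>z. \<Sum>i\<le>n. coeff p i * inverse z ^ (n - i)) \<longlongrightarrow> coeff p n) at_infinity" by simp
  moreover have "\<forall>\<^sub>F z in at_infinity. (\<Sum>i\<le>n. coeff p i * inverse z ^ (n - i)) = poly p z / z ^ n"
    using eventually_not_equal_at_infinity[of 0]
  proof eventually_elim
    case (elim z)
    have "poly p z = (\<Sum>i\<le>n. coeff p i * z ^ i)"
      unfolding poly_altdef using n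
      by (intro sum.mono_neutral_left) (auto simp: coeff_eq_0)
    then have "poly p z / z ^ n = (\<Sum>i\<le>n. coeff p i * z ^ i / z ^ n)"
      by (simp add: sum_divide_distrib)
    also have "\<dots> = (\<Sum>i\<le>n. coeff p i * inverse z ^ (n - i))"
    proof (intro sum.cong refl)
      fix i assume "i \<in> {..n}"
      then have "z ^ n = z ^ i * z ^ (n - i)" by (simp add: power_add[symmetric])
      then show "coeff p i * z ^ i / z ^ n = coeff p i * inverse z ^ (n - i)"
        using elim by (simp add: field_simps)
    qed
    finally show ?case ..
  qed
  ultimately show ?thesis by (rule Lim_transform_eventually)
qed

lemma ray_at_infinity: "filterlim (\<lambda>r. of_real r * ray_dir D k) at_infinity at_top"
  unfolding filterlim_at_infinity[OF order_refl]
proof (intro allI impI)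
  fix b :: real assume "b > 0"
  show "\<forall>\<^sub>F r in at_top. b \<le> norm (of_real r * ray_dir D k)"
    using eventually_ge_at_top[of "max b 0"] by eventually_elim (simp add: norm_mult)
qed

lemma ray_dir_power: "D > 0 \<Longrightarrow> ray_dir D k ^ D = 1"
  unfolding ray_dir_def Complex.DeMoivre by (simp add: complex_eq_iff)

text \<open>The rays are the directions in which \<open>z\<^sup>D\<close> is positive, hence \<open>exp (- V z)\<close> beats every
  polynomial on them.\<close>

lemma exp_neg_V_decay:
  assumes V: "Polynomial.degree V = D" "lead_coeff V > 0" "D > 0"
  shows "((\<lambda>r. poly q (of_real r * ray_dir D k) * exp (- poly (cp V) (of_real r * ray_dir D k))) \<longlongrightarrow> 0) at_top"
proof -
  let ?z = "\<lambda>r. of_real r * ray_dir D k" and ?n = "Polynomial.degree q"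
  let ?\<gamma> = "lead_coeff V"
  have "((\<lambda>r. poly (cp V) (?z r) / ?z r ^ D) \<longlongrightarrow> of_real ?\<gamma>) at_top"
    using filterlim_compose[OF poly_over_power_tendsto[of "cp V" D] ray_at_infinity[of D k]] V
    by (simp add: coeff_map_poly)
  then have "((\<lambda>r. Re (poly (cp V) (?z r) / ?z r ^ D)) \<longlongrightarrow> ?\<gamma>) at_top"
    by (auto dest: tendsto_Re)
  then have "\<forall>\<^sub>F r in at_top. Re (poly (cp V) (?z r) / ?z r ^ D) > ?\<gamma> / 2"
    by (rule order_tendstoD) (use V in simp)
  then have ev: "\<forall>\<^sub>F r in at_top. Re (poly (cp V) (?z r)) \<ge> ?\<gamma> / 2 * r"
    using eventually_ge_at_top[of 1]
  proof eventually_elim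
    case (elim r)
    have "poly (cp V) (?z r) / ?z r ^ D = poly (cp V) (?z r) / of_real (r ^ D)"
      by (simp add: power_mult_distrib ray_dir_power V)
    then have "Re (poly (cp V) (?z r)) / r ^ D > ?\<gamma> / 2" using elim by (simp only: Re_divide_of_real)
    then have "Re (poly (cp V) (?z r)) > ?\<gamma> / 2 * r ^ D" using elim by (simp add: pos_less_divide_eq)
    moreover have "r ^ 1 \<le> r ^ D" using elim V by (intro power_increasing) auto
    then have "?\<gamma> / 2 * r \<le> ?\<gamma> / 2 * r ^ D" using V by (intro mult_left_mono) auto
    ultimately show ?case by linarith
  qed
  have l1: "((\<lambda>r. poly q (?z r) / ?z r ^ ?n) \<longlongrightarrow> coeff q ?n) at_top"
    using filterlim_compose[OF poly_over_power_tendsto[of q ?n] ray_at_infinity[of D k]] by simp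
  have l2: "((\<lambda>r. r ^ ?n * exp (- (?\<gamma> / 2 * r))) \<longlongrightarrow> 0) at_top"
  proof -
    have "((\<lambda>r. (?\<gamma> / 2 * r) ^ ?n / exp (?\<gamma> / 2 * r)) \<longlongrightarrow> 0) at_top"
      by (rule filterlim_compose[OF tendsto_power_div_exp_0])
         (rule filterlim_tendsto_pos_mult_at_top[OF tendsto_const _ filterlim_ident], use V in simp)
    then have "((\<lambda>r. (2 / ?\<gamma>) ^ ?n * ((?\<gamma> / 2 * r) ^ ?n / exp (?\<gamma> / 2 * r))) \<longlongrightarrow> 0) at_top"
      by (rule tendsto_mult_right_zero)
    moreover have "(2 / ?\<gamma>) ^ ?n * ((?\<gamma> / 2 * r) ^ ?n / exp (?\<gamma> / 2 * r)) = r ^ ?n * exp (- (?\<gamma> / 2 * r))" for r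
    proof -
      have "(2 / ?\<gamma>) ^ ?n * (?\<gamma> / 2 * r) ^ ?n = ((2 / ?\<gamma>) * (?\<gamma> / 2 * r)) ^ ?n"
        by (rule power_mult_distrib[symmetric])
      also have "(2 / ?\<gamma>) * (?\<gamma> / 2 * r) = r" using V(2) by auto
      finally show ?thesis by (simp only: times_divide_eq_right exp_minus divide_inverse mult.assoc[symmetric])
    qed
    ultimately show ?thesis by simp
  qed
  have "((\<lambda>r. norm (poly q (?z r) / ?z r ^ ?n) * (r ^ ?n * exp (- (?\<gamma> / 2 * r)))) \<longlongrightarrow> 0) at_top"
    using tendsto_mult[OF tendsto_norm[OF l1] l2] by simp
  then show ?thesis
  proof (rule Lim_null_comparison[rotated])
    show "\<forall>\<^sub>F r in at_top. norm (poly q (?z r) * exp (- poly (cp V) (?z r)))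
        \<le> norm (poly q (?z r) / ?z r ^ ?n) * (r ^ ?n * exp (- (?\<gamma> / 2 * r)))"
      using ev eventually_gt_at_top[of 0]
    proof eventually_elim
      case (elim r)
      have "norm (poly q (?z r) / ?z r ^ ?n) * (r ^ ?n * exp (- (?\<gamma> / 2 * r))) = norm (poly q (?z r)) * exp (- (?\<gamma> / 2 * r))"
        using elim by (simp only: norm_divide norm_power norm_mult norm_ray_dir norm_of_real) simp
      moreover have "norm (exp (- poly (cp V) (?z r))) \<le> exp (- (?\<gamma> / 2 * r))"
        using elim by (simp add: norm_exp_eq_Re)
      ultimately show ?case by (simp only: norm_mult) (intro mult_left_mono norm_ge_zero)
    qed
  qed
qed

lemma real_exp_neg_V_decay:
  fixes q :: "real poly"
  assumes V: "Polynomial.degree V = D" "lead_coeff V > 0" "D > 0" "even D"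
  shows "((\<lambda>x. poly q x * exp (- poly V x)) \<longlongrightarrow> 0) at_top"
    "((\<lambda>x. poly q x * exp (- poly V x)) \<longlongrightarrow> 0) at_bot"
proof -
  have *: "poly (cp q) (of_real x) * exp (- poly (cp V) (of_real x)) = of_real (poly q x * exp (- poly V x))" for x
    by (simp add: exp_of_real[symmetric])
  have "((\<lambda>x. poly (cp q) (of_real x) * exp (- poly (cp V) (of_real x))) \<longlongrightarrow> 0) at_top"
    using exp_neg_V_decay[OF V(1-3), of "cp q" 0] by simp
  then have "((\<lambda>x. complex_of_real (poly q x * exp (- poly V x))) \<longlongrightarrow> of_real 0) at_top"
    unfolding * by simp
  then show "((\<lambda>x. poly q x * exp (- poly V x)) \<longlongrightarrow> 0) at_top"
    by (simp only: tendsto_of_real_iff)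
  have "((\<lambda>x. poly (cp q) (of_real (- x)) * exp (- poly (cp V) (of_real (- x)))) \<longlongrightarrow> 0) at_top"
    using exp_neg_V_decay[OF V(1-3), of "cp q" "D div 2"] by (simp add: ray_dir_half V del: cpoly_of_real)
  then have "((\<lambda>x. complex_of_real (poly q (- x) * exp (- poly V (- x)))) \<longlongrightarrow> of_real 0) at_top"
    unfolding * by simp
  then have "((\<lambda>x. poly q (- x) * exp (- poly V (- x))) \<longlongrightarrow> 0) at_top"
    by (simp only: tendsto_of_real_iff)
  then show "((\<lambda>x. poly q x * exp (- poly V x)) \<longlongrightarrow> 0) at_bot"
    by (simp only: filterlim_at_bot_mirror)
qed

lemma poly_exp_neg_V_integrable:
  fixes q :: "real poly"
  assumes V: "Polynomial.degree V = D" "lead_coeff V > 0" "D > 0" "even D"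
  shows "integrable lborel (\<lambda>x. poly q x * exp (- poly V x))"
proof -
  define f where "f x = poly q x * exp (- poly V x)" for x
  \<comment> \<open>The extra factor \<open>1 + x\<^sup>2\<close> turns boundedness into a bound by an integrable function.\<close>
  define g where "g x = poly ([:1, 0, 1:] * q) x * exp (- poly V x)" for x
  have gf: "g x = (1 + x\<^sup>2) * f x" for x
    unfolding f_def g_def by (simp add: power2_eq_square distrib_right mult.assoc)
  have cf: "continuous_on UNIV f" unfolding f_def by (intro continuous_intros)
  have c: "continuous_on {a..b} g" for a b unfolding g_def by (intro continuous_intros)
  have small: "\<forall>\<^sub>F x in F. \<bar>g x\<bar> < 1" if "(g \<longlongrightarrow> 0) F" for F
    by (rule order_tendstoD(2)[OF tendsto_rabs_zero[OF that]]) simp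
  have lims: "(g \<longlongrightarrow> 0) at_top" "(g \<longlongrightarrow> 0) at_bot"
    unfolding g_def by (rule real_exp_neg_V_decay[OF V])+
  from small[OF lims(1)] small[OF lims(2)]
  obtain a b where ab: "\<And>x. x \<ge> b \<Longrightarrow> \<bar>g x\<bar> < 1" "\<And>x. x \<le> a \<Longrightarrow> \<bar>g x\<bar> < 1"
    unfolding eventually_at_top_linorder eventually_at_bot_linorder by blast
  have "compact (g ` {a..b})" by (rule compact_continuous_image[OF c compact_Icc])
  then have "\<exists>B. \<forall>y \<in> g ` {a..b}. \<bar>y\<bar> \<le> B"
    unfolding bounded_real[symmetric] by (rule compact_imp_bounded)
  then obtain B where "\<forall>y \<in> g ` {a..b}. \<bar>y\<bar> \<le> B" ..
  then have B: "\<And>x. x \<in> {a..b} \<Longrightarrow> \<bar>g x\<bar> \<le> B" by blast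
  have g: "\<bar>g x\<bar> \<le> max B 1" for x
  proof -
    have "x \<ge> b \<or> x \<le> a \<or> x \<in> {a..b}" using linear[of b x] linear[of x a] by auto
    then show ?thesis
    proof (elim disjE)
      assume "x \<ge> b" from ab(1)[OF this] show ?thesis by linarith
    next
      assume "x \<le> a" from ab(2)[OF this] show ?thesis by linarith
    next
      assume "x \<in> {a..b}" from B[OF this] show ?thesis by linarith
    qed
  qed
  have "integrable lborel (\<lambda>x::real. inverse (1 + x\<^sup>2))"
    using integrable_inverse_1_plus_square by (simp add: set_integrable_def)
  then have "integrable lborel (\<lambda>x. max B 1 * inverse (1 + x\<^sup>2))"
    by (rule integrable_mult_right)
  then have "integrable lborel f"
  proof (rule Bochner_Integration.integrable_bound)
    show "f \<in> borel_measurable lborel"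
      using borel_measurable_continuous_onI[OF cf] by simp
    show "AE x in lborel. norm (f x) \<le> norm (max B 1 * inverse (1 + x\<^sup>2))"
    proof (rule AE_I2)
      fix x :: real
      have p: "1 + x\<^sup>2 > 0" by (rule add_pos_nonneg) simp_all
      have "\<bar>g x\<bar> = \<bar>f x\<bar> * (1 + x\<^sup>2)" unfolding gf abs_mult using p by (simp only: abs_of_pos mult.commute)
      then have "\<bar>f x\<bar> \<le> max B 1 / (1 + x\<^sup>2)"
        unfolding pos_le_divide_eq[OF p] using g[of x] by (simp only:)
      also have "\<dots> \<le> norm (max B 1 * inverse (1 + x\<^sup>2))"
        unfolding divide_inverse real_norm_def by (rule abs_ge_self)
      finally show "norm (f x) \<le> norm (max B 1 * inverse (1 + x\<^sup>2))" unfolding real_norm_def .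
    qed
  qed
  then show ?thesis unfolding f_def .
qed

lemma tendsto_integral_symmetric:
  fixes f :: "real \<Rightarrow> real"
  assumes f: "integrable lborel f"
  shows "((\<lambda>R. integral {-R..R} f) \<longlongrightarrow> (LBINT x. f x)) at_top"
proof -
  have "((\<lambda>R. LINT x|lborel. indicat_real {-R..R} x * f x) \<longlongrightarrow> (LINT x|lborel. f x)) at_top"
  proof (rule integral_dominated_convergence_at_top[where w = "\<lambda>x. norm (f x)"])
    show "f \<in> borel_measurable lborel" using f by simp
    show "(\<lambda>x. indicat_real {-R..R} x * f x) \<in> borel_measurable lborel" for R using f by simp
    show "integrable lborel (\<lambda>x. norm (f x))" using f by simp
    show "\<forall>\<^sub>F R in at_top. AE x in lborel. norm (indicat_real {-R..R} x * f x) \<le> norm (f x)"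
      by (auto simp: indicator_def)
    show "AE x in lborel. ((\<lambda>R. indicat_real {-R..R} x * f x) \<longlongrightarrow> f x) at_top"
    proof (rule AE_I2)
      fix x :: real
      have "\<forall>\<^sub>F R in at_top. f x = indicat_real {-R..R} x * f x"
        using eventually_ge_at_top[of "\<bar>x\<bar>"] by eventually_elim (auto simp: indicator_def)
      then show "((\<lambda>R. indicat_real {-R..R} x * f x) \<longlongrightarrow> f x) at_top"
        by (rule Lim_transform_eventually[OF tendsto_const])
    qed
  qed
  moreover have "(LINT x|lborel. indicat_real {-R..R} x * f x) = integral {-R..R} f" for R
  proof -
    have "set_integrable lborel {-R..R} f"
      unfolding set_integrable_def real_scaleR_def using integrable_mult_indicator[of "{-R..R}" lborel f] f by simp
    from set_borel_integral_eq_integral(2)[OF this] show ?thesis by (simp add: set_lebesgue_integral_def)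
  qed
  ultimately show ?thesis by simp
qed

text \<open>The second-order operator that represents the Sobolev product in the space weighted by
  \<open>exp (- V)\<close>: integration by parts turns \<open>\<langle>P, Q\<rangle>\<close> into the integral of \<open>P\<close> against the image of
  \<open>Q\<close>.  It also annihilates the Sibuya solutions of even index.\<close>

definition sobolev_op :: "real poly \<Rightarrow> real \<Rightarrow> complex poly \<Rightarrow> complex poly" where
  "sobolev_op V lam q = q - Polynomial.smult (of_real lam) (pderiv (pderiv q))
      + Polynomial.smult (of_real lam) (pderiv (cp V) * pderiv q)"

lemma degree_sobolev_op_le:
  assumes "Polynomial.degree V = D" "D \<ge> 2"
  shows "Polynomial.degree (sobolev_op V lam q) \<le> Polynomial.degree q + D - 2"
proof (cases "Polynomial.degree q = 0")
  case True
  then obtain a where "q = [:a:]" by (rule degree_eq_zeroE)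
  then show ?thesis using assms by (simp add: sobolev_op_def pderiv_pCons)
next
  case False
  have d: "Polynomial.degree (pderiv (pderiv q)) \<le> Polynomial.degree q + D - 2" 
    "Polynomial.degree q \<le> Polynomial.degree q + D - 2"
    using assms by (auto simp: degree_pderiv)
  have "Polynomial.degree (pderiv (cp V) * pderiv q) \<le> (D - 1) + (Polynomial.degree q - 1)"
    using assms by (intro order.trans[OF degree_mult_le] add_mono) (auto simp: degree_pderiv)
  also have "\<dots> \<le> Polynomial.degree q + D - 2" using False assms by linarith
  finally show ?thesis unfolding sobolev_op_def using d
    by (intro degree_add_le degree_diff_le degree_smult_le[THEN order.trans])
qed

text \<open>The integrands differ by the derivative of \<open>lam P Q' exp (- V)\<close>, and \<open>P Q' exp (- V)\<close>
  vanishes at both ends.\<close>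

lemma sobolev_inner_limit:
  assumes V: "Polynomial.degree V = D" "lead_coeff V > 0" "D > 0" "even D"
  shows "((\<lambda>R. integral {-R..R} (\<lambda>x. poly P x * (poly Q x - lam * poly (pderiv (pderiv Q)) x
      + lam * poly (pderiv V) x * poly (pderiv Q) x) * exp (- poly V x))) \<longlongrightarrow> sobolev_inner V lam P Q) at_top"
proof -
  let ?w = "\<lambda>x. exp (- poly V x)"
  let ?a = "\<lambda>x. poly P x * poly Q x * ?w x" and ?b = "\<lambda>x. poly (pderiv P) x * poly (pderiv Q) x * ?w x"
  let ?g = "\<lambda>x. poly P x * poly (pderiv Q) x * ?w x"
  let ?f = "\<lambda>x. poly P x * (poly Q x - lam * poly (pderiv (pderiv Q)) x + lam * poly (pderiv V) x * poly (pderiv Q) x) * ?w x"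
  let ?dg = "\<lambda>x. ?b x + poly P x * (poly (pderiv (pderiv Q)) x - poly (pderiv V) x * poly (pderiv Q) x) * ?w x"
  have ia: "integrable lborel ?a" using poly_exp_neg_V_integrable[OF V, of "P * Q"] by simp
  have ib: "integrable lborel ?b" using poly_exp_neg_V_integrable[OF V, of "pderiv P * pderiv Q"] by simp
  have g0: "(?g \<longlongrightarrow> 0) at_top" "(?g \<longlongrightarrow> 0) at_bot"
    using real_exp_neg_V_decay[OF V, of "P * pderiv Q"] by simp_all
  have dg: "(?g has_real_derivative ?dg x) (at x)" for x
    by (auto intro!: derivative_eq_intros simp: algebra_simps)
  have int: "integral {-R..R} ?f = integral {-R..R} ?a + lam * integral {-R..R} ?b - lam * (?g R - ?g (-R))" 
    if R: "R \<ge> 0" for R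
  proof -
    have 1: "(?dg has_integral ?g R - ?g (-R)) {-R..R}"
    proof (rule fundamental_theorem_of_calculus)
      show "(?g has_vector_derivative ?dg x) (at x within {-R..R})" for x
        using dg[of x] unfolding has_real_derivative_iff_has_vector_derivative
        by (rule has_vector_derivative_at_within)
    qed (use R in simp)
    have 2: "(?a has_integral integral {-R..R} ?a) {-R..R}" "(?b has_integral integral {-R..R} ?b) {-R..R}"
      by (rule integrable_integral, rule integrable_continuous_real, intro continuous_intros)+
    have "((\<lambda>x. ?a x + lam * ?b x - lam * ?dg x) has_integral
        integral {-R..R} ?a + lam * integral {-R..R} ?b - lam * (?g R - ?g (-R))) {-R..R}"
      by (rule has_integral_diff[OF has_integral_add[OF 2(1) has_integral_mult_right[OF 2(2)]]
            has_integral_mult_right[OF 1]])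
    moreover have "?a x + lam * ?b x - lam * ?dg x = ?f x" for x by (simp add: algebra_simps)
    ultimately show ?thesis by (simp add: integral_unique)
  qed
  have "((\<lambda>R. integral {-R..R} ?a + lam * integral {-R..R} ?b - lam * (?g R - ?g (-R))) \<longlongrightarrow>
      (LBINT x. ?a x) + lam * (LBINT x. ?b x) - lam * (0 - 0)) at_top"
    by (rule tendsto_diff[OF tendsto_add[OF tendsto_integral_symmetric[OF ia]
          tendsto_mult_left[OF tendsto_integral_symmetric[OF ib]]]
        tendsto_mult_left[OF tendsto_diff[OF g0(1) g0(2)[unfolded filterlim_at_bot_mirror]]]])
  then have "((\<lambda>R. integral {-R..R} ?a + lam * integral {-R..R} ?b - lam * (?g R - ?g (-R))) \<longlongrightarrow> sobolev_inner V lam P Q) at_top"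
    by (simp add: sobolev_inner_def)
  moreover have "\<forall>\<^sub>F R in at_top. integral {-R..R} ?a + lam * integral {-R..R} ?b - lam * (?g R - ?g (-R)) = integral {-R..R} ?f"
    using eventually_ge_at_top[of 0] by eventually_elim (simp only: int)
  ultimately show ?thesis by (rule Lim_transform_eventually)
qed

lemma AE_poly_nonzero:
  fixes P :: "real poly"
  assumes "P \<noteq> 0"
  shows "AE x in lborel. poly P x \<noteq> 0"
proof -
  have "{x. poly P x = 0} \<in> null_sets lborel"
    using poly_roots_finite[OF assms] by (rule finite_imp_null_set_lborel)
  then show ?thesis by (rule AE_I') auto
qed

lemma sobolev_inner_self_pos:
  assumes V: "Polynomial.degree V = D" "lead_coeff V > 0" "D > 0" "even D" and "lam > 0" "P \<noteq> 0"
  shows "sobolev_inner V lam P P > 0"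
proof -
  let ?a = "\<lambda>x. poly P x * poly P x * exp (- poly V x)"
  have ia: "integrable lborel ?a" using poly_exp_neg_V_integrable[OF V, of "P * P"] by simp
  have 1: "(LBINT x. ?a x) \<ge> 0" by (rule Bochner_Integration.integral_nonneg) simp
  have 2: "(LBINT x. ?a x) \<noteq> 0"
  proof
    assume "(LBINT x. ?a x) = 0"
    moreover have "AE x in lborel. 0 \<le> ?a x" by (rule AE_I2) simp
    ultimately have "AE x in lborel. ?a x = 0"
      using integral_nonneg_eq_0_iff_AE[OF ia] by blast
    then have A: "AE x in lborel. poly P x = 0" by eventually_elim simp
    have "AE x in (lborel :: real measure). False"
      by (rule eventually_mono[OF eventually_conj[OF A AE_poly_nonzero[OF assms(6)]]]) blast
    then have "ae_filter (lborel :: real measure) = bot" unfolding trivial_limit_def .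
    then show False by (simp add: ae_filter_eq_bot_iff)
  qed
  have 3: "(LBINT x. poly (pderiv P) x * poly (pderiv P) x * exp (- poly V x)) \<ge> 0"
    by (rule Bochner_Integration.integral_nonneg) simp
  have "(LBINT x. ?a x) > 0" using 1 2 by linarith
  moreover have "lam * (LBINT x. poly (pderiv P) x * poly (pderiv P) x * exp (- poly V x)) \<ge> 0"
    using assms(5) 3 by (rule mult_nonneg_nonneg[OF less_imp_le])
  ultimately show ?thesis unfolding sobolev_inner_def by (rule add_pos_nonneg)
qed

section \<open>Sibuya solutions on the rays\<close>

locale sibuya_data =
  fixes D :: nat and lam \<gamma> \<rho> :: real and V :: "real poly"
    and \<phi> \<psi> :: "complex \<Rightarrow> complex" and F :: "nat \<Rightarrow> complex \<Rightarrow> complex"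
  assumes evenD: "even D" and D4: "D \<ge> 4" and lam: "lam > 0"
    and degV: "Polynomial.degree V = D" and lcV: "lead_coeff V = \<gamma>" and \<gamma>: "\<gamma> > 0"
    and coord: "sibuya_coordinate D \<gamma> V \<rho> \<phi> \<psi>"
    and sol: "\<And>k. k < 2 * D \<Longrightarrow> sibuya_solution D V lam \<rho> \<psi> k (F k)"
begin

lemma D0: "D > 0" using D4 by simp

lemma lcV_pos: "lead_coeff V > 0" using lcV \<gamma> by simp

abbreviation e where "e k \<equiv> ray_dir D k"

text \<open>In the coordinate \<open>\<phi>\<close> a unit disc about a far point of the ray of argument \<open>2\<pi>j/D\<close> has
  almost the same argument, because \<open>\<phi>\<close> is asymptotic to the identity; the sector with index \<open>2j\<close>
  has exactly this bisector.\<close>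

lemma disc_in_sector:
  obtains r0 where "r0 > 1" "\<And>r z. r \<ge> r0 \<Longrightarrow> norm (z - of_real r * e j) \<le> 1 \<Longrightarrow> z \<in> sibuya_sector D \<rho> \<psi> (2 * j)"
proof -
  let ?\<theta> = "2 * pi * real j / real D" and ?\<beta> = "pi / real D"
  let ?c = "cos ?\<beta>"
  have \<beta>: "0 < ?\<beta>" "?\<beta> < pi / 2" using D4 by (auto simp: field_simps)
  have \<beta>': "?\<beta> \<le> pi" "2 * ?\<beta> \<le> pi" using \<beta> pi_gt_zero by linarith+
  have c0: "0 \<le> ?c" using \<beta> by (intro cos_ge_zero) auto
  have "cos ?\<beta> < cos 0" by (rule cos_monotone_0_pi) (use \<beta> \<beta>' in simp_all)
  then have c1: "?c < 1" by simp
  \<comment> \<open>Relative errors of at most \<open>3 \<eta>\<close> do not leave the cone of half-opening \<open>\<beta>\<close>.\<close>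
  define \<eta> where "\<eta> = (1 - ?c) / 10"
  have \<eta>: "0 < \<eta>" "\<eta> < 1" using c0 c1 by (auto simp: \<eta>_def)
  have \<rho>: "\<rho> > 0" using coord by (simp add: sibuya_coordinate_def)
  have O: "(\<lambda>z. \<phi> z / z - 1) \<in> O[at_infinity](\<lambda>z. 1 / z)"
    using coord by (simp add: sibuya_coordinate_def)
  obtain c where c: "c > 0" "\<forall>\<^sub>F z in at_infinity. norm (\<phi> z / z - 1) \<le> c * norm (1 / z)"
    using landau_o.bigE[OF O] by blast
  have inv: "\<forall>\<^sub>F z in at_infinity. \<psi> (\<phi> z) = z"
    using coord by (simp add: sibuya_coordinate_def)
  obtain b where b: "\<And>z. norm z \<ge> b \<Longrightarrow> norm (\<phi> z / z - 1) \<le> c * norm (1 / z) \<and> \<psi> (\<phi> z) = z"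
    using eventually_conj[OF c(2) inv] unfolding eventually_at_infinity by blast
  define r0 where "r0 = Max {b + 1, 2 * \<rho> + 1, 1 / \<eta>, c / \<eta> + 1, 2}"
  have r0: "b + 1 \<le> r0" "2 * \<rho> + 1 \<le> r0" "1 / \<eta> \<le> r0" "c / \<eta> + 1 \<le> r0" "2 \<le> r0"
    unfolding r0_def by (rule Max_ge; simp)+
  show ?thesis
  proof (rule that[of r0])
    show "r0 > 1" using r0 by simp
    fix r z assume r: "r0 \<le> r" and z: "norm (z - of_real r * e j) \<le> 1"
    have "norm (of_real r * e j) \<le> norm z + norm (of_real r * e j - z)"
      using norm_triangle_ineq[of z "of_real r * e j - z"] by simp
    then have nz: "norm z \<ge> r - 1" using z r r0 by (simp add: norm_mult norm_minus_commute)
    have zb: "norm z \<ge> b" "norm z \<ge> 2 * \<rho>" "norm z \<ge> c / \<eta>" "norm z > 0" using nz r r0 by linarith+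
    have z0: "z \<noteq> 0" using zb(4) by auto
    have rpos: "r > 0" using r r0 by linarith
    have "norm (\<phi> z / z - 1) \<le> c / norm z" using b[OF zb(1)] by (simp add: norm_divide)
    also have "\<dots> \<le> \<eta>" using zb(3,4) \<eta> by (simp add: field_simps)
    finally have p: "norm (\<phi> z / z - 1) \<le> \<eta>" .
    define v where "v = z * cis (- ?\<theta>) / of_real r"
    have "v - 1 = (z - of_real r * e j) * cis (- ?\<theta>) / of_real r"
      using rpos by (simp add: v_def ray_dir_def field_simps cis_mult)
    then have "norm (v - 1) = norm (z - of_real r * e j) / r"
      using rpos by (simp add: norm_mult norm_divide)
    also have "\<dots> \<le> 1 / r" using z rpos by (simp add: divide_right_mono)
    also have "\<dots> \<le> \<eta>"
    proof -
      have "1 / \<eta> \<le> r" using r0(3) r by linarith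
      then show ?thesis using rpos \<eta> by (simp add: field_simps)
    qed
    finally have q: "norm (v - 1) \<le> \<eta>" .
    define u where "u = \<phi> z * cis (- ?\<theta>) / of_real r"
    have "u - 1 = (\<phi> z / z - 1) * v + (v - 1)"
      using z0 rpos by (simp add: u_def v_def field_simps)
    then have "norm (u - 1) \<le> norm ((\<phi> z / z - 1) * v) + norm (v - 1)"
      by (simp only: norm_triangle_ineq)
    also have "\<dots> \<le> \<eta> * norm v + \<eta>"
      unfolding norm_mult by (rule add_mono[OF mult_right_mono[OF p norm_ge_zero] q])
    finally have "norm (u - 1) \<le> \<eta> * norm v + \<eta>" .
    moreover have nv: "norm v \<le> 2" using q \<eta> norm_triangle_ineq[of "v - 1" 1] by simp
    have "\<eta> * norm v \<le> \<eta> * 2" using nv \<eta> by (intro mult_left_mono) auto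
    ultimately have u: "norm (u - 1) \<le> 3 * \<eta>" by simp
    have nu: "norm u \<le> 1 + 3 * \<eta>" using u norm_triangle_ineq[of "u - 1" 1] by simp
    have Ru: "Re u \<ge> 1 - 3 * \<eta>" using u abs_Re_le_cmod[of "u - 1"] by simp
    have "?c * norm u \<le> ?c * (1 + 3 * \<eta>)" using nu c0 by (rule mult_left_mono)
    also have "\<dots> \<le> ?c + 3 * \<eta>" using c1 \<eta> by (simp add: algebra_simps)
    also have "\<dots> < 1 - 3 * \<eta>" using c1 by (simp add: \<eta>_def field_simps)
    finally have cu: "?c * norm u < Re u" using Ru by simp
    have Ru0: "0 < Re u" using cu c0 by (smt (verit) mult_nonneg_nonneg norm_ge_zero)
    have \<phi>u: "\<phi> z * cis (- ?\<theta>) = of_real r * u" using rpos by (simp add: u_def)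
    have n\<phi>: "norm (\<phi> z) = r * norm u"
    proof -
      have "norm (\<phi> z) = norm (\<phi> z * cis (- ?\<theta>))" by (simp add: norm_mult)
      then show ?thesis using rpos by (simp only: \<phi>u norm_mult) simp
    qed
    have "\<phi> z \<in> cone (?\<theta> - ?\<beta>) (?\<theta> + ?\<beta>)"
    proof (subst cone_iff)
      show "?\<theta> - ?\<beta> < ?\<theta> + ?\<beta>" "(?\<theta> + ?\<beta>) - (?\<theta> - ?\<beta>) \<le> pi"
        using \<beta>(1) \<beta>' by linarith+
      have m: "(?\<theta> - ?\<beta> + (?\<theta> + ?\<beta>)) / 2 = ?\<theta>" "(?\<theta> + ?\<beta> - (?\<theta> - ?\<beta>)) / 2 = ?\<beta>" by simp_all
      have "?c * (r * norm u) < r * Re u" using mult_strict_left_mono[OF cu rpos] by (simp add: mult_ac)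
      then show "0 < Re (\<phi> z * cis (- ((?\<theta> - ?\<beta> + (?\<theta> + ?\<beta>)) / 2))) \<and>
        cos ((?\<theta> + ?\<beta> - (?\<theta> - ?\<beta>)) / 2) * norm (\<phi> z) < Re (\<phi> z * cis (- ((?\<theta> - ?\<beta> + (?\<theta> + ?\<beta>)) / 2)))"
        unfolding m n\<phi> \<phi>u using Ru0 rpos by simp
    qed
    then obtain s t where st: "\<phi> z = rcis s t" "0 < s" "?\<theta> - ?\<beta> < t" "t < ?\<theta> + ?\<beta>"
      unfolding cone_def by blast
    have "norm z / 2 \<le> norm (\<phi> z)"
      using coord zb(2) \<rho> by (auto simp: sibuya_coordinate_def)
    then have s: "s \<ge> \<rho>" using st zb(2) by simp
    have "pi * (real (2 * j) - 1) / real D \<le> t" "t \<le> pi * (real (2 * j) + 1) / real D"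
      using st by (auto simp: field_simps diff_divide_distrib add_divide_distrib)
    moreover have "\<psi> (rcis s t) = z" using b[OF zb(1)] st by simp
    ultimately show "z \<in> sibuya_sector D \<rho> \<psi> (2 * j)"
      unfolding sibuya_sector_def using s by (metis (mono_tags, lifting) image_eqI mem_Collect_eq)
  qed
qed

lemma F_near_1:
  assumes j: "j < D"
  obtains r0 where "r0 > 1" "\<And>r z. r \<ge> r0 \<Longrightarrow> norm (z - of_real r * e j) \<le> 1 \<Longrightarrow> norm (F (2 * j) z - 1) \<le> 1 / 2"
proof -
  obtain r1 where r1: "r1 > 1" "\<And>r z. r \<ge> r1 \<Longrightarrow> norm (z - of_real r * e j) \<le> 1 \<Longrightarrow> z \<in> sibuya_sector D \<rho> \<psi> (2 * j)"
    using disc_in_sector[of j] by metis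
  have "(\<lambda>z. F (2 * j) z - 1) \<in> O[inf at_infinity (principal (sibuya_sector D \<rho> \<psi> (2 * j)))](\<lambda>z. of_real (norm z powi (2 - int D)))"
    using sol[of "2 * j"] j by (simp add: sibuya_solution_def)
  then obtain c where c: "c > 0" "\<forall>\<^sub>F z in inf at_infinity (principal (sibuya_sector D \<rho> \<psi> (2 * j))).
      norm (F (2 * j) z - 1) \<le> c * norm (of_real (norm z powi (2 - int D)) :: complex)"
    using landau_o.bigE by blast
  then obtain b where b: "\<And>z. norm z \<ge> b \<Longrightarrow> z \<in> sibuya_sector D \<rho> \<psi> (2 * j) \<Longrightarrow>
      norm (F (2 * j) z - 1) \<le> c * norm (of_real (norm z powi (2 - int D)) :: complex)"
    unfolding eventually_inf_principal eventually_at_infinity by blast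
  define r0 where "r0 = Max {r1, b + 1, 2, 2 * c + 1}"
  have r0: "r1 \<le> r0" "b + 1 \<le> r0" "2 \<le> r0" "2 * c + 1 \<le> r0"
    unfolding r0_def by (rule Max_ge; simp)+
  show ?thesis
  proof (rule that[of r0])
    show "r0 > 1" using r0 by simp
    fix r z assume r: "r0 \<le> r" and z: "norm (z - of_real r * e j) \<le> 1"
    have "norm (of_real r * e j) \<le> norm z + norm (of_real r * e j - z)"
      using norm_triangle_ineq[of z "of_real r * e j - z"] by simp
    then have nz: "norm z \<ge> r - 1" using z r r0 by (simp add: norm_mult norm_minus_commute)
    have zb: "norm z \<ge> b" "norm z \<ge> 1" "norm z \<ge> 2 * c" using nz r r0 by linarith+
    have "norm z powi (2 - int D) \<le> norm z powi (- 1)"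
      using zb(2) D4 by (intro power_int_increasing) auto
    also have "\<dots> = 1 / norm z" by (simp add: power_int_minus divide_inverse)
    finally have "norm z powi (2 - int D) \<le> 1 / norm z" .
    moreover have "norm (of_real (norm z powi (2 - int D)) :: complex) = norm z powi (2 - int D)"
      unfolding norm_of_real by simp
    ultimately have "c * norm (of_real (norm z powi (2 - int D)) :: complex) \<le> c * (1 / norm z)"
      using c(1) by (intro mult_left_mono) simp_all
    also have "\<dots> \<le> 1 / 2"
    proof -
      have "norm z > 0" using zb(2) by linarith
      then show ?thesis using zb(3) by (simp add: divide_le_eq)
    qed
    finally show "norm (F (2 * j) z - 1) \<le> 1 / 2"
      using b[OF zb(1) r1(2)[OF _ z]] r r0 by simp
  qed
qed

lemma F_holo: "k < 2 * D \<Longrightarrow> F k holomorphic_on UNIV"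
  using sol by (simp add: sibuya_solution_def)

lemma F_deriv: "k < 2 * D \<Longrightarrow> (F k has_field_derivative deriv (F k) z) (at z)"
  using F_holo[of k] by (metis holomorphic_derivI open_UNIV UNIV_I)

lemma F_deriv2: "k < 2 * D \<Longrightarrow> (deriv (F k) has_field_derivative deriv (deriv (F k)) z) (at z)"
  using holomorphic_deriv[OF F_holo[of k] open_UNIV] by (metis holomorphic_derivI open_UNIV UNIV_I)

lemma F_ode: "j < D \<Longrightarrow> deriv (deriv (F (2 * j))) z = poly (cp (pderiv V)) z * deriv (F (2 * j)) z + F (2 * j) z / of_real lam"
  using sol[of "2 * j"] by (simp add: sibuya_solution_def algebra_simps)

text \<open>The bound on the derivative is Cauchy's estimate on unit discs, which stay inside the sector.\<close>

lemma F_bounded_on_ray: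
  assumes j: "j < D"
  obtains r0 where "\<And>r. r \<ge> r0 \<Longrightarrow> norm (F (2 * j) (of_real r * e j) - 1) \<le> 1 / 2"
    "\<And>r. r \<ge> r0 \<Longrightarrow> norm (F (2 * j) (of_real r * e j)) \<le> 2"
    "\<And>r. r \<ge> r0 \<Longrightarrow> norm (deriv (F (2 * j)) (of_real r * e j)) \<le> 2"
proof -
  obtain r0 where r0: "r0 > 1" "\<And>r z. r \<ge> r0 \<Longrightarrow> norm (z - of_real r * e j) \<le> 1 \<Longrightarrow> norm (F (2 * j) z - 1) \<le> 1 / 2"
    using F_near_1[OF j] by metis
  have le2: "norm (F (2 * j) z) \<le> 2" if "r \<ge> r0" "norm (z - of_real r * e j) \<le> 1" for r z
    using r0(2)[OF that] norm_triangle_ineq[of "F (2 * j) z - 1" 1] by simp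
  show ?thesis
  proof (rule that[of r0])
    fix r assume r: "r \<ge> r0"
    show "norm (F (2 * j) (of_real r * e j) - 1) \<le> 1 / 2" using r0(2)[OF r] by simp
    show "norm (F (2 * j) (of_real r * e j)) \<le> 2" using le2[OF r] by simp
    have h: "F (2 * j) holomorphic_on UNIV" using F_holo j by simp
    have "norm ((deriv ^^ 1) (F (2 * j)) (of_real r * e j)) \<le> fact 1 * 2 / 1 ^ 1"
    proof (rule Cauchy_inequality)
      show "F (2 * j) holomorphic_on ball (of_real r * e j) 1" using h holomorphic_on_subset by blast
      show "continuous_on (cball (of_real r * e j) 1) (F (2 * j))"
        using holomorphic_on_imp_continuous_on[OF h] continuous_on_subset by blast
      show "norm (F (2 * j) x) \<le> 2" if "norm (of_real r * e j - x) = 1" for x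
        using le2[OF r, of x] that by (simp add: norm_minus_commute)
    qed simp
    then show "norm (deriv (F (2 * j)) (of_real r * e j)) \<le> 2" by simp
  qed
qed

text \<open>The boundary term in Green's identity (the bilinear concomitant of the operator).\<close>

definition boundary_form :: "nat \<Rightarrow> complex poly \<Rightarrow> complex \<Rightarrow> complex" where
  "boundary_form j q z = (poly (pderiv q) z * F (2 * j) z - poly q z * deriv (F (2 * j)) z) * exp (- poly (cp V) z)"

text \<open>Green's identity: \<open>F\<close> is annihilated by the operator, which is formally self-adjoint for the
  weight \<open>exp (- V)\<close>, so only boundary terms remain.\<close>

lemma boundary_form_deriv:
  assumes j: "j < D"
  shows "((\<lambda>z. - of_real lam * boundary_form j q z) has_field_derivative
     poly (sobolev_op V lam q) z * (F (2 * j) z * exp (- poly (cp V) z))) (at z)"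
proof -
  note [derivative_intros] = DERIV_chain'[OF _ F_deriv] DERIV_chain'[OF _ F_deriv2]
  have k: "2 * j < 2 * D" using j by simp
  let ?V' = "poly (pderiv (cp V)) z"
  have l: "of_real lam \<noteq> (0::complex)" using lam by simp
  have "((\<lambda>z. - of_real lam * boundary_form j q z) has_field_derivative
     - of_real lam * (((poly (pderiv (pderiv q)) z * F (2 * j) z + poly (pderiv q) z * deriv (F (2 * j)) z)
        - (poly (pderiv q) z * deriv (F (2 * j)) z + poly q z * deriv (deriv (F (2 * j))) z)) * exp (- poly (cp V) z)
       + (poly (pderiv q) z * F (2 * j) z - poly q z * deriv (F (2 * j)) z) * (exp (- poly (cp V) z) * (- ?V')))) (at z)"
    unfolding boundary_form_def
    by (rule derivative_eq_intros F_deriv F_deriv2 k refl poly_DERIV | simp add: algebra_simps k)+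
  moreover have "- of_real lam * (((poly (pderiv (pderiv q)) z * F (2 * j) z + poly (pderiv q) z * deriv (F (2 * j)) z)
        - (poly (pderiv q) z * deriv (F (2 * j)) z + poly q z * deriv (deriv (F (2 * j))) z)) * exp (- poly (cp V) z)
       + (poly (pderiv q) z * F (2 * j) z - poly q z * deriv (F (2 * j)) z) * (exp (- poly (cp V) z) * (- ?V')))
     = poly (sobolev_op V lam q) z * (F (2 * j) z * exp (- poly (cp V) z))"
    unfolding F_ode[OF j] cpoly_pderiv sobolev_op_def using l
    by (simp add: field_simps)
  ultimately show ?thesis by simp
qed

text \<open>Only the boundary term at the origin survives: at infinity \<open>F\<close> and \<open>F'\<close> stay bounded on the
  ray while \<open>exp (- V)\<close> decays.\<close>

lemma sibuya_ray_moment: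
  assumes j: "j < D"
  shows "((\<lambda>R. integral {0..R} (\<lambda>r. e j * (poly (sobolev_op V lam q) (of_real r * e j) *
      (F (2 * j) (of_real r * e j) * exp (- poly (cp V) (of_real r * e j))))))
    \<longlongrightarrow> of_real lam * boundary_form j q 0) at_top"
proof -
  let ?h = "\<lambda>z. poly (sobolev_op V lam q) z * (F (2 * j) z * exp (- poly (cp V) z))"
  let ?z = "\<lambda>r. of_real r * e j"
  obtain r0 where r0: "\<And>r. r \<ge> r0 \<Longrightarrow> norm (F (2 * j) (?z r)) \<le> 2"
    "\<And>r. r \<ge> r0 \<Longrightarrow> norm (deriv (F (2 * j)) (?z r)) \<le> 2"
    using F_bounded_on_ray[OF j] by metis
  have dec: "((\<lambda>r. poly p (?z r) * exp (- poly (cp V) (?z r))) \<longlongrightarrow> 0) at_top" for p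
    by (rule exp_neg_V_decay[OF degV lcV_pos D0])
  have B0: "((\<lambda>r. boundary_form j q (?z r)) \<longlongrightarrow> 0) at_top"
  proof (rule Lim_null_comparison)
    let ?a = "\<lambda>r. norm (poly (pderiv q) (?z r) * exp (- poly (cp V) (?z r)))"
    let ?b = "\<lambda>r. norm (poly q (?z r) * exp (- poly (cp V) (?z r)))"
    show "((\<lambda>r. ?a r * 2 + ?b r * 2) \<longlongrightarrow> 0) at_top"
      using tendsto_add[OF tendsto_mult_right[OF tendsto_norm[OF dec[of "pderiv q"]], of 2]
        tendsto_mult_right[OF tendsto_norm[OF dec[of q]], of 2]] by simp
    show "\<forall>\<^sub>F r in at_top. norm (boundary_form j q (?z r)) \<le> ?a r * 2 + ?b r * 2"
      using eventually_ge_at_top[of r0]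
    proof eventually_elim
      case (elim r)
      have "boundary_form j q (?z r) = (poly (pderiv q) (?z r) * exp (- poly (cp V) (?z r))) * F (2 * j) (?z r)
          - (poly q (?z r) * exp (- poly (cp V) (?z r))) * deriv (F (2 * j)) (?z r)"
        by (simp add: boundary_form_def algebra_simps)
      then have "norm (boundary_form j q (?z r)) \<le> ?a r * norm (F (2 * j) (?z r)) + ?b r * norm (deriv (F (2 * j)) (?z r))"
        by (metis norm_mult norm_triangle_ineq4)
      also have "\<dots> \<le> ?a r * 2 + ?b r * 2"
        using r0 elim by (intro add_mono mult_left_mono) auto
      finally show ?case .
    qed
  qed
  have int: "integral {0..R} (\<lambda>r. e j * ?h (?z r)) = - of_real lam * boundary_form j q (?z R) + of_real lam * boundary_form j q 0"
    if "R \<ge> 0" for R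
  proof -
    have "((\<lambda>r. e j * ?h (?z r)) has_integral - of_real lam * boundary_form j q (?z R) - (- of_real lam * boundary_form j q (?z 0))) {0..R}"
      by (rule integral_along_ray[where S = UNIV and g = "\<lambda>z. - of_real lam * boundary_form j q z" and h = ?h])
         (use boundary_form_deriv[OF j] that in auto)
    from integral_unique[OF this] show ?thesis by simp
  qed
  have "((\<lambda>R. - of_real lam * boundary_form j q (?z R) + of_real lam * boundary_form j q 0) \<longlongrightarrow> - of_real lam * 0 + of_real lam * boundary_form j q 0) at_top"
    by (intro tendsto_intros B0)
  then have "((\<lambda>R. - of_real lam * boundary_form j q (?z R) + of_real lam * boundary_form j q 0) \<longlongrightarrow> of_real lam * boundary_form j q 0) at_top"
    by simp
  moreover have "\<forall>\<^sub>F R in at_top. - of_real lam * boundary_form j q (?z R) + of_real lam * boundary_form j q 0 = integral {0..R} (\<lambda>r. e j * ?h (?z r))"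
    using eventually_ge_at_top[of 0] by eventually_elim (simp only: int)
  ultimately show ?thesis by (rule Lim_transform_eventually)
qed

end

section \<open>Connection coefficients and moments of the weights\<close>

text \<open>Integrals over the contour are taken over the rays truncated at radius \<open>R\<close>, and moments are
  limits as \<open>R\<close> grows.  Convergence is then part of each moment identity instead of a separate
  integrability statement.\<close>

definition ray_moment :: "nat \<Rightarrow> (nat \<Rightarrow> complex \<Rightarrow> complex) \<Rightarrow> complex poly \<Rightarrow> real \<Rightarrow> complex" where
  "ray_moment D \<omega> p R =
     (\<Sum>k<D. ray_dir D k * integral {0..R} (\<lambda>r. poly p (of_real r * ray_dir D k) * \<omega> k (of_real r * ray_dir D k)))"

definition has_moment :: "nat \<Rightarrow> (nat \<Rightarrow> complex \<Rightarrow> complex) \<Rightarrow> complex poly \<Rightarrow> complex \<Rightarrow> bool" where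
  "has_moment D \<omega> p L \<longleftrightarrow> (ray_moment D \<omega> p \<longlongrightarrow> L) at_top"

lemma has_moment_unique: "has_moment D \<omega> p L \<Longrightarrow> has_moment D \<omega> p M \<Longrightarrow> L = M"
  unfolding has_moment_def using tendsto_unique[OF trivial_limit_at_top_linorder] by blast

lemma has_moment_0 [simp]: "has_moment D \<omega> 0 0"
  by (simp add: has_moment_def ray_moment_def[abs_def])

lemma has_moment_smult:
  assumes "has_moment D \<omega> p L"
  shows "has_moment D \<omega> (Polynomial.smult a p) (a * L)"
proof -
  have "ray_moment D \<omega> (Polynomial.smult a p) = (\<lambda>R. a * ray_moment D \<omega> p R)"
    by (simp add: ray_moment_def[abs_def] sum_distrib_left mult_ac)
  then show ?thesis using assms unfolding has_moment_def by (simp only: tendsto_mult_left)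
qed

definition ray_continuous :: "nat \<Rightarrow> (nat \<Rightarrow> complex \<Rightarrow> complex) \<Rightarrow> bool" where
  "ray_continuous D \<omega> \<longleftrightarrow> (\<forall>k<D. continuous_on UNIV (\<omega> k))"

lemma ray_continuous_integrable:
  assumes "ray_continuous D \<omega>" "k < D"
  shows "continuous_on S (\<lambda>r. poly p (of_real r * ray_dir D k) * \<omega> k (of_real r * ray_dir D k))"
proof -
  have "continuous_on UNIV (\<omega> k)" using assms by (simp add: ray_continuous_def)
  then have "continuous_on S (\<lambda>r. \<omega> k (of_real r * ray_dir D k))"
    by (rule continuous_on_compose2) (auto intro!: continuous_intros)
  moreover have "continuous_on S (\<lambda>r. poly p (of_real r * ray_dir D k))"
    by (intro continuous_intros)
  ultimately show ?thesis by (intro continuous_on_mult)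
qed

lemma has_moment_add:
  assumes c: "ray_continuous D \<omega>" and "has_moment D \<omega> p L" "has_moment D \<omega> q M"
  shows "has_moment D \<omega> (p + q) (L + M)"
proof -
  have eq: "ray_moment D \<omega> (p + q) R = ray_moment D \<omega> p R + ray_moment D \<omega> q R" for R
    unfolding ray_moment_def sum.distrib[symmetric] distrib_left[symmetric]
  proof (intro sum.cong refl arg_cong2[where f = "(*)"])
    fix k assume k: "k \<in> {..<D}"
    have i: "(\<lambda>r. poly p (of_real r * ray_dir D k) * \<omega> k (of_real r * ray_dir D k)) integrable_on {0..R}" for p
      by (rule integrable_continuous_real) (use ray_continuous_integrable[OF c] k in blast)
    show "integral {0..R} (\<lambda>r. poly (p + q) (of_real r * ray_dir D k) * \<omega> k (of_real r * ray_dir D k))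
      = integral {0..R} (\<lambda>r. poly p (of_real r * ray_dir D k) * \<omega> k (of_real r * ray_dir D k))
      + integral {0..R} (\<lambda>r. poly q (of_real r * ray_dir D k) * \<omega> k (of_real r * ray_dir D k))"
      by (subst integral_add[OF i i, symmetric]) (simp add: distrib_right)
  qed
  show ?thesis using tendsto_add[OF assms(2,3)[unfolded has_moment_def]]
    unfolding has_moment_def eq[abs_def] .
qed

lemma has_moment_sum:
  assumes c: "ray_continuous D \<omega>" and "finite I" "\<And>i. i \<in> I \<Longrightarrow> has_moment D \<omega> (p i) (L i)"
  shows "has_moment D \<omega> (\<Sum>i\<in>I. p i) (\<Sum>i\<in>I. L i)"
  using assms(2,3) by (induction I rule: finite_induct) (auto intro!: has_moment_add[OF c])

context sibuya_data begin

text \<open>An energy estimate: along either half of the real axis the function \<open>Re (cnj F \<cdot> F') exp (- V)\<close>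
  has derivative \<open>(\<bar>F'\<bar>\<^sup>2 + \<bar>F\<bar>\<^sup>2 / lam) exp (- V)\<close> and tends to \<open>0\<close>; this determines its sign at the
  origin.\<close>

lemma energy_sign:
  assumes j: "j < D" and s: "s * s = (1::real)" "e j = of_real s"
  shows "s * inner (F (2 * j) 0) (deriv (F (2 * j)) 0) < 0"
proof -
  have k: "2 * j < 2 * D" using j by simp
  let ?z = "\<lambda>r. of_real r * e j"
  let ?w = "\<lambda>r. exp (- poly V (r * s))"
  let ?a = "\<lambda>r. F (2 * j) (?z r)" and ?b = "\<lambda>r. e j * deriv (F (2 * j)) (?z r)"
  let ?c = "\<lambda>r. poly (pderiv V) (r * s)"
  define g where "g r = inner (?a r) (?b r) * ?w r" for r
  have zr: "?z r = of_real (r * s)" for r by (simp add: s)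
  have zd: "(?z has_vector_derivative e j) (at r)" for r
    by (auto intro!: derivative_eq_intros simp: has_vector_derivative_def scaleR_conv_of_real)
  have ad: "(?a has_vector_derivative ?b r) (at r)" for r
    using field_vector_diff_chain_at[OF zd F_deriv[OF k]] by (simp add: o_def)
  have "((\<lambda>r. deriv (F (2 * j)) (?z r)) has_vector_derivative e j * deriv (deriv (F (2 * j))) (?z r)) (at r)" for r
    using field_vector_diff_chain_at[OF zd F_deriv2[OF k]] by (simp add: o_def)
  then have "(?b has_vector_derivative e j * (e j * deriv (deriv (F (2 * j))) (?z r))) (at r)" for r
    by (rule has_vector_derivative_mult_right)
  moreover have "e j * (e j * x) = x" for x
    unfolding s(2) mult.assoc[symmetric] of_real_mult[symmetric] s(1) by simp
  ultimately have bd: "(?b has_vector_derivative deriv (deriv (F (2 * j))) (?z r)) (at r)" for r by simp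
  have ode: "deriv (deriv (F (2 * j))) (?z r) = of_real (?c r) * deriv (F (2 * j)) (?z r) + ?a r / of_real lam" for r
    unfolding F_ode[OF j] zr cpoly_of_real ..
  have inb: "inner (?a r) (?b r) = s * inner (?a r) (deriv (F (2 * j)) (?z r))" for r
    by (simp add: s(2) inner_mult_right scaleR_conv_of_real[symmetric])
  have wd: "(?w has_real_derivative ?w r * (- (?c r * s))) (at r)" for r
    by (auto intro!: derivative_eq_intros)
  have dg: "(g has_real_derivative ((norm (?b r))\<^sup>2 + (norm (?a r))\<^sup>2 / lam) * ?w r) (at r)" for r
  proof -
    have "((\<lambda>r. inner (?a r) (?b r)) has_real_derivative
        inner (?a r) (deriv (deriv (F (2 * j))) (?z r)) + inner (?b r) (?b r)) (at r)"
      unfolding has_real_derivative_iff_has_vector_derivative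
      by (rule bounded_bilinear.has_vector_derivative[OF bounded_bilinear_inner ad bd])
    from DERIV_mult[OF this wd]
    have 1: "(g has_real_derivative (inner (?a r) (deriv (deriv (F (2 * j))) (?z r)) + inner (?b r) (?b r)) * ?w r
        + ?w r * (- (?c r * s)) * inner (?a r) (?b r)) (at r)" unfolding g_def .
    have 2: "inner (?a r) (deriv (deriv (F (2 * j))) (?z r)) = ?c r * inner (?a r) (deriv (F (2 * j)) (?z r)) + (norm (?a r))\<^sup>2 / lam"
    proof -
      have "?a r / of_real lam = (1 / lam) *\<^sub>R ?a r" by (simp add: scaleR_conv_of_real)
      moreover have "of_real (?c r) * deriv (F (2 * j)) (?z r) = ?c r *\<^sub>R deriv (F (2 * j)) (?z r)"
        by (simp add: scaleR_conv_of_real)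
      ultimately show ?thesis unfolding ode by (simp add: inner_add_right power2_norm_eq_inner)
    qed
    have "?c r * s * inner (?a r) (?b r) = ?c r * inner (?a r) (deriv (F (2 * j)) (?z r))"
      unfolding inb using s(1) by (simp add: mult.assoc[symmetric])
    then have 3: "?w r * (- (?c r * s)) * inner (?a r) (?b r) = - (?w r * (?c r * inner (?a r) (deriv (F (2 * j)) (?z r))))"
      by (simp add: mult.assoc)
    have 4: "(C + N + M) * W + - (W * C) = (M + N) * W" for C N M W :: real
      by (simp add: algebra_simps)
    show ?thesis using 1 unfolding 2 3 4 power2_norm_eq_inner[of "?b r", symmetric] .
  qed
  have mono: "g x \<le> g y" if "x \<le> y" for x y
    by (rule DERIV_nonneg_imp_nondecreasing[OF that]) (use dg lam in \<open>force intro!: mult_nonneg_nonneg add_nonneg_nonneg\<close>)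
  obtain r0 where r0: "\<And>r. r \<ge> r0 \<Longrightarrow> norm (F (2 * j) (?z r) - 1) \<le> 1 / 2"
    "\<And>r. r \<ge> r0 \<Longrightarrow> norm (F (2 * j) (?z r)) \<le> 2"
    "\<And>r. r \<ge> r0 \<Longrightarrow> norm (deriv (F (2 * j)) (?z r)) \<le> 2"
    using F_bounded_on_ray[OF j] by metis
  have lim: "(g \<longlongrightarrow> 0) at_top"
  proof (rule Lim_null_comparison)
    have "((\<lambda>r. poly 1 (?z r) * exp (- poly (cp V) (?z r))) \<longlongrightarrow> 0) at_top"
      by (rule exp_neg_V_decay[OF degV lcV_pos D0])
    from tendsto_norm_zero[OF this]
    have "((\<lambda>r. norm (exp (- poly (cp V) (?z r)))) \<longlongrightarrow> 0) at_top" by simp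
    moreover have "norm (exp (- poly (cp V) (?z r))) = ?w r" for r
      unfolding zr cpoly_of_real by (simp add: norm_exp_eq_Re)
    ultimately have "(?w \<longlongrightarrow> 0) at_top" by simp
    then show "((\<lambda>r. 4 * ?w r) \<longlongrightarrow> 0) at_top" by (rule tendsto_mult_right_zero)
    show "\<forall>\<^sub>F r in at_top. norm (g r) \<le> 4 * ?w r"
      using eventually_ge_at_top[of r0]
    proof eventually_elim
      case (elim r)
      have "\<bar>inner (?a r) (?b r)\<bar> \<le> norm (?a r) * norm (?b r)" by (rule Cauchy_Schwarz_ineq2)
      also have "\<dots> \<le> 2 * 2" using r0 elim by (intro mult_mono) (auto simp: norm_mult)
      finally show ?case by (simp add: g_def abs_mult)
    qed
  qed
  have "g 0 < 0"
  proof (rule ccontr)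
    assume "\<not> g 0 < 0"
    then have ge: "g r \<ge> 0" if "r \<ge> 0" for r using mono[OF that] by simp
    have le: "g r \<le> 0" for r
      by (rule tendsto_lowerbound[OF lim]) (use mono in \<open>auto intro: eventually_mono[OF eventually_ge_at_top[of r]]\<close>)
    let ?r = "max r0 0"
    have "?a ?r \<noteq> 0" using r0(1)[of ?r] by auto
    then have "((norm (?b ?r))\<^sup>2 + (norm (?a ?r))\<^sup>2 / lam) * ?w ?r > 0"
      using lam by (intro mult_pos_pos add_nonneg_pos divide_pos_pos) auto
    from DERIV_pos_inc_right[OF dg this] obtain d where "d > 0" "\<And>h. 0 < h \<Longrightarrow> h < d \<Longrightarrow> g ?r < g (?r + h)" by blast
    then have "g ?r < g (?r + d / 2)" by simp
    then show False using le[of "?r + d / 2"] ge[of ?r] by simp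
  qed
  then have "inner (?a 0) (?b 0) < 0" by (simp add: g_def mult_less_0_iff)
  then show ?thesis unfolding inb by simp
qed

lemma half_D: "D div 2 < D" "2 * (D div 2) = D" "D div 2 \<noteq> 0"
  using D4 evenD by auto

abbreviation F_wronskian where
  "F_wronskian k l \<equiv> F k 0 * deriv (F l) 0 - deriv (F k) 0 * F l 0"

text \<open>If it vanished, \<open>F' / F\<close> would have the same value at the origin for both solutions, whereas the
  energy estimate on the positive and on the negative half-axis gives its real part opposite signs.\<close>

lemma F_wronskian_nonzero: "F_wronskian 0 D \<noteq> 0"
proof
  assume W: "F_wronskian 0 D = 0"
  let ?A = "F 0 0" and ?A' = "deriv (F 0) 0" and ?B = "F D 0" and ?B' = "deriv (F D) 0"
  have A: "inner ?A ?A' < 0" using energy_sign[of 0 1] D0 by simp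
  have B: "inner ?B ?B' > 0" using energy_sign[of "D div 2" "-1"] half_D ray_dir_half[OF evenD D0] by simp
  have "?B \<noteq> 0" using B by auto
  have "cnj ?A * ?A' * (cnj ?B * ?B) = cnj ?A * ?A * (cnj ?B * ?B')"
    using W by (simp add: algebra_simps)
  moreover have "cnj ?A * ?A = of_real ((norm ?A)\<^sup>2)" "cnj ?B * ?B = of_real ((norm ?B)\<^sup>2)"
    by (simp_all add: complex_norm_square mult.commute del: of_real_power)
  ultimately have "Re (cnj ?A * ?A' * of_real ((norm ?B)\<^sup>2)) = Re (of_real ((norm ?A)\<^sup>2) * (cnj ?B * ?B'))" by (simp only:)
  then have "inner ?A ?A' * (norm ?B)\<^sup>2 = (norm ?A)\<^sup>2 * inner ?B ?B'"
    by (simp add: inner_complex_def del: of_real_power)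
  moreover have "inner ?A ?A' * (norm ?B)\<^sup>2 < 0" using A \<open>?B \<noteq> 0\<close> by (intro mult_neg_pos) auto
  moreover have "(norm ?A)\<^sup>2 * inner ?B ?B' \<ge> 0" using B by simp
  ultimately show False by linarith
qed

text \<open>The constant factor in the definition of \<open>sibuya_Y\<close>.\<close>

definition coef :: "nat \<Rightarrow> complex" where "coef k = \<i> ^ k * exp (- \<i> * of_real pi / 4)"

lemma coef_nz: "coef k \<noteq> 0" by (simp add: coef_def)

lemma sibuya_Y_even: "even k \<Longrightarrow> sibuya_Y V lam F k z = coef k * exp (- (1/2) * poly (cp V) z) * F k z"
  by (simp add: sibuya_Y_def coef_def)

lemma Y_wronskian:
  assumes "even k" "even l" "k < 2 * D" "l < 2 * D"
  shows "wronskian (sibuya_Y V lam F k) (sibuya_Y V lam F l) 0 = coef k * coef l * exp (- poly (cp V) 0) * F_wronskian k l"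
proof -
  let ?E = "exp (- (1/2) * poly (cp V) 0)" and ?d = "- (1/2) * poly (pderiv (cp V)) 0"
  have d: "(sibuya_Y V lam F m has_field_derivative coef m * ?E * (deriv (F m) 0 + ?d * F m 0)) (at 0)"
    if "even m" "m < 2 * D" for m
    unfolding sibuya_Y_even[OF that(1), abs_def]
    by (rule derivative_eq_intros F_deriv that(2) refl poly_DERIV | simp add: algebra_simps)+
  have EE: "?E * ?E = exp (- poly (cp V) 0)" by (simp add: exp_add[symmetric])
  show ?thesis
    unfolding wronskian_def DERIV_imp_deriv[OF d[OF assms(1,3)]] DERIV_imp_deriv[OF d[OF assms(2,4)]]
      sibuya_Y_even[OF assms(1)] sibuya_Y_even[OF assms(2)] EE[symmetric]
    by (simp add: algebra_simps)
qed

text \<open>The coefficients \<open>\<beta>\<close> and \<open>\<kappa>\<close> express the initial data at \<open>0\<close> of one solution by those of two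
  others; this is Cramer's rule.\<close>

lemma connection_at_0:
  assumes j: "j < D"
  shows "coef (2 * j) * F (2 * j) 0 = connection_beta D V lam F j * coef 0 * F 0 0 + connection_kappa D V lam F j * coef D * F D 0"
    "coef (2 * j) * deriv (F (2 * j)) 0 = connection_beta D V lam F j * coef 0 * deriv (F 0) 0
       + connection_kappa D V lam F j * coef D * deriv (F D) 0"
proof -
  have W: "F_wronskian 0 D \<noteq> 0" by (rule F_wronskian_nonzero)
  have \<beta>: "connection_beta D V lam F j * coef 0 = - (coef (2 * j) * F_wronskian D (2 * j) / F_wronskian 0 D)"
    unfolding connection_beta_def using j D0 evenD W coef_nz[of 0] coef_nz[of D]
    by (simp add: Y_wronskian)
  have \<kappa>: "connection_kappa D V lam F j * coef D = coef (2 * j) * F_wronskian 0 (2 * j) / F_wronskian 0 D"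
    unfolding connection_kappa_def using j D0 evenD W coef_nz[of 0] coef_nz[of D]
    by (simp add: Y_wronskian)
  show "coef (2 * j) * F (2 * j) 0 = connection_beta D V lam F j * coef 0 * F 0 0 + connection_kappa D V lam F j * coef D * F D 0"
    unfolding \<beta> \<kappa> using W by (simp add: divide_simps) (simp add: algebra_simps)
  show "coef (2 * j) * deriv (F (2 * j)) 0 = connection_beta D V lam F j * coef 0 * deriv (F 0) 0
       + connection_kappa D V lam F j * coef D * deriv (F D) 0"
    unfolding \<beta> \<kappa> using W by (simp add: divide_simps) (simp add: algebra_simps)
qed

text \<open>Jump densities across the rays, counterclockwise minus clockwise side; the minus signs at
  \<open>D div 2\<close> account for the opposite orientation of that ray.\<close>

definition exp_jump :: "nat \<Rightarrow> complex \<Rightarrow> complex" where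
  "exp_jump k z = (if k = 0 then 1 else if k = D div 2 then - 1 else 0) * exp (- poly (cp V) z)"

definition weight_coef :: "nat \<Rightarrow> nat \<Rightarrow> complex" where
  "weight_coef j k = (if k = j then coef (2 * j) else if k = 0 then - (connection_beta D V lam F j * coef 0)
     else if k = D div 2 then - (connection_kappa D V lam F j * coef D) else 0)"

definition weight_jump :: "nat \<Rightarrow> nat \<Rightarrow> complex \<Rightarrow> complex" where
  "weight_jump j k z = weight_coef j k * (F (2 * k) z * exp (- poly (cp V) z))"

lemma ray_continuous_exp_jump: "ray_continuous D exp_jump"
  unfolding ray_continuous_def exp_jump_def by (auto intro!: continuous_intros)

lemma ray_continuous_weight_jump: "ray_continuous D (weight_jump j)"
  unfolding ray_continuous_def weight_jump_def
  by (auto intro!: continuous_on_mult continuous_on_const continuous_on_exp continuous_on_minus continuous_on_poly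
      continuous_on_id holomorphic_on_imp_continuous_on[OF F_holo])

text \<open>Each of the three rays in the weight contributes a boundary term at the origin.  The coefficients
  \<open>\<beta>\<close> and \<open>\<kappa>\<close> are chosen so that these cancel.\<close>

lemma weight_moment_sobolev_op:
  assumes j: "j < D" "j \<noteq> 0" "j \<noteq> D div 2"
  shows "has_moment D (weight_jump j) (sobolev_op V lam q) 0"
proof -
  let ?I = "\<lambda>k R. integral {0..R} (\<lambda>r. e k * (poly (sobolev_op V lam q) (of_real r * e k) *
      (F (2 * k) (of_real r * e k) * exp (- poly (cp V) (of_real r * e k)))))"
  have eq: "ray_moment D (weight_jump j) (sobolev_op V lam q) R = (\<Sum>k<D. weight_coef j k * ?I k R)" for R
    unfolding ray_moment_def weight_jump_def
    by (intro sum.cong refl) (simp add: mult_ac)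
  have "((\<lambda>R. \<Sum>k<D. weight_coef j k * ?I k R) \<longlongrightarrow> (\<Sum>k<D. weight_coef j k * (of_real lam * boundary_form k q 0))) at_top"
    by (intro tendsto_sum tendsto_mult_left sibuya_ray_moment) auto
  moreover have "(\<Sum>k<D. weight_coef j k * (of_real lam * boundary_form k q 0)) = 0"
  proof -
    let ?t = "\<lambda>k. weight_coef j k * (of_real lam * boundary_form k q 0)"
    have wc: "weight_coef j j = coef (2 * j)" "weight_coef j 0 = - (connection_beta D V lam F j * coef 0)"
      "weight_coef j (D div 2) = - (connection_kappa D V lam F j * coef D)"
      unfolding weight_coef_def using j(2,3) j(2,3)[symmetric] half_D(3) by auto
    have "sum ?t {..<D} = sum ?t {j, 0, D div 2}"
      by (rule sum.mono_neutral_right) (use j half_D D0 in \<open>auto simp: weight_coef_def\<close>)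
    also have "\<dots> = ?t j + ?t 0 + ?t (D div 2)" using j half_D by simp
    also have "\<dots> = of_real lam * exp (- poly (cp V) 0) *
        (poly (pderiv q) 0 * (coef (2 * j) * F (2 * j) 0 - connection_beta D V lam F j * coef 0 * F 0 0 - connection_kappa D V lam F j * coef D * F D 0)
         - poly q 0 * (coef (2 * j) * deriv (F (2 * j)) 0 - connection_beta D V lam F j * coef 0 * deriv (F 0) 0 - connection_kappa D V lam F j * coef D * deriv (F D) 0))"
      unfolding wc boundary_form_def half_D(2) mult_0_right by (simp add: algebra_simps)
    also have "\<dots> = 0" unfolding connection_at_0[OF j(1)] by simp
    finally show ?thesis .
  qed
  ultimately show ?thesis unfolding has_moment_def unfolding eq[abs_def] by (simp only:)
qed

lemma exp_moment_sobolev_op: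
  "has_moment D exp_jump (cp P * sobolev_op V lam (cp Q)) (of_real (sobolev_inner V lam P Q))"
proof -
  define f where "f x = poly P x * (poly Q x - lam * poly (pderiv (pderiv Q)) x
      + lam * poly (pderiv V) x * poly (pderiv Q) x) * exp (- poly V x)" for x
  have cf: "continuous_on S f" for S unfolding f_def by (intro continuous_intros)
  have f: "poly (cp P * sobolev_op V lam (cp Q)) (of_real x) * exp (- poly (cp V) (of_real x)) = of_real (f x)" for x
    unfolding f_def sobolev_op_def cpoly_pderiv[symmetric] by (simp add: exp_of_real[symmetric])
  have oi: "integral {a..b} (\<lambda>r. complex_of_real (g r)) = of_real (integral {a..b} g)" if "continuous_on {a..b} g" for a b :: real and g
    using integral_linear[OF integrable_continuous_real[OF that] bounded_linear_of_real] by (simp add: o_def)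
  have "ray_moment D exp_jump (cp P * sobolev_op V lam (cp Q)) R = of_real (integral {-R..R} f)" if R: "R \<ge> 0" for R
  proof -
    let ?t = "\<lambda>k. e k * integral {0..R} (\<lambda>r. poly (cp P * sobolev_op V lam (cp Q)) (of_real r * e k) * exp_jump k (of_real r * e k))"
    have "sum ?t {..<D} = sum ?t {0, D div 2}"
      by (rule sum.mono_neutral_right) (use half_D D0 in \<open>auto simp: exp_jump_def\<close>)
    also have "\<dots> = ?t 0 + ?t (D div 2)" using half_D by simp
    also have "?t 0 = of_real (integral {0..R} f)"
      using f by (simp add: exp_jump_def oi[OF cf] del: poly_mult)
    also have "?t (D div 2) = of_real (integral {0..R} (\<lambda>r. f (- r)))"
    proof -
      have "?t (D div 2) = integral {0..R} (\<lambda>r. of_real (f (- r)))"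
        using half_D by (simp add: exp_jump_def ray_dir_half[OF evenD D0] f[symmetric] del: poly_mult)
      also have "\<dots> = of_real (integral {0..R} (\<lambda>r. f (- r)))"
        by (rule oi) (auto intro!: continuous_on_compose2[OF cf] continuous_intros)
      finally show ?thesis .
    qed
    also have "integral {0..R} (\<lambda>r. f (- r)) = integral {-R..0} f"
      using Henstock_Kurzweil_Integration.integral_reflect_real[of 0 "-R" f] by simp
    also have "of_real (integral {0..R} f) + complex_of_real (integral {-R..0} f) = of_real (integral {-R..R} f)"
      using Henstock_Kurzweil_Integration.integral_combine[of "-R" 0 R f] R integrable_continuous_real[OF cf]
      by (simp flip: of_real_add add: add.commute)
    finally show ?thesis unfolding ray_moment_def .
  qed
  then have "\<forall>\<^sub>F R in at_top. complex_of_real (integral {-R..R} f) = ray_moment D exp_jump (cp P * sobolev_op V lam (cp Q)) R"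
    by (intro eventually_mono[OF eventually_ge_at_top[of 0]]) (simp only:)
  moreover have "((\<lambda>R. complex_of_real (integral {-R..R} f)) \<longlongrightarrow> of_real (sobolev_inner V lam P Q)) at_top"
    unfolding f_def by (intro tendsto_of_real sobolev_inner_limit[OF degV lcV_pos D0 evenD])
  ultimately show ?thesis unfolding has_moment_def by (rule Lim_transform_eventually[rotated])
qed

end

section \<open>Polynomials in the entries of a matrix function\<close>

text \<open>Determinants and cofactors are polynomials in the entries.  Everything needed about them
  (analyticity, boundary values, boundedness, growth) holds for all such expressions by the same
  induction.\<close>

inductive entry_poly :: "nat \<Rightarrow> (complex mat \<Rightarrow> complex) \<Rightarrow> bool" for n where
  const: "entry_poly n (\<lambda>_. c)"
| entry: "i < n \<Longrightarrow> j < n \<Longrightarrow> entry_poly n (\<lambda>M. M $$ (i, j))"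
| add: "entry_poly n f \<Longrightarrow> entry_poly n g \<Longrightarrow> entry_poly n (\<lambda>M. f M + g M)"
| mult: "entry_poly n f \<Longrightarrow> entry_poly n g \<Longrightarrow> entry_poly n (\<lambda>M. f M * g M)"

lemma entry_poly_sum: "finite I \<Longrightarrow> (\<And>i. i \<in> I \<Longrightarrow> entry_poly n (f i)) \<Longrightarrow> entry_poly n (\<lambda>M. \<Sum>i\<in>I. f i M)"
  by (induction I rule: finite_induct) (auto intro: entry_poly.intros)

lemma entry_poly_prod: "finite I \<Longrightarrow> (\<And>i. i \<in> I \<Longrightarrow> entry_poly n (f i)) \<Longrightarrow> entry_poly n (\<lambda>M. \<Prod>i\<in>I. f i M)"
  by (induction I rule: finite_induct) (auto intro: entry_poly.intros)

definition det_expr :: "nat \<Rightarrow> complex mat \<Rightarrow> complex" where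
  "det_expr n M = (\<Sum>p \<in> {p. p permutes {0..<n}}. signof p * (\<Prod>i = 0..<n. M $$ (i, p i)))"

lemma det_eq_det_expr: "M \<in> carrier_mat n n \<Longrightarrow> Determinant.det M = det_expr n M"
  by (simp add: det_def' det_expr_def)

lemma entry_poly_det: "entry_poly n (det_expr n)"
  unfolding det_expr_def[abs_def]
  by (intro entry_poly_sum entry_poly.mult entry_poly.const entry_poly_prod entry_poly.entry)
     (auto simp: finite_permutations permutes_in_image)

definition cofactor_expr :: "nat \<Rightarrow> nat \<Rightarrow> nat \<Rightarrow> complex mat \<Rightarrow> complex" where
  "cofactor_expr n i j M = (-1) ^ (i + j) * (\<Sum>p \<in> {p. p permutes {0..<n - 1}}. signof p *
     (\<Prod>k = 0..<n - 1. M $$ (if k < i then k else Suc k, if p k < j then p k else Suc (p k))))"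

lemma cofactor_eq_cofactor_expr:
  assumes "M \<in> carrier_mat n n" "i < n" "j < n"
  shows "cofactor M i j = cofactor_expr n i j M"
proof -
  have "mat_delete M i j \<in> carrier_mat (n - 1) (n - 1)"
    using assms by (intro mat_delete_carrier)
  then have "Determinant.det (mat_delete M i j) = (\<Sum>p \<in> {p. p permutes {0..<n - 1}}. signof p * (\<Prod>k = 0..<n - 1. mat_delete M i j $$ (k, p k)))"
    by (rule det_def')
  also have "\<dots> = (\<Sum>p \<in> {p. p permutes {0..<n - 1}}. signof p *
     (\<Prod>k = 0..<n - 1. M $$ (if k < i then k else Suc k, if p k < j then p k else Suc (p k))))"
    using assms permutes_in_image
    by (intro sum.cong refl arg_cong2[where f = "(*)"] prod.cong) (fastforce simp: mat_delete_def)
  finally show ?thesis by (simp add: cofactor_def cofactor_expr_def)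
qed

lemma permutes_less_pred:
  assumes "p permutes {0..<n - Suc 0}" "k < n - Suc 0"
  shows "Suc (p k) < n" "p k < n"
proof -
  have "p k \<in> {0..<n - Suc 0}" using permutes_in_image[OF assms(1), of k] assms(2) by simp
  then show "Suc (p k) < n" "p k < n" by auto
qed

lemma entry_poly_cofactor: "i < n \<Longrightarrow> j < n \<Longrightarrow> entry_poly n (cofactor_expr n i j)"
  unfolding cofactor_expr_def[abs_def]
  by (intro entry_poly_sum entry_poly.mult entry_poly.const entry_poly_prod entry_poly.entry)
     (auto simp: finite_permutations permutes_less_pred)

lemma entry_poly_tendsto:
  assumes "entry_poly n \<Phi>" "\<And>i j. i < n \<Longrightarrow> j < n \<Longrightarrow> ((\<lambda>z. M z $$ (i, j)) \<longlongrightarrow> L $$ (i, j)) G"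
  shows "((\<lambda>z. \<Phi> (M z)) \<longlongrightarrow> \<Phi> L) G"
  using assms(1) by induction (auto intro!: tendsto_intros assms(2))

lemma entry_poly_continuous:
  assumes "entry_poly n \<Phi>" "\<And>i j. i < n \<Longrightarrow> j < n \<Longrightarrow> continuous_on S (\<lambda>z. M z $$ (i, j))"
  shows "continuous_on S (\<lambda>z. \<Phi> (M z))"
  using assms(1) by induction (auto intro!: continuous_intros assms(2))

lemma entry_poly_holomorphic:
  assumes "entry_poly n \<Phi>" "\<And>i j. i < n \<Longrightarrow> j < n \<Longrightarrow> (\<lambda>z. M z $$ (i, j)) holomorphic_on S"
  shows "(\<lambda>z. \<Phi> (M z)) holomorphic_on S"
  using assms(1) by induction (auto intro!: holomorphic_intros assms(2))

lemma bounded_near_0I: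
  assumes "r > 0" "\<And>z. z \<in> ball 0 r - rays D \<Longrightarrow> norm (f z) \<le> M"
  shows "bounded_near_0 D f"
  unfolding bounded_near_0_def bounded_iff using assms by blast

lemma bounded_near_0_const: "bounded_near_0 D (\<lambda>_. c)"
  by (rule bounded_near_0I[of 1]) auto

lemma bounded_near_0_add:
  assumes "bounded_near_0 D f" "bounded_near_0 D g"
  shows "bounded_near_0 D (\<lambda>z. f z + g z)"
proof -
  obtain r M where 1: "r > 0" "M > 0" "\<And>z. z \<in> ball 0 r - rays D \<Longrightarrow> norm (f z) \<le> M"
    using bounded_near_0_lim[OF assms(1)] by blast
  obtain s L where 2: "s > 0" "L > 0" "\<And>z. z \<in> ball 0 s - rays D \<Longrightarrow> norm (g z) \<le> L"
    using bounded_near_0_lim[OF assms(2)] by blast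
  show ?thesis
  proof (rule bounded_near_0I[of "min r s" _ _ "M + L"])
    fix z assume "z \<in> ball 0 (min r s) - rays D"
    then show "norm (f z + g z) \<le> M + L"
      using 1(3)[of z] 2(3)[of z] by (intro norm_triangle_le add_mono) auto
  qed (use 1 2 in simp)
qed

lemma bounded_near_0_mult:
  assumes "bounded_near_0 D f" "bounded_near_0 D g"
  shows "bounded_near_0 D (\<lambda>z. f z * g z)"
proof -
  obtain r M where 1: "r > 0" "M > 0" "\<And>z. z \<in> ball 0 r - rays D \<Longrightarrow> norm (f z) \<le> M"
    using bounded_near_0_lim[OF assms(1)] by blast
  obtain s L where 2: "s > 0" "L > 0" "\<And>z. z \<in> ball 0 s - rays D \<Longrightarrow> norm (g z) \<le> L"
    using bounded_near_0_lim[OF assms(2)] by blast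
  show ?thesis
  proof (rule bounded_near_0I[of "min r s" _ _ "M * L"])
    fix z assume "z \<in> ball 0 (min r s) - rays D"
    then show "norm (f z * g z) \<le> M * L"
      using 1(3)[of z] 2(3)[of z] 1(2) unfolding norm_mult by (intro mult_mono) auto
  qed (use 1 2 in simp)
qed

lemma bounded_near_0_sum:
  "finite I \<Longrightarrow> (\<And>i. i \<in> I \<Longrightarrow> bounded_near_0 D (f i)) \<Longrightarrow> bounded_near_0 D (\<lambda>z. \<Sum>i\<in>I. f i z)"
  by (induction I rule: finite_induct) (auto intro: bounded_near_0_const bounded_near_0_add)

lemma bounded_near_0_continuous:
  assumes "isCont f 0" shows "bounded_near_0 D f"
proof -
  have "\<forall>\<^sub>F z in at 0. dist (f z) (f 0) < 1"
    using tendstoD[OF assms[unfolded isCont_def], of 1] by simp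
  then obtain r where r: "r > 0" "\<And>z. z \<noteq> 0 \<Longrightarrow> norm z < r \<Longrightarrow> norm (f z - f 0) < 1"
    unfolding eventually_at by (auto simp: dist_norm)
  show ?thesis
  proof (rule bounded_near_0I[OF r(1)])
    fix z assume "z \<in> ball 0 r - rays D"
    then show "norm (f z) \<le> norm (f 0) + 1"
      using r(2)[of z] norm_triangle_ineq[of "f z - f 0" "f 0"] by (cases "z = 0") auto
  qed
qed

lemma entry_poly_bounded:
  assumes "entry_poly n \<Phi>" "\<And>i j. i < n \<Longrightarrow> j < n \<Longrightarrow> bounded_near_0 D (\<lambda>z. M z $$ (i, j))"
  shows "bounded_near_0 D (\<lambda>z. \<Phi> (M z))"
  using assms(1) by induction (auto intro!: bounded_near_0_const bounded_near_0_add bounded_near_0_mult assms(2))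

abbreviation (input) infty_off_rays :: "nat \<Rightarrow> complex filter" where
  "infty_off_rays D \<equiv> inf at_infinity (principal (- rays D))"

lemma infty_off_rays_le: "infty_off_rays D \<le> at_infinity"
  by simp

lemma eventually_norm_ge: "\<forall>\<^sub>F z in infty_off_rays D. norm z \<ge> b"
  unfolding eventually_inf_principal eventually_at_infinity by blast

lemma power_bigo_mono:
  assumes "m \<le> n" shows "(\<lambda>z::complex. z ^ m) \<in> O[infty_off_rays D](\<lambda>z. z ^ n)"
proof (rule bigoI[where c = 1])
  show "\<forall>\<^sub>F z in infty_off_rays D. norm (z ^ m) \<le> 1 * norm (z ^ n)"
    using eventually_norm_ge[of 1]
    by eventually_elim (use assms in \<open>simp add: norm_power power_increasing\<close>)
qed

lemma entry_poly_growth: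
  assumes "entry_poly n \<Phi>" "\<And>i j. i < n \<Longrightarrow> j < n \<Longrightarrow> (\<lambda>z. M z $$ (i, j)) \<in> O[infty_off_rays D](\<lambda>z. z ^ l)"
  shows "\<exists>m. (\<lambda>z. \<Phi> (M z)) \<in> O[infty_off_rays D](\<lambda>z. z ^ m)"
  using assms(1)
proof induction
  case (const c)
  show ?case
    by (rule exI[of _ 0], rule bigoI[where c = "norm c"]) simp
next
  case (entry i j) then show ?case using assms(2) by blast
next
  case (add f g)
  then obtain m1 m2 where "(\<lambda>z. f (M z)) \<in> O[infty_off_rays D](\<lambda>z. z ^ m1)" "(\<lambda>z. g (M z)) \<in> O[infty_off_rays D](\<lambda>z. z ^ m2)" by blast
  note fg = landau_o.big_trans[OF this(1) power_bigo_mono[of m1 "max m1 m2"]]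
    landau_o.big_trans[OF this(2) power_bigo_mono[of m2 "max m1 m2"]]
  from fg show ?case by (intro exI sum_in_bigo) auto
next
  case (mult f g)
  then obtain m1 m2 where "(\<lambda>z. f (M z)) \<in> O[infty_off_rays D](\<lambda>z. z ^ m1)" "(\<lambda>z. g (M z)) \<in> O[infty_off_rays D](\<lambda>z. z ^ m2)" by blast
  from landau_o.big_mult[OF this] show ?case by (intro exI[of _ "m1 + m2"]) (simp add: power_add)
qed

lemma no_jumpI:
  assumes "\<And>k. k < D \<Longrightarrow> continuous_on (ray D k - {0}) g"
    "\<And>k x. k < D \<Longrightarrow> x \<in> ray D k - {0} \<Longrightarrow> (f \<longlongrightarrow> g x) (at x within ccw_sector D k)"
    "\<And>k x. k < D \<Longrightarrow> x \<in> ray D k - {0} \<Longrightarrow> (f \<longlongrightarrow> g x) (at x within cw_sector D k)"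
  shows "no_jump D f g"
  using assms by (auto simp: no_jump_def side_limits_def)

section \<open>Consequences of the Riemann-Hilbert problem\<close>

text \<open>\<open>Ap\<close> and \<open>Am\<close> are the boundary values from the left and from the right, \<open>R\<close> is the error term at
  infinity.\<close>

locale rh_data = sibuya_data D lam \<gamma> \<rho> V \<phi> \<psi> F
  for D :: nat and lam \<gamma> \<rho> :: real and V :: "real poly"
    and \<phi> \<psi> :: "complex \<Rightarrow> complex" and F :: "nat \<Rightarrow> complex \<Rightarrow> complex" +
  fixes N :: nat and A Ap Am R :: "complex \<Rightarrow> complex mat"
  assumes N1: "N \<ge> 1"
    and carr: "\<And>z. z \<in> - rays D \<Longrightarrow> A z \<in> carrier_mat D D"
    and hol: "\<And>i j. i < D \<Longrightarrow> j < D \<Longrightarrow> (\<lambda>z. A z $$ (i, j)) holomorphic_on (- rays D)"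
    and bcarr: "\<And>x. x \<in> rays D - {0} \<Longrightarrow> Ap x \<in> carrier_mat D D" "\<And>x. x \<in> rays D - {0} \<Longrightarrow> Am x \<in> carrier_mat D D"
    and jump: "\<And>x. x \<in> rays D - {0} \<Longrightarrow> Ap x = Am x * jump_matrix D V lam F x"
    and bcont: "\<And>i j. i < D \<Longrightarrow> j < D \<Longrightarrow> continuous_on (rays D - {0}) (\<lambda>x. Ap x $$ (i, j))"
      "\<And>i j. i < D \<Longrightarrow> j < D \<Longrightarrow> continuous_on (rays D - {0}) (\<lambda>x. Am x $$ (i, j))"
    and lims: "\<And>k x i j. k < D \<Longrightarrow> x \<in> ray D k - {0} \<Longrightarrow> i < D \<Longrightarrow> j < D \<Longrightarrow>
        ((\<lambda>z. A z $$ (i, j)) \<longlongrightarrow> Ap x $$ (i, j)) (at x within left_side D k)"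
      "\<And>k x i j. k < D \<Longrightarrow> x \<in> ray D k - {0} \<Longrightarrow> i < D \<Longrightarrow> j < D \<Longrightarrow>
        ((\<lambda>z. A z $$ (i, j)) \<longlongrightarrow> Am x $$ (i, j)) (at x within right_side D k)"
    and bdd: "\<And>i j. i < D \<Longrightarrow> j < D \<Longrightarrow> bounded_near_0 D (\<lambda>z. A z $$ (i, j))"
    and Rcarr: "\<And>z. z \<in> - rays D \<Longrightarrow> R z \<in> carrier_mat D D"
    and AR: "\<And>z. z \<in> - rays D \<Longrightarrow> A z = (1\<^sub>m D + R z) * growth_matrix D N z"
    and RO: "\<And>i j. i < D \<Longrightarrow> j < D \<Longrightarrow> (\<lambda>z. R z $$ (i, j)) \<in> O[infty_off_rays D](\<lambda>z. 1 / z)"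
begin

lemma ray_subset: "k < D \<Longrightarrow> ray D k - {0} \<subseteq> rays D - {0}"
  by (auto simp: rays_def)

lemma jump_carrier: "jump_matrix D V lam F x \<in> carrier_mat D D"
  by (simp add: jump_matrix_def)

lemma det_jump: "Determinant.det (jump_matrix D V lam F x) = 1"
proof -
  have "upper_triangular (jump_matrix D V lam F x)"
    by (auto simp: jump_matrix_def)
  then have "Determinant.det (jump_matrix D V lam F x) = prod_list (diag_mat (jump_matrix D V lam F x))"
    by (rule det_upper_triangular[OF _ jump_carrier])
  also have "diag_mat (jump_matrix D V lam F x) = map (\<lambda>_. 1) [0..<D]"
    by (auto simp: diag_mat_def jump_matrix_def)
  finally show ?thesis by (simp add: map_replicate_const)
qed

lemma growth_carrier: "growth_matrix D N z \<in> carrier_mat D D"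
  by (simp add: growth_matrix_def)

lemma det_growth:
  assumes "z \<noteq> 0" shows "Determinant.det (growth_matrix D N z) = 1"
proof -
  let ?g = "\<lambda>j. if j = 0 then z ^ (N + D - 2) else if j = 1 then z powi (- int N) else z powi (- 1)"
  have "upper_triangular (growth_matrix D N z)" by (auto simp: growth_matrix_def mat_diag_def)
  then have "Determinant.det (growth_matrix D N z) = prod_list (diag_mat (growth_matrix D N z))"
    by (rule det_upper_triangular[OF _ growth_carrier])
  also have "diag_mat (growth_matrix D N z) = map ?g [0..<D]"
    by (auto simp: diag_mat_def growth_matrix_def mat_diag_def)
  also have "prod_list (map ?g [0..<D]) = prod ?g {0..<D}"
    using prod.distinct_set_conv_list[of "[0..<D]" ?g] by simp
  also have "{0..<D} = insert 0 (insert 1 {2..<D})" using D4 by auto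
  also have "prod ?g \<dots> = z ^ (N + D - 2) * (z powi (- int N) * (z powi (- 1)) ^ (D - 2))"
    by simp
  also have "\<dots> = z powi int (N + D - 2) * (z powi (- int N) * z powi (- int (D - 2)))"
    by (simp add: power_int_minus power_inverse)
  also have "\<dots> = z powi (int (N + D - 2) + (- int N + - int (D - 2)))"
    by (simp only: power_int_add assms simp_thms)
  also have "int (N + D - 2) + (- int N + - int (D - 2)) = 0" using D4 by simp
  finally show ?thesis by simp
qed

lemma entry_poly_limits:
  assumes \<Phi>: "entry_poly D \<Phi>" and k: "k < D" "x \<in> ray D k - {0}"
  shows "((\<lambda>z. \<Phi> (A z)) \<longlongrightarrow> \<Phi> (Ap x)) (at x within left_side D k)"
    "((\<lambda>z. \<Phi> (A z)) \<longlongrightarrow> \<Phi> (Am x)) (at x within right_side D k)"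
  by (rule entry_poly_tendsto[OF \<Phi>], rule lims[OF k], assumption+)+

lemma entry_poly_no_jump:
  assumes \<Phi>: "entry_poly D \<Phi>" and eq: "\<And>x. x \<in> rays D - {0} \<Longrightarrow> \<Phi> (Ap x) = \<Phi> (Am x)"
  shows "no_jump D (\<lambda>z. \<Phi> (A z)) (\<lambda>x. \<Phi> (Ap x))"
proof (rule no_jumpI)
  fix k assume k: "k < D"
  show "continuous_on (ray D k - {0}) (\<lambda>x. \<Phi> (Ap x))"
    by (rule entry_poly_continuous[OF \<Phi>], rule continuous_on_subset[OF bcont(1) ray_subset[OF k]])
  fix x assume x: "x \<in> ray D k - {0}"
  then have "x \<in> rays D - {0}" using ray_subset[OF k] by blast
  note l = entry_poly_limits[OF \<Phi> k x, unfolded eq[OF this, symmetric]]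
  show "((\<lambda>z. \<Phi> (A z)) \<longlongrightarrow> \<Phi> (Ap x)) (at x within ccw_sector D k)"
    using l by (cases "k = D div 2") (auto simp: left_side_def right_side_def)
  show "((\<lambda>z. \<Phi> (A z)) \<longlongrightarrow> \<Phi> (Ap x)) (at x within cw_sector D k)"
    using l by (cases "k = D div 2") (auto simp: left_side_def right_side_def)
qed

lemma growth_entry: "i < D \<Longrightarrow> j < D \<Longrightarrow> z \<in> - rays D \<Longrightarrow>
   A z $$ (i, j) = ((if i = j then 1 else 0) + R z $$ (i, j)) *
     (if j = 0 then z ^ (N + D - 2) else if j = 1 then z powi (- int N) else z powi (- 1))"
  unfolding AR growth_matrix_def
  by (subst mat_diag_mult_right[of _ D]) (use Rcarr[of z] in auto)

lemma R_tendsto: "i < D \<Longrightarrow> j < D \<Longrightarrow> ((\<lambda>z. R z $$ (i, j)) \<longlongrightarrow> 0) (infty_off_rays D)"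
proof -
  assume ij: "i < D" "j < D"
  obtain c where c: "c > 0" "\<forall>\<^sub>F z in infty_off_rays D. norm (R z $$ (i, j)) \<le> c * norm (1 / z)"
    using landau_o.bigE[OF RO[OF ij]] by blast
  show ?thesis
  proof (rule Lim_null_comparison[OF c(2)])
    have "((\<lambda>z::complex. 1 / z) \<longlongrightarrow> 0) (infty_off_rays D)"
      using tendsto_mono[OF infty_off_rays_le tendsto_inverse_0[where 'a = complex]]
      unfolding inverse_eq_divide[abs_def] .
    from tendsto_mult_right_zero[OF tendsto_norm_zero[OF this]]
    show "((\<lambda>z::complex. c * norm (1 / z)) \<longlongrightarrow> 0) (infty_off_rays D)" .
  qed
qed

text \<open>The determinant has no jump and tends to \<open>1\<close>.\<close>

lemma det_A: assumes z: "z \<in> - rays D" shows "Determinant.det (A z) = 1"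
proof -
  have eqd: "det_expr D (Ap x) = det_expr D (Am x)" if "x \<in> rays D - {0}" for x
  proof -
    have "Determinant.det (Ap x) = Determinant.det (Am x)"
      unfolding jump[OF that] using det_mult[OF bcarr(2)[OF that] jump_carrier] det_jump by simp
    then show ?thesis using bcarr[OF that] by (simp add: det_eq_det_expr)
  qed
  obtain G where G: "G holomorphic_on UNIV" "\<And>z. z \<in> - rays D \<Longrightarrow> G z = det_expr D (A z)"
    "\<And>x. x \<in> rays D - {0} \<Longrightarrow> G x = det_expr D (Ap x)"
    using no_jump_entire[OF D4 entry_poly_holomorphic[OF entry_poly_det hol]
        entry_poly_no_jump[OF entry_poly_det eqd] entry_poly_bounded[OF entry_poly_det bdd]] by blast
  have "((\<lambda>z. det_expr D (1\<^sub>m D + R z)) \<longlongrightarrow> det_expr D (1\<^sub>m D)) (infty_off_rays D)"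
  proof (rule entry_poly_tendsto[OF entry_poly_det])
    fix i j assume ij: "i < D" "j < D"
    have "((\<lambda>z. 1\<^sub>m D $$ (i, j) + R z $$ (i, j)) \<longlongrightarrow> 1\<^sub>m D $$ (i, j) + 0) (infty_off_rays D)"
      by (intro tendsto_intros R_tendsto ij)
    moreover have "\<forall>\<^sub>F z in infty_off_rays D. 1\<^sub>m D $$ (i, j) + R z $$ (i, j) = (1\<^sub>m D + R z) $$ (i, j)"
    proof -
      have "1\<^sub>m D $$ (i, j) + R z $$ (i, j) = (1\<^sub>m D + R z) $$ (i, j)" if "z \<in> - rays D" for z
        using Rcarr[OF that] ij by auto
      then show ?thesis unfolding eventually_inf_principal by simp
    qed
    ultimately show "((\<lambda>z. (1\<^sub>m D + R z) $$ (i, j)) \<longlongrightarrow> 1\<^sub>m D $$ (i, j)) (infty_off_rays D)"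
      by (simp add: Lim_transform_eventually)
  qed
  moreover have "det_expr D (1\<^sub>m D) = 1" using det_eq_det_expr[of "1\<^sub>m D" D] by simp
  moreover have "\<forall>\<^sub>F z in infty_off_rays D. det_expr D (1\<^sub>m D + R z) = G z"
  proof -
    have "det_expr D (1\<^sub>m D + R z) = G z" if z: "z \<in> - rays D" for z
    proof -
      have "z \<noteq> 0" using z zero_in_rays[OF D0] by blast
      have c: "1\<^sub>m D + R z \<in> carrier_mat D D" using Rcarr[OF z] by simp
      have "Determinant.det (A z) = Determinant.det (1\<^sub>m D + R z)"
        unfolding AR[OF z] using det_mult[OF c growth_carrier] det_growth[OF \<open>z \<noteq> 0\<close>] by simp
      then show ?thesis using G(2)[OF z] carr[OF z] c by (simp add: det_eq_det_expr)
    qed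
    then show ?thesis by (auto simp: eventually_inf_principal)
  qed
  ultimately have G1: "(G \<longlongrightarrow> 1) (infty_off_rays D)" by (simp add: Lim_transform_eventually)
  have "(\<lambda>z. det_expr D (A z)) \<in> O[infty_off_rays D](\<lambda>z. z ^ 0)"
  proof (rule bigoI[where c = 2])
    have "\<forall>\<^sub>F z in infty_off_rays D. norm (G z) < 2"
      using order_tendstoD(2)[OF tendsto_norm[OF G1], of 2] by simp
    moreover have "\<forall>\<^sub>F z in infty_off_rays D. z \<in> - rays D" by (simp add: eventually_inf_principal)
    ultimately show "\<forall>\<^sub>F z in infty_off_rays D. norm (det_expr D (A z)) \<le> 2 * norm (z ^ 0)"
      by eventually_elim (use G(2) in simp)
  qed
  then obtain p where p: "Polynomial.degree p \<le> 0" "\<And>z. z \<in> - rays D \<Longrightarrow> det_expr D (A z) = poly p z"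
    using no_jump_polynomial[OF D4 entry_poly_holomorphic[OF entry_poly_det hol]
        entry_poly_no_jump[OF entry_poly_det eqd] entry_poly_bounded[OF entry_poly_det bdd]] by metis
  obtain a where a: "p = [:a:]" using p(1) by (meson degree_eq_zeroE le_zero_eq)
  have "\<forall>\<^sub>F z in infty_off_rays D. G z = a"
    using G(2) p(2) a by (auto simp: eventually_inf_principal)
  then have "((\<lambda>_. a) \<longlongrightarrow> 1) (infty_off_rays D)" using G1 by (rule Lim_transform_eventually[rotated])
  moreover have "infty_off_rays D \<noteq> bot"
  proof
    assume "infty_off_rays D = bot"
    then have "\<forall>\<^sub>F z in infty_off_rays D. False" by simp
    then obtain b where b: "\<And>z. norm z \<ge> b \<Longrightarrow> z \<in> rays D"
      unfolding eventually_inf_principal eventually_at_infinity by blast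
    define w where "w = rcis (max b 1) (pi / real D)"
    have "w \<in> ccw_sector D 0" unfolding ccw_sector_def w_def
      using D0 by (intro CollectI exI[of _ "max b 1"] exI[of _ "pi / real D"]) (auto simp: divide_strict_right_mono)
    moreover have "norm w \<ge> b" by (simp add: w_def)
    ultimately show False using b[of w] ccw_sector_disjoint_rays[OF D0, of 0] by blast
  qed
  ultimately have "a = 1" using tendsto_const tendsto_unique by blast
  then show ?thesis using p(2)[OF z] a carr[OF z] by (simp add: det_eq_det_expr)
qed

end

section \<open>Polynomial entries of the solution and its inverse\<close>

lemma side_limits_lincomb:
  assumes "finite I" "\<And>i. i \<in> I \<Longrightarrow> side_limits D (f i) (hp i) (hm i)"
  shows "side_limits D (\<lambda>z. \<Sum>i\<in>I. v i * f i z) (\<lambda>k x. \<Sum>i\<in>I. v i * hp i k x) (\<lambda>k x. \<Sum>i\<in>I. v i * hm i k x)"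
  using assms(2) unfolding side_limits_def
  by (auto intro!: continuous_intros tendsto_sum tendsto_mult_left)

lemma side_limits_mult:
  assumes s: "side_limits D f hp hm" and T: "\<And>x. x \<in> rays D - {0} \<Longrightarrow> isCont T x"
  shows "side_limits D (\<lambda>z. f z * T z) (\<lambda>k x. hp k x * T x) (\<lambda>k x. hm k x * T x)"
  unfolding side_limits_def
proof (intro allI impI conjI ballI)
  fix k assume k: "k < D"
  then have sub: "ray D k - {0} \<subseteq> rays D - {0}" by (auto simp: rays_def)
  have c: "continuous_on (ray D k - {0}) T"
    by (intro continuous_at_imp_continuous_on ballI T) (use sub in blast)
  show "continuous_on (ray D k - {0}) (\<lambda>x. hp k x * T x)" "continuous_on (ray D k - {0}) (\<lambda>x. hm k x * T x)"
    using s k c by (auto simp: side_limits_def intro!: continuous_on_mult)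
  fix x assume x: "x \<in> ray D k - {0}"
  have t: "(T \<longlongrightarrow> T x) (at x within S)" for S
    using T[of x] sub x unfolding isCont_def by (blast intro: tendsto_within_subset)
  show "((\<lambda>z. f z * T z) \<longlongrightarrow> hp k x * T x) (at x within ccw_sector D k)"
    "((\<lambda>z. f z * T z) \<longlongrightarrow> hm k x * T x) (at x within cw_sector D k)"
    using s k x by (auto simp: side_limits_def intro!: tendsto_mult t)
qed

lemma side_limits_diff_const:
  assumes "side_limits D f hp hm"
  shows "side_limits D (\<lambda>z. f z - c) (\<lambda>k x. hp k x - c) (\<lambda>k x. hm k x - c)"
  using assms unfolding side_limits_def by (auto intro!: continuous_on_diff continuous_on_const tendsto_diff tendsto_const)

lemma side_limits_cong:
  assumes s: "side_limits D f hp hm" and eq: "\<And>z. z \<in> - rays D \<Longrightarrow> z \<noteq> a \<Longrightarrow> g z = f z" and a: "a \<notin> rays D"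
  shows "side_limits D g hp hm"
proof -
  have "(g \<longlongrightarrow> l) (at x within S)" if f: "(f \<longlongrightarrow> l) (at x within S)" and S: "S \<subseteq> - rays D" and x: "x \<in> rays D" for l x S
  proof (rule Lim_transform_eventually[OF f])
    have "x \<in> - {a}" using x a by auto
    from eventually_within_open[OF open_Compl[OF closed_singleton] this, of S]
    show "\<forall>\<^sub>F z in at x within S. f z = g z"
    proof eventually_elim
      case (elim z) then show ?case using eq[of z] S by auto
    qed
  qed
  moreover have "ccw_sector D k \<subseteq> - rays D" "cw_sector D k \<subseteq> - rays D" if "k < D" for k
    using that ccw_sector_subset[of D k] cw_sector_subset[of D k] by auto
  moreover have "x \<in> rays D" if "k < D" "x \<in> ray D k - {0}" for k x using that by (auto simp: rays_def)
  ultimately show ?thesis using s unfolding side_limits_def by blast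
qed

context rh_data begin

lemma mem_real_ray:
  assumes k: "k < D" "x \<in> ray D k - {0}"
  shows "x \<in> \<real> \<longleftrightarrow> k = 0 \<or> k = D div 2"
proof
  assume "x \<in> \<real>"
  then obtain t where t: "x = of_real t" by (auto elim: Reals_cases)
  have "t \<noteq> 0" using k t by auto
  then have "x \<in> ray D 0 \<or> x \<in> ray D (D div 2)"
    unfolding mem_ray_iff' ray_dir_half[OF evenD D0] ray_dir_0 t
    by (cases "t > 0") (auto intro: exI[of _ t] exI[of _ "- t"])
  then show "k = 0 \<or> k = D div 2"
    using rays_distinct[OF k(1), of 0] rays_distinct[OF k(1), of "D div 2"] k(2) D0 half_D(1) by auto
next
  assume "k = 0 \<or> k = D div 2"
  then show "x \<in> \<real>" using k(2)[unfolded mem_ray_iff] ray_dir_half[OF evenD D0] by auto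
qed

text \<open>The jump of any entry in column \<open>c\<close> is this density times the entry of the first column in the
  same row.\<close>

definition col_jump :: "nat \<Rightarrow> nat \<Rightarrow> complex \<Rightarrow> complex" where
  "col_jump c = (if c = 1 then exp_jump else weight_jump (weight_indices D ! (c - 2)))"

lemma weight_index:
  assumes "2 \<le> c" "c < D"
  defines "j \<equiv> weight_indices D ! (c - 2)"
  shows "j < D" "j \<noteq> 0" "j \<noteq> D div 2"
proof -
  have "c - 2 < length (weight_indices D)"
    using assms(1,2) evenD D4 by (auto simp: weight_indices_def)
  then have "j \<in> set (weight_indices D)" unfolding j_def by (rule nth_mem)
  then show "j < D" "j \<noteq> 0" "j \<noteq> D div 2" by (auto simp: weight_indices_def)
qed

lemma ray_continuous_col_jump: "ray_continuous D (col_jump c)"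
  unfolding col_jump_def using ray_continuous_exp_jump ray_continuous_weight_jump by simp

lemma ray_indicator:
  assumes "k < D" "x \<in> ray D k - {0}" "j < D"
  shows "indicator (ray D j) x = (if k = j then 1 else (0 :: complex))"
  using rays_distinct[OF assms(1,3)] assms(2) by (auto simp: indicator_def)

lemma jump_first_row:
  assumes k: "k < D" "x \<in> ray D k - {0}" and c: "1 \<le> c" "c < D"
  shows "(if k = D div 2 then -1 else 1) * jump_matrix D V lam F x $$ (0, c) = col_jump c k x"
proof (cases "c = 1")
  case True
  then show ?thesis
    using c mem_real_ray[OF k] half_D by (auto simp: jump_matrix_def col_jump_def exp_jump_def)
next
  case False
  then have c2: "2 \<le> c" using c by simp
  define j where "j = weight_indices D ! (c - 2)"
  note j = weight_index[OF c2 c(2), folded j_def]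
  have E: "exp (- (poly (cp V) x / 2)) * exp (- (poly (cp V) x / 2)) = exp (- poly (cp V) x)"
    by (simp add: exp_add[symmetric])
  have ind: "indicator (ray D i) x = (if k = i then 1 else (0 :: complex))" if "i < D" for i
    by (rule ray_indicator[OF k that])
  have Y: "sibuya_Y V lam F m x * exp (- (1/2) * poly (cp V) x) = coef m * (F m x * exp (- poly (cp V) x))" if "even m" for m
    unfolding sibuya_Y_even[OF that] using E by (simp add: mult_ac)
  have "jump_matrix D V lam F x $$ (0, c) = ray_weight D V lam F j x"
    using c c2 False by (simp add: jump_matrix_def j_def)
  also have "\<dots> = (coef (2 * j) * (F (2 * j) x * exp (- poly (cp V) x))) * (if k = j then 1 else 0)
     - connection_beta D V lam F j * (coef 0 * (F 0 x * exp (- poly (cp V) x))) * (if k = 0 then 1 else 0)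
     + connection_kappa D V lam F j * (coef D * (F D x * exp (- poly (cp V) x))) * (if k = D div 2 then 1 else 0)"
  proof -
    have y: "sibuya_Y V lam F (2 * j) x * exp (- (1/2) * poly (cp V) x) = coef (2 * j) * (F (2 * j) x * exp (- poly (cp V) x))"
      "sibuya_Y V lam F 0 x * exp (- (1/2) * poly (cp V) x) = coef 0 * (F 0 x * exp (- poly (cp V) x))"
      "sibuya_Y V lam F D x * exp (- (1/2) * poly (cp V) x) = coef D * (F D x * exp (- poly (cp V) x))"
      by (rule Y; use evenD in simp)+
    show ?thesis
      unfolding ray_weight_def ind[OF j(1)] ind[OF D0] ind[OF half_D(1)]
        mult.assoc[of "connection_beta D V lam F j"] mult.assoc[of "connection_kappa D V lam F j"] y ..
  qed
  finally show ?thesis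
    using False j half_D by (simp add: col_jump_def j_def[symmetric] weight_jump_def weight_coef_def)
qed

text \<open>Boundary values from the counterclockwise (\<open>Hp\<close>) and clockwise (\<open>Hm\<close>) side; left and right are
  exchanged on the ray that is oriented towards the origin.\<close>

definition Hp where "Hp i c k x = (if k = D div 2 then Am x $$ (i, c) else Ap x $$ (i, c))"
definition Hm where "Hm i c k x = (if k = D div 2 then Ap x $$ (i, c) else Am x $$ (i, c))"

lemma A_side_limits:
  assumes "i < D" "c < D"
  shows "side_limits D (\<lambda>z. A z $$ (i, c)) (Hp i c) (Hm i c)"
  unfolding side_limits_def
proof (intro allI impI conjI ballI)
  fix k assume k: "k < D"
  show "continuous_on (ray D k - {0}) (Hp i c k)" "continuous_on (ray D k - {0}) (Hm i c k)"
    unfolding Hp_def[abs_def] Hm_def[abs_def]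
    using continuous_on_subset[OF bcont(1)[OF assms] ray_subset[OF k]] continuous_on_subset[OF bcont(2)[OF assms] ray_subset[OF k]]
    by (cases "k = D div 2"; simp)+
  fix x assume x: "x \<in> ray D k - {0}"
  show "((\<lambda>z. A z $$ (i, c)) \<longlongrightarrow> Hp i c k x) (at x within ccw_sector D k)"
    "((\<lambda>z. A z $$ (i, c)) \<longlongrightarrow> Hm i c k x) (at x within cw_sector D k)"
    using lims[OF k x assms] by (auto simp: left_side_def right_side_def Hp_def Hm_def)
qed

lemma jump_entry:
  assumes x: "x \<in> rays D - {0}" and i: "i < D" and c: "c < D"
  shows "Ap x $$ (i, c) = (if c = 0 then Am x $$ (i, 0) else Am x $$ (i, c) + Am x $$ (i, 0) * jump_matrix D V lam F x $$ (0, c))"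
proof -
  let ?J = "jump_matrix D V lam F x"
  have "Ap x $$ (i, c) = (\<Sum>l<D. Am x $$ (i, l) * ?J $$ (l, c))"
    unfolding jump[OF x] using i c bcarr(2)[OF x] jump_carrier[of x]
    by (auto simp: scalar_prod_def atLeast0LessThan intro!: sum.cong)
  also have "\<dots> = (\<Sum>l\<in>{0, c}. Am x $$ (i, l) * ?J $$ (l, c))"
    by (rule sum.mono_neutral_right) (use c D0 in \<open>auto simp: jump_matrix_def\<close>)
  finally show ?thesis using c D0 by (auto simp: jump_matrix_def)
qed

text \<open>The first column of every jump matrix is a unit vector.\<close>

lemma first_column_no_jump:
  assumes i: "i < D" shows "no_jump D (\<lambda>z. A z $$ (i, 0)) (\<lambda>x. Ap x $$ (i, 0))"
  by (rule entry_poly_no_jump[OF entry_poly.entry[OF i D0]]) (use jump_entry[OF _ i D0] in simp)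

lemma first_column_growth:
  assumes i: "i < D"
  shows "(\<lambda>z. A z $$ (i, 0)) \<in> O[infty_off_rays D](\<lambda>z. z ^ (N + D - (if i = 0 then 2 else 3)))"
proof -
  let ?m = "N + D - 2"
  have R1: "(\<lambda>z. R z $$ (i, 0) * z ^ ?m) \<in> O[infty_off_rays D](\<lambda>z. z ^ (N + D - 3))"
  proof -
    have "(\<lambda>z. R z $$ (i, 0) * z ^ ?m) \<in> O[infty_off_rays D](\<lambda>z. 1 / z * z ^ ?m)"
      by (rule landau_o.big.mult_right[OF RO[OF i D0]])
    moreover have "\<forall>\<^sub>F z in infty_off_rays D. 1 / z * z ^ ?m = z ^ (N + D - 3)"
      using eventually_norm_ge[of 1]
    proof eventually_elim
      case (elim z)
      have "?m = Suc (N + D - 3)" using D4 by simp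
      then show ?case using elim by auto
    qed
    ultimately show ?thesis by (simp add: landau_o.big.cong)
  qed
  have ev: "\<forall>\<^sub>F z in infty_off_rays D. A z $$ (i, 0) = (if i = 0 then z ^ ?m else 0) + R z $$ (i, 0) * z ^ ?m"
    using growth_entry[OF i D0] by (auto simp: eventually_inf_principal distrib_right)
  have "(\<lambda>z. (if i = 0 then z ^ ?m else 0) + R z $$ (i, 0) * z ^ ?m) \<in> O[infty_off_rays D](\<lambda>z. z ^ (N + D - (if i = 0 then 2 else 3)))"
    using R1 power_bigo_mono[of "N + D - 3" "N + D - 2" D] by (auto intro!: sum_in_bigo intro: landau_o.big_trans)
  then show ?thesis using landau_o.big.in_cong[OF ev] by simp
qed

lemma first_column_poly:
  "\<exists>first_col. \<forall>i<D. Polynomial.degree (first_col i) \<le> N + D - (if i = 0 then 2 else 3) \<and>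
     (\<forall>z \<in> - rays D. A z $$ (i, 0) = poly (first_col i) z) \<and> (\<forall>x \<in> rays D - {0}. Ap x $$ (i, 0) = poly (first_col i) x \<and> Am x $$ (i, 0) = poly (first_col i) x)"
proof (rule choice_iff[THEN iffD1], intro allI)
  fix i
  show "\<exists>p. i < D \<longrightarrow> Polynomial.degree p \<le> N + D - (if i = 0 then 2 else 3) \<and>
     (\<forall>z \<in> - rays D. A z $$ (i, 0) = poly p z) \<and> (\<forall>x \<in> rays D - {0}. Ap x $$ (i, 0) = poly p x \<and> Am x $$ (i, 0) = poly p x)"
  proof (cases "i < D")
    case True
    obtain p where "Polynomial.degree p \<le> N + D - (if i = 0 then 2 else 3)" "\<And>z. z \<in> - rays D \<Longrightarrow> A z $$ (i, 0) = poly p z"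
      "\<And>x. x \<in> rays D - {0} \<Longrightarrow> Ap x $$ (i, 0) = poly p x"
      using no_jump_polynomial[OF D4 hol[OF True D0] first_column_no_jump[OF True] bdd[OF True D0] first_column_growth[OF True]] by metis
    then show ?thesis using jump_entry[OF _ True D0] by (intro exI[of _ p]) auto
  qed simp
qed

definition first_col where
  "first_col = (SOME first_col. \<forall>i<D. Polynomial.degree (first_col i) \<le> N + D - (if i = 0 then 2 else 3) \<and>
     (\<forall>z \<in> - rays D. A z $$ (i, 0) = poly (first_col i) z) \<and> (\<forall>x \<in> rays D - {0}. Ap x $$ (i, 0) = poly (first_col i) x \<and> Am x $$ (i, 0) = poly (first_col i) x))"

lemma first_col:
  assumes "i < D"
  shows "Polynomial.degree (first_col i) \<le> N + D - (if i = 0 then 2 else 3)"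
    "z \<in> - rays D \<Longrightarrow> A z $$ (i, 0) = poly (first_col i) z"
    "x \<in> rays D - {0} \<Longrightarrow> Ap x $$ (i, 0) = poly (first_col i) x"
    "x \<in> rays D - {0} \<Longrightarrow> Am x $$ (i, 0) = poly (first_col i) x"
  using someI_ex[OF first_column_poly, folded first_col_def] assms by auto

lemma side_jump:
  assumes k: "k < D" "x \<in> ray D k - {0}" and i: "i < D" and c: "1 \<le> c" "c < D"
  shows "Hp i c k x - Hm i c k x = poly (first_col i) x * col_jump c k x"
proof -
  have x: "x \<in> rays D - {0}" using ray_subset[OF k(1)] k(2) by blast
  show ?thesis
    unfolding jump_first_row[OF k c, symmetric] Hp_def Hm_def jump_entry[OF x i c(2)] first_col(4)[OF i x]
    using c by simp
qed

text \<open>The second row of the inverse: since the second row of every jump matrix is a unit vector,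
  it has no jump either.\<close>

lemma inverse_row_poly:
  assumes i: "i < D"
  shows "\<exists>b. \<forall>z \<in> - rays D. adj_mat (A z) $$ (1, i) = poly b z"
proof -
  let ?\<Phi> = "cofactor_expr D i 1"
  have one: "1 < D" using D4 by simp
  have adj: "adj_mat M $$ (1, i) = ?\<Phi> M" if "M \<in> carrier_mat D D" for M :: "complex mat"
    using that i one cofactor_eq_cofactor_expr[OF that i one] by (auto simp: adj_mat_def)
  note \<Phi> = entry_poly_cofactor[OF i one]
  have eq: "?\<Phi> (Ap x) = ?\<Phi> (Am x)" if x: "x \<in> rays D - {0}" for x
  proof -
    let ?J = "jump_matrix D V lam F x"
    note c = bcarr[OF x] jump_carrier[of x]
    have dm: "Determinant.det (Am x) = Determinant.det (Ap x)"
      unfolding jump[OF x] using det_mult[OF c(2,3)] det_jump by simp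
    have d1: "Determinant.det (Ap x) = 1"
    proof -
      obtain k where k: "k < D" "x \<in> ray D k - {0}" using x by (auto simp: rays_def)
      have l: "((\<lambda>z. det_expr D (A z)) \<longlongrightarrow> det_expr D (Ap x)) (at x within left_side D k)"
        by (rule entry_poly_limits[OF entry_poly_det k])
      have "det_expr D (A z) = 1" if "z \<in> left_side D k" for z
      proof -
        have "z \<in> - rays D" using that ccw_sector_subset[OF D0, of k] cw_sector_subset[OF D0, of k]
          by (auto simp: left_side_def split: if_splits)
        then show ?thesis using det_A carr by (simp add: det_eq_det_expr[symmetric])
      qed
      then have "((\<lambda>z. 1) \<longlongrightarrow> det_expr D (Ap x)) (at x within left_side D k)"
        by (intro tendsto_within_cong[OF l]) simp
      moreover have "at x within left_side D k \<noteq> bot"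
        using islimpt_sectors[OF k(2,1)] by (auto simp: trivial_limit_within left_side_def)
      ultimately have "det_expr D (Ap x) = 1" using tendsto_const tendsto_unique by blast
      then show ?thesis using c by (simp add: det_eq_det_expr)
    qed
    have sm: "(1::complex) \<cdot>\<^sub>m 1\<^sub>m D = 1\<^sub>m D" by (rule eq_matI) auto
    have am: "adj_mat (Am x) * Am x = 1\<^sub>m D" "adj_mat (Am x) \<in> carrier_mat D D" "Ap x * adj_mat (Ap x) = 1\<^sub>m D" "adj_mat (Ap x) \<in> carrier_mat D D"
      using adj_mat[OF c(1)] adj_mat[OF c(2)] d1 dm sm by simp_all
    \<comment> \<open>As all determinants are \<open>1\<close>, adjugates are inverses, and \<open>adj (Am) = J adj (Ap)\<close>.\<close>
    have "adj_mat (Am x) * Ap x = ?J"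
      unfolding jump[OF x] using assoc_mult_mat[OF am(2) c(2,3)] am(1) c(3) by simp
    then have "adj_mat (Am x) = ?J * adj_mat (Ap x)"
      using assoc_mult_mat[OF am(2) c(1) am(4)] am(2,3) by simp
    then have "adj_mat (Am x) $$ (1, i) = (?J * adj_mat (Ap x)) $$ (1, i)" by simp
    also have "\<dots> = (\<Sum>l<D. ?J $$ (1, l) * adj_mat (Ap x) $$ (l, i))"
      using one i c(3) am(4) by (auto simp: scalar_prod_def atLeast0LessThan intro!: sum.cong)
    also have "\<dots> = (\<Sum>l\<in>{1}. ?J $$ (1, l) * adj_mat (Ap x) $$ (l, i))"
      by (rule sum.mono_neutral_right) (use one in \<open>auto simp: jump_matrix_def\<close>)
    also have "\<dots> = adj_mat (Ap x) $$ (1, i)" using one by (simp add: jump_matrix_def)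
    finally show ?thesis using adj[OF c(1)] adj[OF c(2)] by simp
  qed
  have gr: "(\<lambda>z. A z $$ (l, c)) \<in> O[infty_off_rays D](\<lambda>z. z ^ (N + D - 2))" if "l < D" "c < D" for l c
  proof (cases "c = 0")
    case True
    then show ?thesis using first_column_growth[OF that(1)] power_bigo_mono[of "N + D - 3" "N + D - 2" D]
      by (auto intro: landau_o.big_trans split: if_splits)
  next
    case False
    have "(\<lambda>z. A z $$ (l, c)) \<in> O[infty_off_rays D](\<lambda>z. z ^ 0)"
    proof (rule bigoI[where c = 2])
      have "\<forall>\<^sub>F z in infty_off_rays D. norm (R z $$ (l, c)) < 1"
        using order_tendstoD(2)[OF tendsto_norm[OF R_tendsto[OF that]], of 1] by simp
      moreover have "\<forall>\<^sub>F z in infty_off_rays D. z \<in> - rays D" by (simp add: eventually_inf_principal)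
      ultimately show "\<forall>\<^sub>F z in infty_off_rays D. norm (A z $$ (l, c)) \<le> 2 * norm (z ^ 0)"
        using eventually_norm_ge[of 1]
      proof eventually_elim
        case (elim z)
        let ?g = "if c = 1 then z powi (- int N) else z powi (- 1)"
        have "norm ((if l = c then 1 else 0) + R z $$ (l, c)) \<le> 2"
          using elim norm_triangle_ineq[of "if l = c then 1 else 0" "R z $$ (l, c)"] by (auto split: if_splits)
        moreover have "norm ?g \<le> 1"
          using elim by (auto simp: norm_power_int power_int_minus norm_inverse inverse_le_1_iff norm_power one_le_power)
        ultimately have "norm ((if l = c then 1 else 0) + R z $$ (l, c)) * norm ?g \<le> 2 * 1"
          by (intro mult_mono) auto
        then show ?case using growth_entry[OF that elim(2)] False by (simp add: norm_mult)
      qed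
    qed
    then show ?thesis using power_bigo_mono[of 0 "N + D - 2" D] by (rule landau_o.big_trans) simp
  qed
  obtain m where m: "(\<lambda>z. ?\<Phi> (A z)) \<in> O[infty_off_rays D](\<lambda>z. z ^ m)"
    using entry_poly_growth[OF \<Phi> gr] by blast
  obtain b where "\<And>z. z \<in> - rays D \<Longrightarrow> ?\<Phi> (A z) = poly b z"
    using no_jump_polynomial[OF D4 entry_poly_holomorphic[OF \<Phi> hol] entry_poly_no_jump[OF \<Phi> eq] entry_poly_bounded[OF \<Phi> bdd] m] by metis
  then show ?thesis using adj carr by (intro exI[of _ b]) simp
qed

definition inv_row where "inv_row i = (SOME p. \<forall>z \<in> - rays D. adj_mat (A z) $$ (1, i) = poly p z)"

lemma inv_row: "i < D \<Longrightarrow> z \<in> - rays D \<Longrightarrow> adj_mat (A z) $$ (1, i) = poly (inv_row i) z"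
  using someI_ex[OF inverse_row_poly, folded inv_row_def] by blast

end

section \<open>Moments of the solution\<close>

lemma moment_from_jump:
  assumes D: "D \<ge> 4" and hol: "f holomorphic_on (- rays D)"
    and sl: "side_limits D f hp hm" and bd: "bounded_near_0 D f"
    and gr: "(\<lambda>z. f z - c / z) \<in> O[infty_off_rays D](\<lambda>z. 1 / z\<^sup>2)"
    and jump: "\<And>k x. k < D \<Longrightarrow> x \<in> ray D k - {0} \<Longrightarrow> hp k x - hm k x = poly p x * \<omega> k x"
    and \<omega>: "ray_continuous D \<omega>"
  shows "has_moment D \<omega> p (- (2 * pi * \<i> * c))"
  unfolding has_moment_def ray_moment_def[abs_def]
proof (rule ray_jump_integral[OF D hol sl bd gr])
  fix k and r :: real assume "k < D" "r > 0"
  then show "hp k (of_real r * ray_dir D k) - hm k (of_real r * ray_dir D k) =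
      poly p (of_real r * ray_dir D k) * \<omega> k (of_real r * ray_dir D k)"
    by (intro jump) (assumption, unfold mem_ray_iff, blast)
qed (rule ray_continuous_integrable[OF \<omega>])

lemma bounded_near_0_cong:
  assumes f: "bounded_near_0 D f" and eq: "\<And>z. z \<in> - rays D \<Longrightarrow> z \<noteq> x \<Longrightarrow> g z = f z" and x: "x \<noteq> 0"
  shows "bounded_near_0 D g"
proof -
  obtain r M where 1: "r > 0" "M > 0" "\<And>z. z \<in> ball 0 r - rays D \<Longrightarrow> norm (f z) \<le> M"
    using bounded_near_0_lim[OF f] by blast
  show ?thesis
  proof (rule bounded_near_0I[of "min r (norm x)"])
    fix z assume z: "z \<in> ball 0 (min r (norm x)) - rays D"
    then have "g z = f z" by (intro eq) auto
    then show "norm (g z) \<le> M" using 1(3)[of z] z by simp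
  qed (use 1 x in simp)
qed

lemma poly_over_power_bigo:
  assumes "Polynomial.degree T < n"
  shows "(\<lambda>z. poly T z * z powi (- int n)) \<in> O[infty_off_rays D](\<lambda>z. 1 / z)"
proof (rule bigoI_tendsto)
  have "((\<lambda>z. poly T z / z ^ (n - 1)) \<longlongrightarrow> coeff T (n - 1)) (infty_off_rays D)"
    by (rule tendsto_mono[OF infty_off_rays_le poly_over_power_tendsto]) (use assms in simp)
  moreover have "\<forall>\<^sub>F z in infty_off_rays D. poly T z / z ^ (n - 1) = poly T z * z powi (- int n) / (1 / z)"
    using eventually_norm_ge[of 1]
  proof eventually_elim
    case (elim z)
    then have z: "z \<noteq> 0" by auto
    have "z ^ n = z ^ (n - 1) * z" using assms by (cases n) auto
    then show ?case using z by (simp add: power_int_minus field_simps)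
  qed
  ultimately show "((\<lambda>z. poly T z * z powi (- int n) / (1 / z)) \<longlongrightarrow> coeff T (n - 1)) (infty_off_rays D)"
    by (rule Lim_transform_eventually)
  show "\<forall>\<^sub>F z in infty_off_rays D. 1 / z \<noteq> 0"
    using eventually_norm_ge[of 1] by eventually_elim auto
qed

lemma const_mult_bigo: "f \<in> O[G](g) \<Longrightarrow> (\<lambda>z. (c::complex) * f z) \<in> O[G](g)"
  by (cases "c = 0") auto

lemma shifted_inverse_bigo: "(\<lambda>z. 1 / (z - x)) \<in> O[infty_off_rays D](\<lambda>z::complex. 1 / z)"
proof (rule bigoI[where c = 2])
  show "\<forall>\<^sub>F z in infty_off_rays D. norm (1 / (z - x)) \<le> 2 * norm (1 / z)"
    using eventually_norm_ge[of "2 * norm x + 1"]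
  proof eventually_elim
    case (elim z)
    have "norm z \<le> norm (z - x) + norm x" using norm_triangle_ineq[of "z - x" x] by simp
    then have "norm (z - x) \<ge> norm z / 2" using elim by linarith
    moreover have "norm z > 0" using elim norm_ge_zero[of x] by linarith
    ultimately have "norm (z - x) \<ge> norm z / 2" "norm (z - x) > 0" "norm z > 0" by linarith+
    then show ?case by (simp add: norm_divide divide_simps)
  qed
qed

context rh_data begin

text \<open>Column \<open>c\<close> decays like \<open>z\<close> to the power minus this number.\<close>

definition col_order :: "nat \<Rightarrow> nat" where "col_order c = (if c = 1 then N else 1)"

lemma entry_growth:
  assumes "i < D" "1 \<le> c" "c < D" "z \<in> - rays D"
  shows "A z $$ (i, c) * poly T z = ((if i = c then 1 else 0) + R z $$ (i, c)) * (poly T z * z powi (- int (col_order c)))"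
  using growth_entry[OF assms(1,3,4)] assms(2) by (auto simp: col_order_def)

text \<open>The decay of column \<open>c\<close> leaves room for multiplication by \<open>T\<close>; the coefficient of \<open>1 / z\<close> in the
  product comes from the identity matrix in the asymptotics, so it is absent off the diagonal.\<close>

lemma column_moment:
  assumes i: "2 \<le> i" "i < D" and c: "1 \<le> c" "c < D" and T: "Polynomial.degree T < col_order c"
  shows "has_moment D (col_jump c) (first_col i * T) (- (2 * pi * \<i> * (if i = c then coeff T 0 else 0)))"
proof (rule moment_from_jump[OF D4 _ side_limits_mult[OF A_side_limits[OF i(2) c(2)], of "poly T"]
      bounded_near_0_mult[OF bdd[OF i(2) c(2)] bounded_near_0_continuous[of "poly T"]] _ _ ray_continuous_col_jump])
  show "(\<lambda>z. A z $$ (i, c) * poly T z) holomorphic_on - rays D"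
    using hol[OF i(2) c(2)] by (intro holomorphic_intros)
  have "(\<lambda>z. R z $$ (i, c) * (poly T z * z powi (- int (col_order c)))) \<in> O[infty_off_rays D](\<lambda>z. 1 / z * (1 / z))"
    by (rule landau_o.big_mult[OF RO[OF i(2) c(2)] poly_over_power_bigo[OF T]])
  moreover have "\<forall>\<^sub>F z in infty_off_rays D. A z $$ (i, c) * poly T z - (if i = c then coeff T 0 else 0) / z
      = R z $$ (i, c) * (poly T z * z powi (- int (col_order c)))"
    unfolding eventually_inf_principal
  proof (intro always_eventually allI impI)
    fix z assume z: "z \<in> - rays D"
    have "poly T z * z powi (- int (col_order c)) = coeff T 0 / z" if "i = c"
    proof -
      have o: "col_order c = 1" using that i by (simp add: col_order_def)
      then obtain t where "T = [:t:]" using T by (auto elim: degree_eq_zeroE)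
      then show ?thesis using o by (simp add: power_int_minus divide_inverse)
    qed
    then show "A z $$ (i, c) * poly T z - (if i = c then coeff T 0 else 0) / z
      = R z $$ (i, c) * (poly T z * z powi (- int (col_order c)))"
      unfolding entry_growth[OF i(2) c z] by (simp add: distrib_right)
  qed
  ultimately show "(\<lambda>z. A z $$ (i, c) * poly T z - (if i = c then coeff T 0 else 0) / z) \<in> O[infty_off_rays D](\<lambda>z. 1 / z\<^sup>2)"
    by (simp add: landau_o.big.in_cong power2_eq_square)
  show "Hp i c k x * poly T x - Hm i c k x * poly T x = poly (first_col i * T) x * col_jump c k x" if "k < D" "x \<in> ray D k - {0}" for k x
    unfolding left_diff_distrib[symmetric] side_jump[OF that i(2) c] by simp
qed auto

text \<open>For fixed \<open>x\<close> off the rays, the row vector \<open>e\<^sub>2\<^sup>T A(x)\<^sup>-\<^sup>1 A(y)\<close> satisfies the same jump relations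
  in \<open>y\<close> as the rows of \<open>A\<close>, and equals \<open>e\<^sub>2\<^sup>T\<close> at \<open>y = x\<close>.\<close>

definition ip_row :: "complex \<Rightarrow> nat \<Rightarrow> complex \<Rightarrow> complex" where
  "ip_row x c y = (\<Sum>i<D. poly (inv_row i) x * A y $$ (i, c))"

definition ip_poly :: "complex \<Rightarrow> complex poly" where
  "ip_poly x = (\<Sum>i<D. Polynomial.smult (poly (inv_row i) x) (first_col i))"

lemma poly_ip_poly: "poly (ip_poly x) y = (\<Sum>i<D. poly (inv_row i) x * poly (first_col i) y)"
  by (simp add: ip_poly_def poly_sum)

lemma ip_row_diag:
  assumes x: "x \<in> - rays D" and c: "c < D"
  shows "ip_row x c x = (if c = 1 then 1 else 0)"
proof -
  have one: "1 < D" using D4 by simp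
  note Ax = carr[OF x]
  have "(adj_mat (A x) * A x) $$ (1, c) = (\<Sum>i<D. adj_mat (A x) $$ (1, i) * A x $$ (i, c))"
    using one c Ax adj_mat(1)[OF Ax] by (auto simp: scalar_prod_def atLeast0LessThan intro!: sum.cong)
  also have "\<dots> = ip_row x c x" unfolding ip_row_def by (intro sum.cong refl) (use inv_row x in simp)
  also have "adj_mat (A x) * A x = Determinant.det (A x) \<cdot>\<^sub>m 1\<^sub>m D" by (rule adj_mat(3)[OF Ax])
  finally show ?thesis using det_A[OF x] one c by auto
qed

text \<open>At \<open>y = x\<close> the row is a unit vector with vanishing first entry.\<close>

lemma ip_poly_factor:
  assumes x: "x \<in> - rays D"
  obtains q where "ip_poly x = [:- x, 1:] * q" "\<And>n. n \<ge> N + D - 2 \<Longrightarrow> coeff q n = 0"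
proof -
  have "poly (ip_poly x) x = ip_row x 0 x"
    unfolding poly_ip_poly ip_row_def by (intro sum.cong refl) (use first_col(2) x in simp)
  then have "poly (ip_poly x) x = 0" using ip_row_diag[OF x D0] by simp
  then obtain q where q: "ip_poly x = [:- x, 1:] * q" by (auto simp: poly_eq_0_iff_dvd elim: dvdE)
  have d: "Polynomial.degree (ip_poly x) \<le> N + D - 2"
    unfolding ip_poly_def
  proof (intro degree_sum_le order.trans[OF degree_smult_le])
    fix i assume "i \<in> {..<D}"
    then show "Polynomial.degree (first_col i) \<le> N + D - 2" using first_col(1)[of i] by (auto split: if_splits)
  qed simp
  have "coeff q n = 0" if "n \<ge> N + D - 2" for n
  proof (cases "q = 0")
    case False
    then have "Polynomial.degree (ip_poly x) = 1 + Polynomial.degree q"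
      unfolding q by (subst degree_mult_eq) auto
    then show ?thesis using d that by (intro coeff_eq_0) linarith
  qed simp
  then show ?thesis using that q by blast
qed

text \<open>The difference quotient at \<open>x\<close> of the \<open>c\<close>-th entry times \<open>T\<close> is analytic off the rays and has jump
  \<open>q T\<close> times the density.  The subtracted constant \<open>poly T x\<close>, present only in the second column,
  produces its \<open>1 / z\<close> term.\<close>

lemma ip_moment:
  assumes x: "x \<in> - rays D" and c: "1 \<le> c" "c < D" and T: "Polynomial.degree T < col_order c"
    and q: "ip_poly x = [:- x, 1:] * q"
  shows "has_moment D (col_jump c) (q * T) (2 * pi * \<i> * (if c = 1 then poly T x else 0))"
proof -
  define g where "g z = ip_row x c z * poly T z" for z
  define h where "h z = (if z = x then deriv g x else (g z - g x) / (z - x))" for z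
  have x0: "x \<noteq> 0" using x zero_in_rays[OF D0] by auto
  have gx: "g x = (if c = 1 then poly T x else 0)" by (simp add: g_def ip_row_diag[OF x c(2)])
  have opn: "open (- rays D)" using closed_rays by (simp add: open_Compl)
  have gh: "g holomorphic_on - rays D"
    unfolding g_def ip_row_def using hol c(2) by (intro holomorphic_intros) auto
  have hh: "h holomorphic_on - rays D"
    unfolding h_def by (rule pole_lemma_open[OF gh opn])
  let ?p = "\<lambda>k y. ((\<Sum>i<D. poly (inv_row i) x * Hp i c k y) * poly T y - g x) * (1 / (y - x))"
  let ?m = "\<lambda>k y. ((\<Sum>i<D. poly (inv_row i) x * Hm i c k y) * poly T y - g x) * (1 / (y - x))"
  have heq: "h z = (g z - g x) * (1 / (z - x))" if "z \<noteq> x" for z using that by (simp add: h_def)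
  have sl: "side_limits D h ?p ?m"
  proof (rule side_limits_cong[OF side_limits_mult[OF side_limits_diff_const[OF side_limits_mult[OF side_limits_lincomb]]], where a = x])
    show "side_limits D (\<lambda>z. A z $$ (i, c)) (Hp i c) (Hm i c)" if "i \<in> {..<D}" for i
      using A_side_limits[of i c] that c by simp
    show "isCont (\<lambda>y. 1 / (y - x)) w" if "w \<in> rays D - {0}" for w
      using that x by (auto intro!: continuous_intros)
    show "h z = ((\<Sum>i<D. poly (inv_row i) x * A z $$ (i, c)) * poly T z - g x) * (1 / (z - x))" if "z \<noteq> x" for z
      using heq[OF that] by (simp add: g_def ip_row_def)
  qed (use x in auto)
  have bg: "bounded_near_0 D (\<lambda>z. (g z - g x) * (1 / (z - x)))"
  proof (rule bounded_near_0_mult)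
    have "bounded_near_0 D g"
      unfolding g_def ip_row_def using c(2)
      by (intro bounded_near_0_mult bounded_near_0_sum bounded_near_0_const bdd bounded_near_0_continuous) auto
    from bounded_near_0_add[OF this bounded_near_0_const[of D "- g x"]]
    show "bounded_near_0 D (\<lambda>z. g z - g x)" by simp
    show "bounded_near_0 D (\<lambda>z. 1 / (z - x))"
      by (rule bounded_near_0_continuous) (use x0 in \<open>auto intro!: continuous_intros\<close>)
  qed
  have bh: "bounded_near_0 D h"
    by (rule bounded_near_0_cong[OF bg _ x0]) (rule heq)
  have g1: "g \<in> O[infty_off_rays D](\<lambda>z. 1 / z)"
  proof -
    have "(\<lambda>z. \<Sum>i<D. poly (inv_row i) x * (((if i = c then 1 else 0) + R z $$ (i, c)) * (poly T z * z powi (- int (col_order c))))) \<in> O[infty_off_rays D](\<lambda>z. 1 / z)"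
    proof (intro big_sum_in_bigo)
      fix i assume "i \<in> {..<D}"
      then have i: "i < D" by simp
      have "(\<lambda>z. (if i = c then 1 else 0) + R z $$ (i, c)) \<in> O[infty_off_rays D](\<lambda>_. 1)"
        by (rule bigoI_tendsto[where c = "if i = c then 1 else 0"])
           (use tendsto_add[OF tendsto_const[of "if i = c then 1 else 0"] R_tendsto[OF i c(2)]] in auto)
      from landau_o.big_mult[OF this poly_over_power_bigo[OF T]]
      have "(\<lambda>z. ((if i = c then 1 else 0) + R z $$ (i, c)) * (poly T z * z powi (- int (col_order c)))) \<in> O[infty_off_rays D](\<lambda>z. 1 / z)"
        by simp
      then show "(\<lambda>z. poly (inv_row i) x * (((if i = c then 1 else 0) + R z $$ (i, c)) * (poly T z * z powi (- int (col_order c))))) \<in> O[infty_off_rays D](\<lambda>z. 1 / z)"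
        by (cases "poly (inv_row i) x = 0") auto
    qed
    moreover have "\<forall>\<^sub>F z in infty_off_rays D. g z = (\<Sum>i<D. poly (inv_row i) x * (((if i = c then 1 else 0) + R z $$ (i, c)) * (poly T z * z powi (- int (col_order c)))))"
      unfolding eventually_inf_principal
    proof (intro always_eventually allI impI)
      fix z assume z: "z \<in> - rays D"
      show "g z = (\<Sum>i<D. poly (inv_row i) x * (((if i = c then 1 else 0) + R z $$ (i, c)) * (poly T z * z powi (- int (col_order c)))))"
        unfolding g_def ip_row_def sum_distrib_right
        by (intro sum.cong refl) (use entry_growth[OF _ c z, of _ T] in \<open>simp add: mult.assoc\<close>)
    qed
    ultimately show ?thesis by (simp add: landau_o.big.in_cong)
  qed
  have gr: "(\<lambda>z. h z - (- g x) / z) \<in> O[infty_off_rays D](\<lambda>z. 1 / z\<^sup>2)"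
  proof -
    have "(\<lambda>z. g z * (1 / (z - x)) + (- (g x * x)) * (1 / z * (1 / (z - x)))) \<in> O[infty_off_rays D](\<lambda>z. 1 / z * (1 / z))"
    proof (rule sum_in_bigo(1))
      show "(\<lambda>z. g z * (1 / (z - x))) \<in> O[infty_off_rays D](\<lambda>z. 1 / z * (1 / z))"
        by (rule landau_o.big_mult[OF g1 shifted_inverse_bigo])
      have "(\<lambda>z. 1 / z * (1 / (z - x))) \<in> O[infty_off_rays D](\<lambda>z. 1 / z * (1 / z))"
        by (rule landau_o.big_mult[OF landau_o.big_refl shifted_inverse_bigo])
      then show "(\<lambda>z. - (g x * x) * (1 / z * (1 / (z - x)))) \<in> O[infty_off_rays D](\<lambda>z. 1 / z * (1 / z))"
        by (rule const_mult_bigo)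
    qed
    moreover have "\<forall>\<^sub>F z in infty_off_rays D. h z - (- g x) / z = g z * (1 / (z - x)) + (- (g x * x)) * (1 / z * (1 / (z - x)))"
      using eventually_norm_ge[of "norm x + 1"]
    proof eventually_elim
      case (elim z)
      have z: "z \<noteq> x" using elim by auto
      moreover have "z \<noteq> 0"
      proof
        assume "z = 0" then show False using elim norm_ge_zero[of x] by simp
      qed
      ultimately show ?case unfolding heq[OF z] by (simp add: divide_simps) (simp add: algebra_simps)
    qed
    ultimately show ?thesis by (simp add: landau_o.big.in_cong power2_eq_square)
  qed
  have "has_moment D (col_jump c) (q * T) (- (2 * pi * \<i> * (- g x)))"
  proof (rule moment_from_jump[OF D4 hh sl bh gr _ ray_continuous_col_jump])
    fix k y assume k: "k < D" "y \<in> ray D k - {0}"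
    have "y \<in> rays D" using ray_subset[OF k(1)] k(2) by blast
    then have yx: "y - x \<noteq> 0" using x by auto
    have "(\<Sum>i<D. poly (inv_row i) x * Hp i c k y) - (\<Sum>i<D. poly (inv_row i) x * Hm i c k y) = poly (ip_poly x) y * col_jump c k y"
      unfolding poly_ip_poly sum_subtractf[symmetric] sum_distrib_right right_diff_distrib[symmetric]
      by (intro sum.cong refl) (use side_jump[OF k _ c] in \<open>simp add: mult.assoc\<close>)
    also have "poly (ip_poly x) y = (y - x) * poly q y" unfolding q by (simp add: algebra_simps)
    finally have *: "(\<Sum>i<D. poly (inv_row i) x * Hp i c k y) - (\<Sum>i<D. poly (inv_row i) x * Hm i c k y) = (y - x) * poly q y * col_jump c k y" .
    have "(s * t - g') * i - (r * t - g') * i = (s - r) * t * i" for s r t g' i :: complex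
      by (simp add: algebra_simps)
    then have "?p k y - ?m k y = ((y - x) * poly q y * col_jump c k y) * poly T y * (1 / (y - x))"
      unfolding *[symmetric] .
    then show "?p k y - ?m k y = poly (q * T) y * col_jump c k y"
      using yx by simp
  qed
  then show ?thesis using gx by simp
qed

end

section \<open>Identification of the kernel\<close>

lemma polys_linearly_dependent:
  fixes f :: "nat \<Rightarrow> 'a::field poly"
  assumes deg: "\<And>i n. i \<le> M \<Longrightarrow> n \<ge> M \<Longrightarrow> coeff (f i) n = 0"
  obtains \<alpha> where "(\<Sum>i\<le>M. Polynomial.smult (\<alpha> i) (f i)) = 0" "\<exists>i\<le>M. \<alpha> i \<noteq> 0"
proof (cases "inj_on f {..M}")
  case False
  then obtain i j where ij: "i \<le> M" "j \<le> M" "i \<noteq> j" "f i = f j" unfolding inj_on_def by auto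
  let ?\<alpha> = "\<lambda>k. if k = i then 1 else if k = j then - 1 else (0 :: 'a)"
  have "(\<Sum>k\<le>M. Polynomial.smult (?\<alpha> k) (f k)) = (\<Sum>k\<in>{i, j}. Polynomial.smult (?\<alpha> k) (f k))"
    by (rule sum.mono_neutral_right) (use ij in auto)
  also have "\<dots> = 0" using ij by simp
  finally have "(\<Sum>k\<le>M. Polynomial.smult (?\<alpha> k) (f k)) = 0" .
  moreover have "\<exists>k\<le>M. ?\<alpha> k \<noteq> 0" by (intro exI[of _ i]) (use ij in simp)
  ultimately show ?thesis by (rule that)
next
  case True
  interpret vs: vector_space "Polynomial.smult :: 'a \<Rightarrow> 'a poly \<Rightarrow> 'a poly"
    by unfold_locales (simp_all add: smult_add_right smult_add_left)
  let ?B = "f ` {..M}" and ?T = "(\<lambda>n. Polynomial.monom (1::'a) n) ` {..<M}"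
  have "?B \<subseteq> vs.span ?T"
  proof
    fix p assume "p \<in> ?B"
    then obtain i where i: "i \<le> M" "p = f i" by auto
    have "p = (\<Sum>n<M. Polynomial.smult (coeff p n) (Polynomial.monom 1 n))"
    proof (rule poly_eqI)
      fix m
      have "coeff (\<Sum>n<M. Polynomial.smult (coeff p n) (Polynomial.monom 1 n)) m = (\<Sum>n<M. if n = m then coeff p n else 0)"
        unfolding coeff_sum by (intro sum.cong refl) simp
      also have "\<dots> = coeff p m" using deg[OF i(1), of m] i by (simp add: not_less)
      finally show "coeff p m = coeff (\<Sum>n<M. Polynomial.smult (coeff p n) (Polynomial.monom 1 n)) m" by simp
    qed
    also have "\<dots> \<in> vs.span ?T"
      by (intro vs.span_sum vs.span_scale vs.span_base) auto
    finally show "p \<in> vs.span ?T" .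
  qed
  moreover have "card ?B = Suc M" using True by (simp add: card_image)
  moreover have "card ?T \<le> M" using card_image_le[of "{..<M}" "\<lambda>n. Polynomial.monom (1::'a) n"] by simp
  ultimately have "vs.dependent ?B"
    using vs.independent_span_bound[of ?T ?B] by fastforce
  then obtain u where u: "\<exists>v\<in>?B. u v \<noteq> 0" "(\<Sum>v\<in>?B. Polynomial.smult (u v) v) = 0"
    using vs.dependent_finite[of ?B] by auto
  show ?thesis
  proof (rule that[of "\<lambda>i. u (f i)"])
    show "(\<Sum>i\<le>M. Polynomial.smult (u (f i)) (f i)) = 0"
      using u(2) by (simp add: sum.reindex[OF True])
  qed (use u(1) in auto)
qed

lemma infinite_off_rays: assumes "D \<ge> 2" shows "infinite (- rays D)"
proof -
  have D: "D > 0" using assms by simp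
  have "rcis 1 (pi / real D) \<in> ccw_sector D 0" unfolding ccw_sector_def
    using D by (intro CollectI exI[of _ 1] exI[of _ "pi / real D"]) (auto simp: divide_strict_right_mono)
  then have "ccw_sector D 0 \<noteq> {}" by blast
  then have "infinite (ccw_sector D 0)" using open_ccw_sector[OF assms, of 0] finite_imp_not_open by blast
  then show ?thesis using ccw_sector_subset[OF D, of 0] finite_subset by blast
qed

lemma poly_eq_off_rays:
  fixes p q :: "complex poly"
  assumes "D \<ge> 2" "\<And>z. z \<in> - rays D \<Longrightarrow> poly p z = poly q z"
  shows "p = q"
proof (rule ccontr)
  assume "p \<noteq> q"
  then have "finite {z. poly (p - q) z = 0}" by (intro poly_roots_finite) simp
  moreover have "- rays D \<subseteq> {z. poly (p - q) z = 0}" using assms(2) by auto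
  ultimately show False using infinite_off_rays[OF assms(1)] finite_subset by blast
qed

lemma poly_extend_eq:
  assumes "D \<ge> 2" "\<And>z. z \<in> - rays D \<Longrightarrow> f z = poly p z"
  shows "poly_extend (rays D) f z = poly p z"
proof -
  have "(THE q. \<forall>u \<in> - rays D. f u = poly q u) = p"
  proof (rule the_equality)
    fix q assume "\<forall>u \<in> - rays D. f u = poly q u"
    then show "q = p" using assms(2) by (intro poly_eq_off_rays[OF assms(1)]) auto
  qed (use assms in auto)
  then show ?thesis using assms(2) by (simp add: poly_extend_def)
qed

context rh_data begin

lemma D2: "D \<ge> 2" using D4 by simp

lemma inverse_product_21_poly: "inverse_product_21 D A x y = (\<Sum>i<D. poly (inv_row i) x * poly (first_col i) y)"
  unfolding inverse_product_21_def
proof (intro sum.cong refl arg_cong2[where f = "(*)"])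
  fix i assume "i \<in> {..<D}"
  then have i: "i < D" by simp
  show "poly_extend (rays D) (\<lambda>u. A u $$ (i, 0)) y = poly (first_col i) y"
    by (rule poly_extend_eq[OF D2]) (rule first_col(2)[OF i])
  show "poly_extend (rays D) (\<lambda>u. the (mat_inverse (A u)) $$ (1, i)) x = poly (inv_row i) x"
  proof (rule poly_extend_eq[OF D2])
    fix z assume z: "z \<in> - rays D"
    note Az = carr[OF z]
    have sm: "(1::complex) \<cdot>\<^sub>m 1\<^sub>m D = 1\<^sub>m D" by (rule eq_matI) auto
    have am: "adj_mat (A z) \<in> carrier_mat D D" "A z * adj_mat (A z) = 1\<^sub>m D" "adj_mat (A z) * A z = 1\<^sub>m D"
      using adj_mat[OF Az] det_A[OF z] sm by simp_all
    have "A z \<in> Units (ring_mat TYPE(complex) D ())"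
      using am Az by (auto simp: Units_def ring_mat_def)
    then obtain B where B: "mat_inverse (A z) = Some B"
      using mat_inverse(1)[OF Az, of "()"] by (cases "mat_inverse (A z)") auto
    have B': "A z * B = 1\<^sub>m D" "B \<in> carrier_mat D D" using mat_inverse(2)[OF Az B] by auto
    have "B = (adj_mat (A z) * A z) * B" using am B' by simp
    also have "\<dots> = adj_mat (A z)" using assoc_mult_mat[OF am(1) Az B'(2)] B'(1) am(1) by simp
    finally show "the (mat_inverse (A z)) $$ (1, i) = poly (inv_row i) z" using B inv_row[OF i z] by simp
  qed
qed

context
  fixes P :: "nat \<Rightarrow> real poly"
  assumes P: "monic_sobolev_ops V lam P"
begin

lemma degree_P: "Polynomial.degree (P n) = n" and P_nonzero: "P n \<noteq> 0"
  and P_orth: "m \<noteq> n \<Longrightarrow> sobolev_inner V lam (P n) (P m) = 0"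
  using P unfolding monic_sobolev_ops_def by (blast, metis lead_coeff_1 leading_coeff_0_iff zero_neq_one, blast)

definition op_P :: "nat \<Rightarrow> complex poly" where "op_P n = sobolev_op V lam (cp (P n))"

definition norm_P :: "nat \<Rightarrow> complex" where "norm_P n = of_real (sobolev_inner V lam (P n) (P n))"

lemma norm_P_nonzero: "norm_P n \<noteq> 0"
  using sobolev_inner_self_pos[OF degV lcV_pos D0 evenD lam P_nonzero[of n]] by (simp add: norm_P_def)

lemma op_P_exp_moment: "has_moment D (col_jump 1) (op_P n * cp (P m)) (if n = m then norm_P m else 0)"
  using exp_moment_sobolev_op[of "P m" "P n"] P_orth[of n m]
  by (auto simp: col_jump_def op_P_def norm_P_def mult.commute)

lemma op_P_weight_moment:
  assumes "2 \<le> c" "c < D" shows "has_moment D (col_jump c) (op_P n) 0"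
  using weight_moment_sobolev_op[OF weight_index[OF assms]] assms by (simp add: col_jump_def op_P_def)

lemma degree_op_P: "n < N \<Longrightarrow> k \<ge> N + D - 2 \<Longrightarrow> coeff (op_P n) k = 0"
  using degree_sobolev_op_le[OF degV D2, of lam "cp (P n)"] degree_P[of n] D4
  by (intro coeff_eq_0) (simp add: op_P_def)

definition kernel_poly :: "complex \<Rightarrow> complex poly" where
  "kernel_poly x = (\<Sum>n<N. Polynomial.smult (poly (cp (P n)) x / norm_P n) (op_P n))"

lemma poly_kernel_poly: "poly (kernel_poly x) y = sobolev_kernel V lam P N x y"
  by (simp add: kernel_poly_def sobolev_kernel_def poly_sum norm_P_def op_P_def sobolev_op_def cpoly_pderiv algebra_simps)

lemma kernel_poly_exp_moment:
  assumes "m < N" shows "has_moment D (col_jump 1) (kernel_poly x * cp (P m)) (poly (cp (P m)) x)"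
proof -
  have "has_moment D (col_jump 1) (\<Sum>n<N. Polynomial.smult (poly (cp (P n)) x / norm_P n) (op_P n * cp (P m)))
      (\<Sum>n<N. poly (cp (P n)) x / norm_P n * (if n = m then norm_P m else 0))"
    by (intro has_moment_sum[OF ray_continuous_col_jump] has_moment_smult op_P_exp_moment) simp
  moreover have "(\<Sum>n<N. poly (cp (P n)) x / norm_P n * (if n = m then norm_P m else 0)) = poly (cp (P m)) x"
    using assms norm_P_nonzero[of m] by (simp add: if_distrib[of "\<lambda>t. _ * t"] cong: if_cong)
  ultimately show ?thesis by (simp add: kernel_poly_def sum_distrib_right)
qed

lemma kernel_poly_weight_moment:
  assumes "2 \<le> c" "c < D" shows "has_moment D (col_jump c) (kernel_poly x) 0"
proof -
  have "has_moment D (col_jump c) (kernel_poly x) (\<Sum>n<N. poly (cp (P n)) x / norm_P n * 0)"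
    unfolding kernel_poly_def
    by (intro has_moment_sum[OF ray_continuous_col_jump] has_moment_smult op_P_weight_moment assms) simp
  then show ?thesis by simp
qed

text \<open>Uniqueness for the moment problem in degree below \<open>N + D - 2\<close>.  There are as many moments
  as dimensions, and a dual family is at hand: \<open>op_P n\<close> with \<open>n < N\<close> is dual to the moments against
  \<open>exp (- V)\<close>, \<open>first_col c\<close> with \<open>2 \<le> c < D\<close> to those against the other weights.  A nonzero
  polynomial with vanishing moments would be linearly independent of this family.\<close>

lemma moments_determine:
  assumes deg: "\<And>k. k \<ge> N + D - 2 \<Longrightarrow> coeff d k = 0"
    and exp0: "\<And>m. m < N \<Longrightarrow> has_moment D (col_jump 1) (d * cp (P m)) 0"
    and w0: "\<And>c. 2 \<le> c \<Longrightarrow> c < D \<Longrightarrow> has_moment D (col_jump c) d 0"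
  shows "d = 0"
proof -
  let ?M = "N + D - 2"
  define f where "f n = (if n < N then op_P n else if n < ?M then first_col (n - N + 2) else d)" for n
  have MN: "N \<le> ?M" using D4 by simp
  have low: "coeff (f i) k = 0" if "i \<le> ?M" "k \<ge> ?M" for i k
  proof -
    have "i < N \<or> N \<le> i \<and> i < ?M \<or> i = ?M" using \<open>i \<le> ?M\<close> by auto
    then consider "i < N" | "N \<le> i" "i < ?M" | "i = ?M" by blast
    then show ?thesis
    proof cases
      case 1 then show ?thesis using degree_op_P[OF 1 that(2)] by (simp add: f_def)
    next
      case 2
      then have "i - N + 2 < D" by linarith
      from first_col(1)[OF this] have "Polynomial.degree (first_col (i - N + 2)) < k" using that(2) D4 by simp
      then show ?thesis using 2 by (simp add: f_def coeff_eq_0)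
    next
      case 3 then show ?thesis using deg[OF that(2)] MN by (simp add: f_def)
    qed
  qed
  obtain \<alpha> where \<alpha>: "(\<Sum>i\<le>?M. Polynomial.smult (\<alpha> i) (f i)) = 0" "\<exists>i\<le>?M. \<alpha> i \<noteq> 0"
    by (rule polys_linearly_dependent[of ?M f, OF low])
  have \<alpha>1: "\<alpha> m = 0" if m: "m < N" for m
  proof -
    have fm: "has_moment D (col_jump 1) (f i * cp (P m)) (if i = m then norm_P m else 0)" if iM: "i \<le> ?M" for i
    proof -
      have "i < N \<or> N \<le> i \<and> i < ?M \<or> i = ?M" using iM by auto
      then consider "i < N" | "N \<le> i" "i < ?M" | "i = ?M" by blast
      then show ?thesis
      proof cases
        case 1 then show ?thesis using op_P_exp_moment[of i m] by (simp add: f_def)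
      next
        case 2
        then have i: "2 \<le> i - N + 2" "i - N + 2 < D" by linarith+
        have "has_moment D (col_jump 1) (first_col (i - N + 2) * cp (P m)) (- (2 * pi * \<i> * (if i - N + 2 = 1 then coeff (cp (P m)) 0 else 0)))"
          by (rule column_moment[OF i]) (use D4 m degree_P in \<open>auto simp: col_order_def\<close>)
        then show ?thesis using 2 m by (simp add: f_def)
      next
        case 3 then show ?thesis using exp0[OF m] MN m by (simp add: f_def)
      qed
    qed
    have "has_moment D (col_jump 1) (\<Sum>i\<le>?M. Polynomial.smult (\<alpha> i) (f i * cp (P m))) (\<Sum>i\<le>?M. \<alpha> i * (if i = m then norm_P m else 0))"
      by (intro has_moment_sum[OF ray_continuous_col_jump] has_moment_smult fm) auto
    moreover have "(\<Sum>i\<le>?M. Polynomial.smult (\<alpha> i) (f i * cp (P m))) = (\<Sum>i\<le>?M. Polynomial.smult (\<alpha> i) (f i)) * cp (P m)"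
      by (simp add: sum_distrib_right)
    moreover have "(\<Sum>i\<le>?M. \<alpha> i * (if i = m then norm_P m else 0)) = \<alpha> m * norm_P m"
      using m MN by (simp add: if_distrib[of "\<lambda>t. _ * t"] cong: if_cong)
    ultimately have "has_moment D (col_jump 1) 0 (\<alpha> m * norm_P m)" using \<alpha>(1) by simp
    from has_moment_unique[OF this has_moment_0] show ?thesis using norm_P_nonzero[of m] by simp
  qed
  have \<alpha>2: "\<alpha> (N + c - 2) = 0" if c: "2 \<le> c" "c < D" for c
  proof -
    have fc: "has_moment D (col_jump c) (f i) (if i = N + c - 2 then - (2 * pi * \<i>) else 0)" if iM: "i \<le> ?M" for i
    proof -
      have "i < N \<or> N \<le> i \<and> i < ?M \<or> i = ?M" using iM by auto
      then consider "i < N" | "N \<le> i" "i < ?M" | "i = ?M" by blast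
      then show ?thesis
      proof cases
        case 1 then show ?thesis using op_P_weight_moment[OF c, of i] c by (auto simp: f_def)
      next
        case 2
        then have i: "2 \<le> i - N + 2" "i - N + 2 < D" by linarith+
        have H: "has_moment D (col_jump c) (first_col (i - N + 2) * 1) (- (2 * pi * \<i> * (if i - N + 2 = c then coeff 1 0 else 0)))"
          by (rule column_moment[OF i]) (use c in \<open>auto simp: col_order_def\<close>)
        have fi: "f i = first_col (i - N + 2) * 1" using 2 by (simp add: f_def)
        have "i - N + 2 = c \<longleftrightarrow> i = N + c - 2" using 2 c by linarith
        then have e: "- (2 * pi * \<i> * (if i - N + 2 = c then coeff 1 0 else 0)) = (if i = N + c - 2 then - (2 * pi * \<i>) else 0)"
          by simp
        show ?thesis using H unfolding fi e .
      next
        case 3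
        then have "i \<noteq> N + c - 2" using c by linarith
        then show ?thesis using w0[OF c] MN 3 by (simp add: f_def)
      qed
    qed
    have "has_moment D (col_jump c) (\<Sum>i\<le>?M. Polynomial.smult (\<alpha> i) (f i)) (\<Sum>i\<le>?M. \<alpha> i * (if i = N + c - 2 then - (2 * pi * \<i>) else 0))"
      by (intro has_moment_sum[OF ray_continuous_col_jump] has_moment_smult fc) auto
    moreover have "N + c - 2 \<le> ?M" using c by linarith
    then have "(\<Sum>i\<le>?M. \<alpha> i * (if i = N + c - 2 then - (2 * pi * \<i>) else 0)) = \<alpha> (N + c - 2) * (- (2 * pi * \<i>))"
      by (simp add: if_distrib[of "\<lambda>t. _ * t"] cong: if_cong)
    ultimately have "has_moment D (col_jump c) 0 (\<alpha> (N + c - 2) * (- (2 * pi * \<i>)))" using \<alpha>(1) by simp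
    from has_moment_unique[OF this has_moment_0] show ?thesis by simp
  qed
  have z: "\<alpha> i = 0" if "i < ?M" for i
  proof (cases "i < N")
    case False
    then have c: "2 \<le> i - N + 2" "i - N + 2 < D" and e: "N + (i - N + 2) - 2 = i" using that by auto
    from \<alpha>2[OF c] show ?thesis unfolding e .
  qed (rule \<alpha>1)
  have "\<alpha> ?M \<noteq> 0"
  proof -
    obtain i where "i \<le> ?M" "\<alpha> i \<noteq> 0" using \<alpha>(2) by blast
    then show ?thesis using z[of i] by (cases "i = ?M") auto
  qed
  moreover have "(\<Sum>i\<le>?M. Polynomial.smult (\<alpha> i) (f i)) = Polynomial.smult (\<alpha> ?M) (f ?M)"
    by (subst sum.mono_neutral_right[of _ "{?M}"]) (use z in auto)
  ultimately have "f ?M = 0" using \<alpha>(1) by simp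
  then show ?thesis using MN by (simp add: f_def)
qed

lemma kernel_identity_off_rays:
  assumes x: "x \<in> - rays D"
  shows "(\<Sum>i<D. poly (inv_row i) x * poly (first_col i) y) = 2 * pi * \<i> * (y - x) * sobolev_kernel V lam P N x y"
proof -
  obtain q where q: "ip_poly x = [:- x, 1:] * q" "\<And>n. n \<ge> N + D - 2 \<Longrightarrow> coeff q n = 0"
    using ip_poly_factor[OF x] by blast
  define d where "d = q + Polynomial.smult (- (2 * pi * \<i>)) (kernel_poly x)"
  have one: "1 < D" using D4 by simp
  have "d = 0"
  proof (rule moments_determine)
    show "coeff d k = 0" if "k \<ge> N + D - 2" for k
      using q(2)[OF that] degree_op_P[OF _ that] by (simp add: d_def kernel_poly_def coeff_sum)
    show "has_moment D (col_jump 1) (d * cp (P m)) 0" if m: "m < N" for m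
    proof -
      have "has_moment D (col_jump 1) (q * cp (P m)) (2 * pi * \<i> * (if 1 = (1::nat) then poly (cp (P m)) x else 0))"
        by (rule ip_moment[OF x _ one _ q(1)]) (use m degree_P in \<open>auto simp: col_order_def\<close>)
      from has_moment_add[OF ray_continuous_col_jump this has_moment_smult[OF kernel_poly_exp_moment[OF m], of "- (2 * pi * \<i>)" x]]
      show ?thesis by (simp add: d_def left_diff_distrib)
    qed
    show "has_moment D (col_jump c) d 0" if c: "2 \<le> c" "c < D" for c
    proof -
      have "has_moment D (col_jump c) (q * 1) (2 * pi * \<i> * (if c = 1 then poly 1 x else 0))"
        by (rule ip_moment[OF x _ _ _ q(1)]) (use c in \<open>auto simp: col_order_def\<close>)
      then have "has_moment D (col_jump c) q 0" using c by simp
      from has_moment_add[OF ray_continuous_col_jump this has_moment_smult[OF kernel_poly_weight_moment[OF c], of "- (2 * pi * \<i>)" x]]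
      show ?thesis by (simp add: d_def)
    qed
  qed
  then have "poly d y = 0" by simp
  then have "poly q y = 2 * pi * \<i> * sobolev_kernel V lam P N x y" by (simp add: d_def poly_kernel_poly)
  moreover have "(\<Sum>i<D. poly (inv_row i) x * poly (first_col i) y) = (y - x) * poly q y"
    unfolding poly_ip_poly[symmetric] q(1) by (simp add: algebra_simps)
  ultimately show ?thesis by simp
qed

text \<open>Both sides are polynomials in \<open>x\<close>, and the complement of the rays is infinite.\<close>

lemma kernel_identity:
  "(\<Sum>i<D. poly (inv_row i) x * poly (first_col i) y) = 2 * pi * \<i> * (y - x) * sobolev_kernel V lam P N x y"
proof -
  let ?l = "\<Sum>i<D. Polynomial.smult (poly (first_col i) y) (inv_row i)"
  let ?r = "Polynomial.smult (2 * pi * \<i>) ([:y, -1:] * (\<Sum>n<N. Polynomial.smult (poly (op_P n) y / norm_P n) (cp (P n))))"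
  have l: "poly ?l z = (\<Sum>i<D. poly (inv_row i) z * poly (first_col i) y)" for z by (simp add: poly_sum mult.commute)
  have "poly (\<Sum>n<N. Polynomial.smult (poly (op_P n) y / norm_P n) (cp (P n))) z = sobolev_kernel V lam P N z y" for z
    unfolding poly_kernel_poly[symmetric] kernel_poly_def poly_sum poly_smult
    by (intro sum.cong refl) simp
  then have r: "poly ?r z = 2 * pi * \<i> * (y - z) * sobolev_kernel V lam P N z y" for z
    unfolding poly_smult poly_mult by (simp add: mult.assoc)
  have "?l = ?r"
    by (rule poly_eq_off_rays[OF D2]) (unfold l r, rule kernel_identity_off_rays)
  then show ?thesis using l[of x] r[of x] by metis
qed

lemma kernel_formula:
  assumes "x \<noteq> y"
  shows "sobolev_kernel V lam P N x y = - (1 / (2 * of_real pi * \<i>)) * (inverse_product_21 D A x y / (x - y))"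
proof -
  have xy: "x - y \<noteq> 0" using assms by simp
  have "inverse_product_21 D A x y = - (2 * pi * \<i> * sobolev_kernel V lam P N x y) * (x - y)"
    unfolding inverse_product_21_poly kernel_identity by (simp add: algebra_simps)
  then have "inverse_product_21 D A x y / (x - y) = - (2 * pi * \<i> * sobolev_kernel V lam P N x y)"
    using xy by simp
  then show ?thesis by simp
qed

end

end

theorem theorem2p43:
  fixes D N :: nat
    and lam \<gamma> \<rho> :: real
    and V :: "real poly"
    and P :: "nat \<Rightarrow> real poly"
    and \<phi> \<psi> :: "complex \<Rightarrow> complex"
    and F :: "nat \<Rightarrow> complex \<Rightarrow> complex"
    and A :: "complex \<Rightarrow> complex mat"
    and x y :: complex
  assumes "even D" and "D \<ge> 4" and "lam > 0"
    and "Polynomial.degree V = D" and "Polynomial.lead_coeff V = \<gamma>" and "\<gamma> > 0"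
    and "monic_sobolev_ops V lam P"
    and "sibuya_coordinate D \<gamma> V \<rho> \<phi> \<psi>"
    and "\<forall>k<2*D. sibuya_solution D V lam \<rho> \<psi> k (F k)"
    and "N \<ge> 1"
    and "rh_solution D V lam F N A"
    and "x \<noteq> y"
  shows "sobolev_kernel V lam P N x y
    = - (1 / (2 * of_real pi * \<i>)) * (inverse_product_21 D A x y / (x - y))"
proof -
  have sd: "sibuya_data D lam \<gamma> \<rho> V \<phi> \<psi> F"
    by (rule sibuya_data.intro) (use assms(1-6,8,9) in simp_all)
  note rh = assms(11)[unfolded rh_solution_def]
  note carrier = rh[THEN conjunct1, rule_format]
  note holo = rh[THEN conjunct2, THEN conjunct1, rule_format]
  note near0 = rh[THEN conjunct2, THEN conjunct2, THEN conjunct2, THEN conjunct1]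
  obtain Ap Am where jump:
    "\<forall>x \<in> rays D - {0}. Ap x \<in> carrier_mat D D \<and> Am x \<in> carrier_mat D D \<and> Ap x = Am x * jump_matrix D V lam F x"
    and cont: "\<forall>i<D. \<forall>j<D. continuous_on (rays D - {0}) (\<lambda>x. Ap x $$ (i, j)) \<and> continuous_on (rays D - {0}) (\<lambda>x. Am x $$ (i, j))"
    and lims: "\<forall>k<D. \<forall>x \<in> ray D k - {0}. \<forall>i<D. \<forall>j<D.
            ((\<lambda>z. A z $$ (i, j)) \<longlongrightarrow> Ap x $$ (i, j)) (at x within left_side D k) \<and>
            ((\<lambda>z. A z $$ (i, j)) \<longlongrightarrow> Am x $$ (i, j)) (at x within right_side D k)"
    using rh[THEN conjunct2, THEN conjunct2, THEN conjunct1] by (elim exE conjE) (rule that)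
  obtain R where R: "\<forall>z \<in> - rays D. R z \<in> carrier_mat D D \<and> A z = (1\<^sub>m D + R z) * growth_matrix D N z"
    and RO: "\<forall>i<D. \<forall>j<D. (\<lambda>z. R z $$ (i, j)) \<in> O[inf at_infinity (principal (- rays D))](\<lambda>z. 1 / z)"
    using rh[THEN conjunct2, THEN conjunct2, THEN conjunct2, THEN conjunct2] by (elim exE conjE) (rule that)
  have "rh_data_axioms D lam V F N A Ap Am R"
  proof (rule rh_data_axioms.intro)
    show "1 \<le> N" by (rule assms(10))
    show "A z \<in> carrier_mat D D" if "z \<in> - rays D" for z by (rule carrier[OF that])
    show "(\<lambda>z. A z $$ (i, j)) holomorphic_on - rays D" if "i < D" "j < D" for i j by (rule holo[OF that])
    show "Ap u \<in> carrier_mat D D" if "u \<in> rays D - {0}" for u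
      by (rule bspec[OF jump that, THEN conjunct1])
    show "Am u \<in> carrier_mat D D" if "u \<in> rays D - {0}" for u
      by (rule bspec[OF jump that, THEN conjunct2, THEN conjunct1])
    show "Ap u = Am u * jump_matrix D V lam F u" if "u \<in> rays D - {0}" for u
      by (rule bspec[OF jump that, THEN conjunct2, THEN conjunct2])
    show "continuous_on (rays D - {0}) (\<lambda>x. Ap x $$ (i, j))" if "i < D" "j < D" for i j
      by (rule cont[rule_format, OF that, THEN conjunct1])
    show "continuous_on (rays D - {0}) (\<lambda>x. Am x $$ (i, j))" if "i < D" "j < D" for i j
      by (rule cont[rule_format, OF that, THEN conjunct2])
    show "((\<lambda>z. A z $$ (i, j)) \<longlongrightarrow> Ap u $$ (i, j)) (at u within left_side D k)"
      if "k < D" "u \<in> ray D k - {0}" "i < D" "j < D" for k u i j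
      by (rule lims[THEN spec, THEN mp, THEN bspec, THEN spec, THEN mp, THEN spec, THEN mp, THEN conjunct1, OF that])
    show "((\<lambda>z. A z $$ (i, j)) \<longlongrightarrow> Am u $$ (i, j)) (at u within right_side D k)"
      if "k < D" "u \<in> ray D k - {0}" "i < D" "j < D" for k u i j
      by (rule lims[THEN spec, THEN mp, THEN bspec, THEN spec, THEN mp, THEN spec, THEN mp, THEN conjunct2, OF that])
    show "bounded_near_0 D (\<lambda>z. A z $$ (i, j))" if "i < D" "j < D" for i j
      using near0 that unfolding bounded_near_0_def by blast
    show "R z \<in> carrier_mat D D" "A z = (1\<^sub>m D + R z) * growth_matrix D N z" if "z \<in> - rays D" for z
      by (rule bspec[OF R that, THEN conjunct1], rule bspec[OF R that, THEN conjunct2])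
    show "(\<lambda>z. R z $$ (i, j)) \<in> O[inf at_infinity (principal (- rays D))](\<lambda>z. 1 / z)" if "i < D" "j < D" for i j
      by (rule RO[rule_format, OF that])
  qed
  then interpret rh_data D lam \<gamma> \<rho> V \<phi> \<psi> F N A Ap Am R
    by (rule rh_data.intro[OF sd])
  show ?thesis by (rule kernel_formula[OF assms(7,12)])
qed

end
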